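(* Let $d=2m$, where $m$ is an odd integer with $m\ge 3$. (i) If $K\in\{\mathbb{Q}_2(\sqrt{2}),\mathbb{Q}_2(\sqrt{10}),\mathbb{Q}_2(\sqrt{-2}),\mathbb{Q}_2(\sqrt{-10})\}$, then $\Gamma^*(d,K)=\frac{3}{2}d$. (ii) If $K\in\{\mathbb{Q}_2(\sqrt{-1}),\mathbb{Q}_2(\sqrt{-5})\}$, then $\Gamma^*(d,K)=d+1$.
   Context: An additive form of degree $d$ over a field $K$ is a polynomial $a_1x_1^d+\dots+a_sx_s^d$ with $a_i\in K$. A nontrivial zero is a point $(x_1,\dots,x_s)\in K^s$, not all $x_i$ zero, at which the form vanishes. $\Gamma^*(d,K)$ denotes the minimal number $s$ of variables such that every additive form of degree $d$ in $s$ variables with coefficients in $K$ has a nontrivial zero in $K$. *)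

theory Defs
  imports "HOL-Computational_Algebra.Computational_Algebra"
begin

definition abs2 :: "rat \<Rightarrow> real" where
  "abs2 q = (if q = 0 then 0 else
     (let (n, d) = quotient_of q in
        2 powr (real (multiplicity (2::int) d) - real (multiplicity (2::int) n))))"

text \<open>2-adic Cauchy sequences of rationals (they represent the elements of Q_2)
  and 2-adic null sequences (they represent 0 in Q_2).\<close>
definition cauchy2 :: "(nat \<Rightarrow> rat) \<Rightarrow> bool" where
  "cauchy2 X \<longleftrightarrow> (\<forall>e>0. \<exists>N. \<forall>m\<ge>N. \<forall>n\<ge>N. abs2 (X m - X n) < e)"

definition null2 :: "(nat \<Rightarrow> rat) \<Rightarrow> bool" where
  "null2 X \<longleftrightarrow> (\<forall>e>0. \<exists>N. \<forall>n\<ge>N. abs2 (X n) < e)"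

text \<open>An element of K = Q_2(sqrt a) (a a non-square integer in Q_2) is written
  u + v sqrt a with u, v in Q_2; we represent it by a pair of 2-adic Cauchy
  sequences (u, v). Two representatives give the same element of K iff their
  difference is null in both components.\<close>
type_synonym qelem = "(nat \<Rightarrow> rat) \<times> (nat \<Rightarrow> rat)"

definition qvalid :: "qelem \<Rightarrow> bool" where
  "qvalid x \<longleftrightarrow> cauchy2 (fst x) \<and> cauchy2 (snd x)"

definition qzero_el :: "qelem \<Rightarrow> bool" where
  "qzero_el x \<longleftrightarrow> null2 (fst x) \<and> null2 (snd x)"

definition qone :: qelem where
  "qone = ((\<lambda>_. 1), (\<lambda>_. 0))"

definition qadd :: "qelem \<Rightarrow> qelem \<Rightarrow> qelem" where
  "qadd x y = ((\<lambda>n. fst x n + fst y n), (\<lambda>n. snd x n + snd y n))"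

definition qnull :: qelem where
  "qnull = ((\<lambda>_. 0), (\<lambda>_. 0))"

definition qmul :: "int \<Rightarrow> qelem \<Rightarrow> qelem \<Rightarrow> qelem" where
  "qmul a x y = ((\<lambda>n. fst x n * fst y n + of_int a * snd x n * snd y n),
                 (\<lambda>n. fst x n * snd y n + snd x n * fst y n))"

definition qpow :: "int \<Rightarrow> qelem \<Rightarrow> nat \<Rightarrow> qelem" where
  "qpow a x k = ((qmul a x) ^^ k) qone"

definition addform :: "int \<Rightarrow> nat \<Rightarrow> nat \<Rightarrow> (nat \<Rightarrow> qelem) \<Rightarrow> (nat \<Rightarrow> qelem) \<Rightarrow> qelem" where
  "addform a d s c x = foldr (\<lambda>i acc. qadd (qmul a (c i) (qpow a (x i) d)) acc) [0..<s] qnull"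

definition all_forms_isotropic :: "int \<Rightarrow> nat \<Rightarrow> nat \<Rightarrow> bool" where
  "all_forms_isotropic a d s \<longleftrightarrow>
     (\<forall>c. (\<forall>i<s. qvalid (c i)) \<longrightarrow>
        (\<exists>x. (\<forall>i<s. qvalid (x i)) \<and> (\<exists>i<s. \<not> qzero_el (x i)) \<and>
             qzero_el (addform a d s c x)))"

definition Gamma_star :: "int \<Rightarrow> nat \<Rightarrow> nat" where
  "Gamma_star a d = (LEAST s. all_forms_isotropic a d s)"

end

theory Submission
  imports Defs
begin

text \<open>Let \<open>\<pi>\<close> be a uniformizer of \<open>K\<close>. Its residue field has two elements, \<open>2 = \<pi>\<^sup>2 + \<epsilon> \<pi>\<^sup>3\<close> modulo \<open>\<pi>\<^sup>4\<close>
  with \<open>\<epsilon> = 0\<close> in (i) and \<open>\<epsilon> = 1\<close> in (ii), and as \<open>m\<close> is odd the \<open>d\<close>-th powers of units are the squares of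
  units: modulo \<open>\<pi>\<^sup>4\<close> only \<open>1\<close> and \<open>1 + \<pi>\<^sup>2 + \<pi>\<^sup>3\<close>. A coefficient is thus a unit at a level in \<open>\<int>/d\<close>. Two
  variables of the same level contract to a variable of a higher level, and by Hensel's lemma a contraction
  that climbs five levels gives a nontrivial zero. How far a contraction climbs depends on two bits of a unit,
  its type (the digit of \<open>\<pi>\<close>) and its class: units of different type climb one level, units of the same type
  climb two levels or, alternatively, three (a bad pair) or at least four (a good pair).

  If no contraction climbs five levels, the levels split into blocks which carry on average at most \<open>3/2\<close>
  variables in (i) and at most one in (ii). In (i) the average is attained only by the pattern
  \<open>3, 0, 3, 0, \<dots>\<close> with alternating types, which cannot close up since \<open>m\<close> is odd. The variant
  \<open>4, 0, 3, 0, \<dots>, 3, 0, 1, 0\<close> gives an anisotropic form in \<open>3 m - 1\<close> variables; in (ii) the form with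
  coefficients \<open>1, \<pi>, \<dots>, \<pi>\<^bsup>d - 1\<^esup>\<close> is anisotropic.\<close>

section \<open>Contraction of variables\<close>

text \<open>Five is 3 + 2: replacing a unit y by y + \<open>\<pi> ^ j\<close> changes its d-th power
  by order exactly j + 2 as soon as j >= 3. The bound m >= 3 gives d >= 6, so a set of variables
  spanning at most five unrolled levels never uses one variable at two levels. Two units x, y of
  equal type allow two different climbs because the nontrivial d-th power \<open>\<sigma>\<close> =
  1 + \<open>\<pi> ^ 2\<close> + \<open>\<pi> ^ 3\<close> + ... is available: exactly one of x + y
  and x + \<open>\<sigma>\<close> y has order two. The obstacle in the upper bounds is that single
  blocks can exceed the average. An excess along the unrolled levels therefore plays the part of a
  potential. In (ii) it grows by one per period, which the blocks forbid; in (i) it is periodic, so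
  the extremal pattern has to be excluded on its own. K never appears as a field. The algebra takes
  place in the dense subfield Q(sqrt a) of the complex numbers, which has the right residues modulo
  powers of \<open>\<pi>\<close>; elements of K are sequences there, and statements about them hold
  for all large indices.\<close>

lemma card_ge_2D: "2 \<le> card S \<Longrightarrow> \<exists>a\<in>S. \<exists>b\<in>S. a \<noteq> b"
  by (metis One_nat_def Suc_1 card.infinite card_le_Suc0_iff_eq not_less_eq_eq zero_le)

lemma card_ge_3D:
  assumes "3 \<le> card S"
  shows "\<exists>a\<in>S. \<exists>b\<in>S. \<exists>c\<in>S. a \<noteq> b \<and> a \<noteq> c \<and> b \<noteq> c"
proof -
  obtain S' where "S' \<subseteq> S" "card S' = 3" by (metis assms obtain_subset_with_card_n)
  then show ?thesis by (auto simp: card_3_iff)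
qed

lemma card_ge_4D:
  assumes "4 \<le> card S"
  shows "\<exists>a\<in>S. \<exists>b\<in>S. \<exists>c\<in>S. \<exists>d\<in>S. distinct [a, b, c, d]"
proof -
  obtain a where a: "a \<in> S" using assms by fastforce
  have "3 \<le> card (S - {a})" using assms a by (simp add: card_Diff_singleton)
  from card_ge_3D[OF this] show ?thesis using a by fastforce
qed

lemma card_less_obtain: "finite F \<Longrightarrow> card F < card S \<Longrightarrow> \<exists>z\<in>S. z \<notin> F"
  by (meson card_mono not_le subsetI)

text \<open>Here \<open>node B l t c\<close> says that the variables in \<open>B\<close> can be given unit values such that their terms sum to
  \<open>\<pi>\<^sup>l x\<close> for a unit \<open>x\<close> of type \<open>t\<close> and class \<open>c\<close>, and \<open>big B l\<close> that they can sum to a multiple of \<open>\<pi>\<^sup>l\<close>.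
  Levels are unrolled from \<open>\<int>/d\<close> to the natural numbers.\<close>

locale contraction =
  fixes I :: "'b set" and lv :: "'b \<Rightarrow> nat" and ty cl :: "'b \<Rightarrow> bool"
    and node :: "'b set \<Rightarrow> nat \<Rightarrow> bool \<Rightarrow> bool \<Rightarrow> bool"
    and big :: "'b set \<Rightarrow> nat \<Rightarrow> bool" and \<epsilon> :: bool
  assumes finite_level: "finite {b \<in> I. lv b = k}"
    and node_item: "b \<in> I \<Longrightarrow> node {b} (lv b) (ty b) (cl b)"
    and node_big: "node B l t c \<Longrightarrow> i \<le> l \<Longrightarrow> big B i"
    and node_diff: "node B l t c \<Longrightarrow> node B' l (\<not> t) c' \<Longrightarrow> B \<inter> B' = {} \<Longrightarrow>
        \<exists>c''. node (B \<union> B') (l + 1) t'' c''"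
    and node_bad: "node B l t c \<Longrightarrow> node B' l t c' \<Longrightarrow> B \<inter> B' = {} \<Longrightarrow> (c = c') = (\<not> \<epsilon>) \<Longrightarrow>
        (\<exists>c''. node (B \<union> B') (l + 2) t c'') \<and> (\<exists>t'' c''. node (B \<union> B') (l + 3) t'' c'')"
    and node_good: "node B l t c \<Longrightarrow> node B' l t c' \<Longrightarrow> B \<inter> B' = {} \<Longrightarrow> (c = c') = \<epsilon> \<Longrightarrow>
        (\<exists>c''. node (B \<union> B') (l + 2) (\<not> t) c'') \<and>
        (big (B \<union> B') (l + 5) \<or> (\<exists>t'' c''. node (B \<union> B') (l + 4) t'' c''))"
    and big_mono: "big B l \<Longrightarrow> i \<le> l \<Longrightarrow> big B i"
    and aniso: "big B (k + 5) \<Longrightarrow> \<forall>b\<in>B. k \<le> lv b \<and> lv b < k + 5 \<Longrightarrow> \<forall>b\<in>B. lv b \<noteq> k"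
begin

definition V :: "nat \<Rightarrow> 'b set" where "V k = {b \<in> I. lv b = k}"

definition T :: "nat \<Rightarrow> bool \<Rightarrow> 'b set" where "T k t = {b \<in> V k. ty b = t}"

definition nd :: "'b set \<Rightarrow> nat \<Rightarrow> bool \<Rightarrow> bool" where "nd B l t \<longleftrightarrow> (\<exists>c. node B l t c)"

text \<open>The shape of a set of variables to which \<open>aniso\<close> applies: such a set must
  not reach level k + 5.\<close>

definition window :: "nat \<Rightarrow> 'b set \<Rightarrow> bool" where
  "window k B \<longleftrightarrow> (\<forall>b\<in>B. k \<le> lv b \<and> lv b < k + 5) \<and> (\<exists>b\<in>B. lv b = k)"

definition bad :: "'b \<Rightarrow> 'b \<Rightarrow> bool" where "bad a b \<longleftrightarrow> (cl a = cl b) = (\<not> \<epsilon>)"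

text \<open>The state forced on a level that receives a contraction from below (see
  \<open>carry\<close>). Blocks that start at such a level obey sharper bounds.\<close>

definition stable :: "nat \<Rightarrow> bool" where
  "stable k \<longleftrightarrow> (\<exists>t. T k t = {}) \<and> (V k \<noteq> {} \<longrightarrow> V (k + 1) = {})"

section \<open>Constraints on the levels that contractions reach\<close>

lemma V_D: "b \<in> V k \<Longrightarrow> b \<in> I \<and> lv b = k"
  by (simp add: V_def)

lemma T_D: "b \<in> T k t \<Longrightarrow> b \<in> V k \<and> b \<in> I \<and> lv b = k \<and> ty b = t"
  by (simp add: T_def V_def)

lemma V_T: "b \<in> V k \<Longrightarrow> b \<in> T k (ty b)"
  by (simp add: T_def)

lemma no_big: "big B l \<Longrightarrow> window k B \<Longrightarrow> k + 5 \<le> l \<Longrightarrow> False"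
  using aniso[of B k] big_mono[of B l "k + 5"] by (auto simp: window_def)

lemma nd_item: "b \<in> V k \<Longrightarrow> nd {b} k (ty b)"
  using node_item[of b] by (auto simp: nd_def V_def)

lemma nd_lt: "nd B l t \<Longrightarrow> window k B \<Longrightarrow> l < k + 5"
  using no_big[of B l k] node_big[of B l t _ l] by (auto simp: nd_def not_le[symmetric])

lemma nd_diff:
  "nd B l t \<Longrightarrow> nd B' l t' \<Longrightarrow> t \<noteq> t' \<Longrightarrow> B \<inter> B' = {} \<Longrightarrow> nd (B \<union> B') (l + 1) t''"
  using node_diff[of B l t _ B' _ t''] by (cases t; cases t') (auto simp: nd_def)

lemma node_same_big:
  assumes "node B l t c" "node B' l t c'" "B \<inter> B' = {}"
  shows "big (B \<union> B') (l + 3)"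
proof (cases "(c = c') = \<epsilon>")
  case True
  then consider "big (B \<union> B') (l + 5)" | t'' c'' where "node (B \<union> B') (l + 4) t'' c''"
    using node_good[OF assms] by blast
  then show ?thesis by cases (auto intro: big_mono node_big)
next
  case False
  then obtain t'' c'' where "node (B \<union> B') (l + 3) t'' c''" using node_bad[OF assms] by blast
  then show ?thesis by (auto intro: node_big)
qed

text \<open>Equal types climb at least three levels by some choice of values, and l >= k + 2 then
  means reaching level k + 5.\<close>

lemma clash:
  assumes "nd B l t" "nd B' l t'" "B \<inter> B' = {}" "window k (B \<union> B')" "k + 2 \<le> l"
  shows "t' = (\<not> t)"
proof (rule ccontr)
  assume "t' \<noteq> (\<not> t)"
  then have "t' = t" by blast
  then have "big (B \<union> B') (l + 3)" using assms(1-3) node_same_big by (auto simp: nd_def)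
  then show False using no_big[OF _ assms(4)] assms(5) by force
qed

lemma clash_any:
  assumes "nd B l t" "nd B' l t'" "B \<inter> B' = {}" "window k (B \<union> B')" "k + 2 \<le> l"
  shows "nd (B \<union> B') (l + 1) s"
  using nd_diff[OF assms(1,2) _ assms(3)] clash[OF assms] by blast

text \<open>On the top level of the window even a climb by one level is fatal, so the types do not
  matter.\<close>

lemma clash_4:
  assumes "nd B (k + 4) t" "nd B' (k + 4) t'" "B \<inter> B' = {}" "window k (B \<union> B')"
  shows False
  using clash_any[OF assms, of t] nd_lt[OF _ assms(4), of "k + 4 + 1" t] by simp

text \<open>A contraction that lands in level l from below acts like a further variable there, and
  by \<open>clash\<close> every variable of that level has the opposite type. Together with such a
  variable it moves on to l + 1 with a freely chosen type.\<close>

lemma carry: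
  assumes "nd B l t" "window k B" "\<forall>b\<in>B. lv b < l" "k + 2 \<le> l"
  shows "v \<in> V l \<Longrightarrow> ty v = (\<not> t)" and "T l t = {}" and "V l \<noteq> {} \<Longrightarrow> V (l + 1) = {}"
    and "stable l"
proof -
  have l: "l < k + 5" using nd_lt assms by blast
  have *: "ty v = (\<not> t) \<and> nd (B \<union> {v}) (l + 1) s" if "v \<in> V l" for v s
    using clash[OF assms(1) nd_item[OF that], of k] clash_any[OF assms(1) nd_item[OF that], of k s]
      assms l that by (auto simp: V_def window_def)
  then show "v \<in> V l \<Longrightarrow> ty v = (\<not> t)" by blast
  show t: "T l t = {}" using * by (auto simp: T_def)
  show v: "V l \<noteq> {} \<Longrightarrow> V (l + 1) = {}"
  proof -
    assume "V l \<noteq> {}"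
    then obtain v where v: "v \<in> V l" by blast
    have w: "window k (B \<union> {v})" using assms v l by (auto simp: V_def window_def)
    have l': "l + 1 < k + 5" using nd_lt[OF _ w] *[OF v] by blast
    show "V (l + 1) = {}"
    proof (rule ccontr)
      assume "V (l + 1) \<noteq> {}"
      then obtain x where x: "x \<in> V (l + 1)" by blast
      have "(B \<union> {v}) \<inter> {x} = {}" "window k (B \<union> {v} \<union> {x})"
        using assms v x w l' by (auto simp: V_def window_def)
      \<comment> \<open>The contraction can arrive with either type, so x would have to differ from
        both.\<close>
      then have "ty x = (\<not> s)" for s
        using clash[of "B \<union> {v}" "l + 1" s "{x}" "ty x" k] *[OF v] nd_item[OF x] assms(4) by simp
      then show False by blast
    qed
  qed
  show "stable l" unfolding stable_def using t v by blast
qed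

text \<open>Each contraction excludes its own type from level l; their windows may start at
  different levels.\<close>

lemma carry_both:
  assumes "nd B l t" "window k B" "\<forall>b\<in>B. lv b < l" "nd B' l (\<not> t)" "window k' B'" "\<forall>b\<in>B'. lv b < l"
    and "k + 2 \<le> l" "k' + 2 \<le> l"
  shows "V l = {}"
  using carry(1)[OF assms(1,2,3,7)] carry(1)[OF assms(4,5,6,8)] by blast

lemma carry_any:
  assumes "\<And>t. nd B l t" "window k B" "\<forall>b\<in>B. lv b < l" "k + 2 \<le> l"
  shows "V l = {}"
  using carry_both[OF assms(1)[of True] assms(2,3) _ assms(2,3)] assms(1,4) by simp

lemma carry_4:
  assumes "nd B (k + 4) t" "window k B" "\<forall>b\<in>B. lv b < k + 4"
  shows "V (k + 4) = {}"
proof (rule ccontr)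
  assume "V (k + 4) \<noteq> {}"
  then obtain v where v: "v \<in> V (k + 4)" by blast
  show False
    by (rule clash_4[OF assms(1) nd_item[OF v]]) (use assms v in \<open>auto simp: V_def window_def\<close>)
qed

section \<open>Small configurations and the levels that they empty\<close>

lemma pair_bad:
  assumes "a \<in> T k t" "b \<in> T k t" "a \<noteq> b" "bad a b"
  shows "nd {a, b} (k + 2) t" and "\<exists>t'. nd {a, b} (k + 3) t'"
  using node_bad[OF node_item[of a] , of "{b}" "cl b"] node_item[of b] assms
  by (auto simp: T_def V_def nd_def bad_def insert_commute)

lemma pair_good:
  assumes "a \<in> T k t" "b \<in> T k t" "a \<noteq> b" "\<not> bad a b"
  shows "nd {a, b} (k + 2) (\<not> t)" and "\<exists>t'. nd {a, b} (k + 4) t'"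
proof -
  have "node {a} k t (cl a)" "node {b} k t (cl b)" using node_item[of a] node_item[of b] assms by (auto dest!: T_D)
  from node_good[OF this] have *: "(\<exists>c''. node {a, b} (k + 2) (\<not> t) c'') \<and>
      (big {a, b} (k + 5) \<or> (\<exists>t'' c''. node {a, b} (k + 4) t'' c''))"
    using assms by (auto simp: bad_def insert_commute)
  show "nd {a, b} (k + 2) (\<not> t)" using * by (simp add: nd_def)
  have "window k {a, b}" using assms by (auto dest!: T_D simp: window_def)
  then show "\<exists>t'. nd {a, b} (k + 4) t'" using * no_big[of "{a, b}" "k + 5" k] by (auto simp: nd_def)
qed

lemma pair_same:
  assumes "a \<in> T k t" "b \<in> T k t" "a \<noteq> b"
  obtains t' where "nd {a, b} (k + 2) t'"
  using pair_bad[OF assms] pair_good[OF assms] by blast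

lemma pair_mixed:
  assumes "a \<in> T k t" "b \<in> T k (\<not> t)"
  shows "nd {a, b} (k + 1) s"
  using nd_diff[of "{a}" k t "{b}" "\<not> t" s] nd_item[of a k] nd_item[of b k] assms
  by (auto simp: T_def insert_commute)

text \<open>The contracted mixed pair can be given the type opposite to that of w, so the two
  contract again, once more with free type.\<close>

lemma mixed_next:
  assumes "p \<in> T k t" "q \<in> T k (\<not> t)" "w \<in> V (k + 1)"
  shows "nd ({p, q} \<union> {w}) (k + 2) s" and "V (k + 2) = {}"
proof -
  have d: "{p, q} \<inter> {w} = {}" "window k ({p, q} \<union> {w})" "\<forall>b\<in>{p, q} \<union> {w}. lv b < k + 2"
    using assms by (auto dest!: T_D V_D simp: window_def)
  show *: "nd ({p, q} \<union> {w}) (k + 2) s" for s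
    using nd_diff[OF pair_mixed[OF assms(1,2), of "\<not> ty w"] nd_item[OF assms(3)] _ d(1), of s] by simp
  show "V (k + 2) = {}" by (rule carry_any[OF * d(2,3)]) simp
qed

text \<open>If the contracted mixed pair and w were a good pair, they would climb from k + 1 to k +
  5. Being bad ties the class of w to c.\<close>

lemma mixed_next_class:
  assumes "p \<in> T k t" "q \<in> T k (\<not> t)" "w \<in> T (k + 1) s" "node {p, q} (k + 1) s c"
  shows "(c = cl w) = (\<not> \<epsilon>)"
proof (rule ccontr)
  assume a: "(c = cl w) \<noteq> (\<not> \<epsilon>)"
  have d: "{p, q} \<inter> {w} = {}" "window k ({p, q} \<union> {w})"
    using assms by (auto dest!: T_D V_D simp: window_def)
  have "node {w} (k + 1) s (cl w)" using node_item[of w] assms by (auto dest!: T_D)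
  from node_good[OF assms(4) this d(1)] a
  consider "big ({p, q} \<union> {w}) (k + 1 + 5)" | t' c' where "node ({p, q} \<union> {w}) (k + 1 + 4) t' c'" by blast
  then show False using no_big[OF _ d(2)] node_big[of "{p, q} \<union> {w}"]
    by cases force+
qed

text \<open>Now the mixed pair is given the type of w. By \<open>mixed_next_class\<close> this is a
  bad pair at level k + 1, which climbs two levels keeping its type, or three levels.\<close>

lemma mixed_next_carry:
  assumes "p \<in> T k t" "q \<in> T k (\<not> t)" "w \<in> T (k + 1) s"
  shows "nd ({p, q} \<union> {w}) (k + 3) s" and "V (k + 4) = {}" and "stable (k + 3)"
proof -
  obtain c where c: "node {p, q} (k + 1) s c"
    using pair_mixed[OF assms(1,2), of s] by (auto simp: nd_def)
  have d: "{p, q} \<inter> {w} = {}" "window k ({p, q} \<union> {w})"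
    "\<forall>b\<in>{p, q} \<union> {w}. lv b < k + 3" "\<forall>b\<in>{p, q} \<union> {w}. lv b < k + 4"
    using assms by (auto dest!: T_D V_D simp: window_def)
  have "node {w} (k + 1) s (cl w)" using node_item[of w] assms by (auto dest!: T_D)
  from node_bad[OF c this d(1) mixed_next_class[OF assms c]]
  obtain t' where n: "nd ({p, q} \<union> {w}) (k + 3) s" "nd ({p, q} \<union> {w}) (k + 4) t'"
    by (auto simp: nd_def eval_nat_numeral)
  show "nd ({p, q} \<union> {w}) (k + 3) s" by (rule n)
  show "V (k + 4) = {}" by (rule carry_4[OF n(2) d(2,4)])
  show "stable (k + 3)" by (rule carry(4)[OF n(1) d(2,3)]) simp
qed

text \<open>The mixed pair and w reach k + 2 with free type, so also with the type with which a and
  b arrive there; this contradicts \<open>clash\<close>.\<close>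

lemma mixed_same_next:
  assumes "p \<in> T k t" "q \<in> T k (\<not> t)" "w \<in> V (k + 1)"
    and "a \<in> T k s" "b \<in> T k s" "a \<noteq> b" "{a, b} \<inter> {p, q} = {}"
  shows False
proof -
  obtain t' where n: "nd {a, b} (k + 2) t'" using pair_same assms by blast
  have "t' = (\<not> t')"
    by (rule clash[OF mixed_next(1)[OF assms(1-3)] n, of k])
      (use assms in \<open>auto dest!: T_D V_D simp: window_def\<close>)
  then show False by simp
qed

lemma same_mixed_next:
  assumes "a \<in> T k s" "b \<in> T k s" "a \<noteq> b" "w \<in> T (k + 1) t" "w' \<in> T (k + 1) (\<not> t)"
  shows False
proof -
  obtain t' where n: "nd {a, b} (k + 2) t'" using pair_same assms by blast
  have n': "nd {w, w'} (k + 2) t'" using pair_mixed[OF assms(4,5), of t'] by simp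
  have "t' = (\<not> t')"
    by (rule clash[OF n n', of k]) (use assms in \<open>auto dest!: T_D V_D simp: window_def\<close>)
  then show False by simp
qed

lemma same_stable:
  assumes "a \<in> T k s" "b \<in> T k s" "a \<noteq> b"
  shows "stable (k + 2)"
proof -
  obtain t' where n: "nd {a, b} (k + 2) t'" using pair_same assms by blast
  show ?thesis by (rule carry(4)[OF n, of k]) (use assms in \<open>auto dest!: T_D V_D simp: window_def\<close>)
qed

lemma good_empty:
  assumes "a \<in> T k s" "b \<in> T k s" "a \<noteq> b" "\<not> bad a b"
  shows "V (k + 4) = {}"
proof -
  obtain t' where n: "nd {a, b} (k + 4) t'" using pair_good assms by blast
  show ?thesis by (rule carry_4[OF n]) (use assms in \<open>auto dest!: T_D V_D simp: window_def\<close>)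
qed

text \<open>Climbing two levels, a bad pair keeps its type and a good pair flips it, so both types
  arrive at k + 2.\<close>

lemma good_bad_empty:
  assumes "a \<in> T k s" "b \<in> T k s" "a \<noteq> b" "\<not> bad a b"
    and "a' \<in> T k s" "b' \<in> T k s" "a' \<noteq> b'" "bad a' b'"
  shows "V (k + 2) = {}"
  by (rule carry_both[OF pair_bad(1)[OF assms(5-8)] _ _ pair_good(1)[OF assms(1-4)], of k k])
    (use assms in \<open>auto dest!: T_D V_D simp: window_def\<close>)

text \<open>The upper pair lands on level k + 3. A variable at k + 2 would lift the lower pair to k
  + 3 in the same type. The lower pair itself can go to k + 3 when bad, where it must have the
  opposite type and thus blocks the level together with the upper pair, or to k + 4 when good, where
  it meets whatever the upper pair could pick up at k + 3.\<close>

lemma same_same_next: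
  assumes "a \<in> T k s" "b \<in> T k s" "a \<noteq> b" "w \<in> T (k + 1) t" "w' \<in> T (k + 1) t" "w \<noteq> w'"
  shows "V (k + 2) = {}" and "V (k + 3) = {}" and "V (k + 4) = {}"
proof -
  obtain t1 where n1: "nd {a, b} (k + 2) t1" using pair_same assms by blast
  obtain t2 where "nd {w, w'} (k + 1 + 2) t2" using pair_same assms by blast
  then have n2: "nd {w, w'} (k + 3) t2" by (simp add: eval_nat_numeral)
  have d: "{a, b} \<inter> {w, w'} = {}" "window k ({a, b} \<union> {w, w'})" "window k {a, b}" "window (k + 1) {w, w'}"
     "\<forall>x\<in>{a, b}. lv x < k + 2" "\<forall>x\<in>{a, b}. lv x < k + 3" "\<forall>x\<in>{w, w'}. lv x < k + 3"
     "\<forall>x\<in>{a, b} \<union> {w, w'}. lv x < k + 4"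
    using assms by (auto dest!: T_D V_D simp: window_def)
  show "V (k + 2) = {}"
  proof (rule ccontr)
    assume "V (k + 2) \<noteq> {}"
    then obtain x where x: "x \<in> V (k + 2)" by blast
    have n3: "nd ({a, b} \<union> {x}) (k + 2 + 1) t2"
      by (rule clash_any[OF n1 nd_item[OF x], of k]) (use assms x in \<open>auto dest!: T_D V_D simp: window_def\<close>)
    have n3: "nd ({a, b} \<union> {x}) (k + 3) t2" using n3 by (simp add: eval_nat_numeral)
    have "t2 = (\<not> t2)"
      by (rule clash[OF n3 n2, of k]) (use assms x in \<open>auto dest!: T_D V_D simp: window_def\<close>)
    then show False by simp
  qed
  have *: "V (k + 3) = {} \<and> V (k + 4) = {}"
  proof (cases "bad a b")
    case True
    then obtain t3 where n3: "nd {a, b} (k + 3) t3" using pair_bad assms by blast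
    have t: "t2 = (\<not> t3)" and n4: "nd ({a, b} \<union> {w, w'}) (k + 3 + 1) t2"
      by (rule clash[OF n3 n2 d(1,2)], simp) (rule clash_any[OF n3 n2 d(1,2)], simp)
    have n4: "nd ({a, b} \<union> {w, w'}) (k + 4) t2" using n4 by (simp add: eval_nat_numeral)
    show ?thesis
      using carry_both[OF n3 d(3,6) n2[unfolded t] d(4,7)] carry_4[OF n4 d(2,8)] by simp
  next
    case False
    then obtain t3 where n3: "nd {a, b} (k + 4) t3" using pair_good assms by blast
    have "V (k + 3) = {}"
    proof (rule ccontr)
      assume "V (k + 3) \<noteq> {}"
      then obtain x where x: "x \<in> V (k + 3)" by blast
      have n4: "nd ({w, w'} \<union> {x}) (k + 3 + 1) t3"
        by (rule clash_any[OF n2 nd_item[OF x], of "k + 1"]) (use assms x in \<open>auto dest!: T_D V_D simp: window_def\<close>)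
      have n4: "nd ({w, w'} \<union> {x}) (k + 4) t3" using n4 by (simp add: eval_nat_numeral)
      show False
        by (rule clash_4[OF n3 n4]) (use assms x in \<open>auto dest!: T_D V_D simp: window_def\<close>)
    qed
    then show ?thesis using good_empty assms False by blast
  qed
  then show "V (k + 3) = {}" "V (k + 4) = {}" by auto
qed

text \<open>The types of both contracted pairs at level k + 1 are free. Opposite types give level k
  + 2 in any type. Equal types form a bad pair, as a good one would reach k + 5; this gives k + 3 in
  any type, and k + 4.\<close>

lemma two_mixed:
  assumes "p \<in> T k t" "p' \<in> T k t" "p \<noteq> p'" "q \<in> T k (\<not> t)" "q' \<in> T k (\<not> t)" "q \<noteq> q'"
  shows "nd ({p, q} \<union> {p', q'}) (k + 3) s"
    and "V (k + 2) = {}" and "V (k + 3) = {}" and "V (k + 4) = {}"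
proof -
  have d: "{p, q} \<inter> {p', q'} = {}" "window k ({p, q} \<union> {p', q'})"
     "\<forall>x\<in>{p, q} \<union> {p', q'}. lv x < k + 2" "\<forall>x\<in>{p, q} \<union> {p', q'}. lv x < k + 3"
     "\<forall>x\<in>{p, q} \<union> {p', q'}. lv x < k + 4"
    using assms by (auto dest!: T_D V_D simp: window_def)
  note m = pair_mixed[OF assms(1,4)] pair_mixed[OF assms(2,5)]
  have n2: "nd ({p, q} \<union> {p', q'}) (k + 2) s" for s
    using nd_diff[OF m(1)[of True] m(2)[of False] _ d(1), of s] by (simp add: eval_nat_numeral)
  have n: "nd ({p, q} \<union> {p', q'}) (k + 3) s \<and> (\<exists>s'. nd ({p, q} \<union> {p', q'}) (k + 4) s')" for s
  proof -
    obtain c c' where c: "node {p, q} (k + 1) s c" "node {p', q'} (k + 1) s c'" using m[of s] by (auto simp: nd_def)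
    have "(c = c') = (\<not> \<epsilon>)"
    proof (rule ccontr)
      assume "(c = c') \<noteq> (\<not> \<epsilon>)"
      then consider "big ({p, q} \<union> {p', q'}) (k + 1 + 5)" | t' c' where "node ({p, q} \<union> {p', q'}) (k + 1 + 4) t' c'"
        using node_good[OF c d(1)] by blast
      then show False using no_big[OF _ d(2)] node_big[of "{p, q} \<union> {p', q'}"]
        by cases force+
    qed
    from node_bad[OF c d(1) this] show ?thesis by (auto simp: nd_def eval_nat_numeral)
  qed
  then show "nd ({p, q} \<union> {p', q'}) (k + 3) s" by blast
  show "V (k + 2) = {}" by (rule carry_any[OF n2 d(2,3)]) simp
  show "V (k + 3) = {}" by (rule carry_any[OF _ d(2,4)]) (use n in auto)
  show "V (k + 4) = {}" using carry_4[OF _ d(2,5)] n by blast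
qed

lemma two_mixed_same_next:
  assumes "p \<in> T k t" "p' \<in> T k t" "p \<noteq> p'" "q \<in> T k (\<not> t)" "q' \<in> T k (\<not> t)" "q \<noteq> q'"
    and "w \<in> V (k + 1)" "w' \<in> V (k + 1)" "w \<noteq> w'"
  shows False
proof -
  have "ty w = ty w'" using same_mixed_next[OF assms(1-3), of w "ty w" w'] assms by (auto simp: T_def)
  then have w: "w \<in> T (k + 1) (ty w)" "w' \<in> T (k + 1) (ty w)" using assms V_T by fastforce+
  obtain t2 where "nd {w, w'} (k + 1 + 2) t2" using pair_same[OF w assms(9)] by blast
  then have n2: "nd {w, w'} (k + 3) t2" by (simp add: eval_nat_numeral)
  have "t2 = (\<not> t2)"
    by (rule clash[OF two_mixed(1)[OF assms(1-6)] n2, of k]) (use assms in \<open>auto dest!: T_D V_D simp: window_def\<close>)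
  then show False by simp
qed

lemma mixed_three_next:
  assumes "p \<in> T k t" "q \<in> T k (\<not> t)" "w \<in> T (k + 1) s" "w' \<in> T (k + 1) (\<not> s)" "w'' \<in> V (k + 1)"
    "w'' \<noteq> w" "w'' \<noteq> w'"
  shows False
proof -
  have n: "nd {w, w'} (k + 2) True" using pair_mixed[OF assms(3,4), of True] by simp
  have "True = (\<not> True)"
    by (rule clash[OF mixed_next(1)[OF assms(1,2,5)] n, of k])
      (use assms in \<open>auto dest!: T_D V_D simp: window_def\<close>)
  then show False by simp
qed

text \<open>Both classes are tied to that of the contracted mixed pair, so they are equal, and equal
  classes are bad in (i) and good in (ii).\<close>

lemma mixed_same_pair_next:
  assumes "p \<in> T k t" "q \<in> T k (\<not> t)" "w \<in> T (k + 1) s" "w' \<in> T (k + 1) s"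
  shows "bad w w' \<longleftrightarrow> \<not> \<epsilon>"
proof -
  obtain c where c: "node {p, q} (k + 1) s c"
    using pair_mixed[OF assms(1,2), of s] by (auto simp: nd_def)
  show ?thesis
    using mixed_next_class[OF assms(1-3) c] mixed_next_class[OF assms(1,2,4) c] by (auto simp: bad_def)
qed

lemma good_same_empty:
  assumes "a \<in> T k s" "b \<in> T k s" "a \<noteq> b" "\<not> bad a b"
    and "x \<in> T (k + 2) t" "y \<in> T (k + 2) t" "x \<noteq> y"
  shows False
proof -
  obtain t1 where n1: "nd {a, b} (k + 4) t1" using pair_good assms by blast
  obtain t2 where "nd {x, y} (k + 2 + 2) t2" using pair_same assms by blast
  then have n2: "nd {x, y} (k + 4) t2" by (simp add: eval_nat_numeral)
  show False by (rule clash_4[OF n1 n2]) (use assms in \<open>auto dest!: T_D V_D simp: window_def\<close>)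
qed

lemma good_mixed_empty:
  assumes "a \<in> T k s" "b \<in> T k s" "a \<noteq> b" "\<not> bad a b"
    and "x \<in> T (k + 3) t" "y \<in> T (k + 3) (\<not> t)"
  shows False
proof -
  obtain t1 where n1: "nd {a, b} (k + 4) t1" using pair_good assms by blast
  have n2: "nd {x, y} (k + 4) t1" using pair_mixed[OF assms(5,6), of t1] by (simp add: eval_nat_numeral)
  show False by (rule clash_4[OF n1 n2]) (use assms in \<open>auto dest!: T_D V_D simp: window_def\<close>)
qed

lemma good_good:
  assumes "a \<in> T k s" "b \<in> T k s" "a \<noteq> b" "\<not> bad a b"
    and "x \<in> T k t" "y \<in> T k t" "x \<noteq> y" "\<not> bad x y" "{a, b} \<inter> {x, y} = {}"
  shows False
proof -
  obtain t1 where n1: "nd {a, b} (k + 4) t1" using pair_good assms by blast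
  obtain t2 where n2: "nd {x, y} (k + 4) t2" using pair_good assms by blast
  show False by (rule clash_4[OF n1 n2]) (use assms in \<open>auto dest!: T_D V_D simp: window_def\<close>)
qed

lemma bad_bad:
  assumes "a \<in> T k s" "b \<in> T k s" "a \<noteq> b" "bad a b"
    and "x \<in> T k s" "y \<in> T k s" "x \<noteq> y" "bad x y" "{a, b} \<inter> {x, y} = {}"
  shows False
proof -
  have "s = (\<not> s)"
    by (rule clash[OF pair_bad(1)[OF assms(1-4)] pair_bad(1)[OF assms(5-8)], of k])
      (use assms in \<open>auto dest!: T_D V_D simp: window_def\<close>)
  then show False by simp
qed

text \<open>The two pairs arrive at k + 2 with opposite types, so a third pair would clash with one
  of them. Contracted together they reach k + 3 with free type, which excludes a pair from level k +
  1.\<close>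

lemma good_bad_same:
  assumes "a \<in> T k s" "b \<in> T k s" "a \<noteq> b" "\<not> bad a b"
    and "x \<in> T k s" "y \<in> T k s" "x \<noteq> y" "bad x y" "{a, b} \<inter> {x, y} = {}"
  shows "c \<in> T k t \<Longrightarrow> e \<in> T k t \<Longrightarrow> c \<noteq> e \<Longrightarrow> {c, e} \<inter> {a, b, x, y} = {} \<Longrightarrow> False"
    and "nd ({a, b} \<union> {x, y}) (k + 3) t'"
    and "V (k + 2) = {}" and "V (k + 3) = {}" and "V (k + 4) = {}"
    and "w \<in> V (k + 1) \<Longrightarrow> w' \<in> V (k + 1) \<Longrightarrow> w \<noteq> w' \<Longrightarrow> False"
proof -
  note n = pair_good(1)[OF assms(1-4)] pair_bad(1)[OF assms(5-8)]
  show False if c: "c \<in> T k t" "e \<in> T k t" "c \<noteq> e" "{c, e} \<inter> {a, b, x, y} = {}"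
  proof -
    obtain t2 where n2: "nd {c, e} (k + 2) t2" using pair_same c by blast
    have "t2 = (\<not> \<not> s)"
      by (rule clash[OF n(1) n2, of k]) (use assms c in \<open>auto dest!: T_D V_D simp: window_def\<close>)
    moreover have "t2 = (\<not> s)"
      by (rule clash[OF n(2) n2, of k]) (use assms c in \<open>auto dest!: T_D V_D simp: window_def\<close>)
    ultimately show False by simp
  qed
  have n3: "nd ({a, b} \<union> {x, y}) (k + 2 + 1) t'" for t'
    by (rule clash_any[OF n, of k]) (use assms in \<open>auto dest!: T_D V_D simp: window_def\<close>)
  then show n3: "nd ({a, b} \<union> {x, y}) (k + 3) t'" for t' by (simp add: eval_nat_numeral)
  show "V (k + 2) = {}" using good_bad_empty assms by blast
  show "V (k + 4) = {}" using good_empty assms by blast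
  show "V (k + 3) = {}"
    by (rule carry_any[OF n3, of k]) (use assms in \<open>auto dest!: T_D V_D simp: window_def\<close>)
  show False if w: "w \<in> V (k + 1)" "w' \<in> V (k + 1)" "w \<noteq> w'"
  proof -
    have "ty w = ty w'" using same_mixed_next[OF assms(1-3), of w "ty w" w'] w by (auto simp: T_def)
    then have w2: "w \<in> T (k + 1) (ty w)" "w' \<in> T (k + 1) (ty w)" using w V_T by fastforce+
    obtain t2 where "nd {w, w'} (k + 1 + 2) t2" using pair_same[OF w2 w(3)] by blast
    then have n2: "nd {w, w'} (k + 3) t2" by (simp add: eval_nat_numeral)
    have "t2 = (\<not> t2)"
      by (rule clash[OF n3 n2, of k]) (use assms w in \<open>auto dest!: T_D V_D simp: window_def\<close>)
    then show False by simp
  qed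
qed

section \<open>Numbers of variables per level\<close>

definition n :: "nat \<Rightarrow> nat" where "n k = card (V k)"

definition sm :: "nat \<Rightarrow> nat \<Rightarrow> nat" where "sm k l = (\<Sum>i<l. n (k + i))"

lemma sm_simps:
  "sm k (Suc 0) = n k" "sm k 2 = n k + n (k + 1)" "sm k 3 = n k + n (k + 1) + n (k + 2)"
  "sm k 5 = n k + n (k + 1) + n (k + 2) + n (k + 3) + n (k + 4)"
  "sm k 6 = n k + n (k + 1) + n (k + 2) + n (k + 3) + n (k + 4) + n (k + 5)"
  by (simp_all add: sm_def eval_nat_numeral)

lemma finite_V [simp]: "finite (V k)"
  unfolding V_def by (rule finite_level)

lemma n_0: "n k = 0 \<longleftrightarrow> V k = {}"
  by (simp add: n_def)

lemma n_T: "n k = card (T k t) + card (T k (\<not> t))"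
proof -
  have "V k = T k t \<union> T k (\<not> t)" "T k t \<inter> T k (\<not> t) = {}" by (auto simp: T_def)
  then show ?thesis unfolding n_def
    by (metis card_Un_disjoint finite_Un finite_V)
qed

lemma mono_card: "T k t = {} \<Longrightarrow> card (T k (\<not> t)) = n k"
  using n_T[of k t] by simp

text \<open>Two disjoint bad pairs collide, and so do two disjoint good ones; hence, whatever
  \<open>\<epsilon>\<close> is, two disjoint pairs cannot both have equal classes. If both had
  unequal classes, regrouping the four would produce two pairs with equal classes. So four variables
  of one type split 3 : 1 by class.\<close>

lemma same_class:
  assumes "a \<in> T k t" "b \<in> T k t" "x \<in> T k t" "y \<in> T k t" "distinct [a, b, x, y]"
  shows "(cl a = cl b) \<noteq> (cl x = cl y)"
proof -
  have *: False if "a \<in> T k t" "b \<in> T k t" "x \<in> T k t" "y \<in> T k t" "distinct [a, b, x, y]"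
    "cl a = cl b" "cl x = cl y" for a b x y
    using bad_bad[of a k t b x y] good_good[of a k t b x t y] that unfolding bad_def by auto
  from *[of a b x y] *[of a x b y] *[of a y b x] show ?thesis using assms by auto
qed

lemma four_same:
  assumes "4 \<le> card (T k t)"
  shows "V (k + 2) = {}" "V (k + 3) = {}" "V (k + 4) = {}" "n (k + 1) \<le> 1" "card (T k (\<not> t)) \<le> 1"
    "card (T k t) = 4" "\<exists>B. (\<forall>b\<in>B. b \<in> V k) \<and> B \<noteq> {} \<and> (\<forall>s. nd B (k + 3) s)"
proof -
  obtain a b x y where i: "a \<in> T k t" "b \<in> T k t" "x \<in> T k t" "y \<in> T k t" "distinct [a, b, x, y]"
    using card_ge_4D[OF assms] by blast
  obtain a b x y where g: "a \<in> T k t" "b \<in> T k t" "a \<noteq> b" "\<not> bad a b"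
    "x \<in> T k t" "y \<in> T k t" "x \<noteq> y" "bad x y" "{a, b} \<inter> {x, y} = {}"
  proof (cases "bad a b")
    case True
    show ?thesis by (rule that[of x y a b]) (use i True same_class[OF i] in \<open>unfold bad_def, auto\<close>)
  next
    case False
    show ?thesis by (rule that[of a b x y]) (use i False same_class[OF i] in \<open>unfold bad_def, auto\<close>)
  qed
  note * = good_bad_same[OF g]
  show "V (k + 2) = {}" "V (k + 3) = {}" "V (k + 4) = {}" by (rule *)+
  show "n (k + 1) \<le> 1"
    using *(6) card_ge_2D[of "V (k + 1)"] by (force simp: n_def)
  show "card (T k (\<not> t)) \<le> 1"
  proof (rule ccontr)
    assume "\<not> card (T k (\<not> t)) \<le> 1"
    then obtain c e where c: "c \<in> T k (\<not> t)" "e \<in> T k (\<not> t)" "c \<noteq> e"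
      using card_ge_2D[of "T k (\<not> t)"] by auto
    then show False using *(1)[OF c] g by (auto simp: T_def)
  qed
  show "card (T k t) = 4"
  proof (rule ccontr)
    assume "card (T k t) \<noteq> 4"
    then have "5 \<le> card (T k t)" using assms by simp
    then have "card {a, b, x, y} < card (T k t)" by (simp add: card_insert_if)
    then obtain z where z: "z \<in> T k t" "z \<notin> {a, b, x, y}" using card_less_obtain[of "{a, b, x, y}" "T k t"] by auto
    \<comment> \<open>Any four of the five would have to split 3 : 1 by class, which no division of
      five variables into two classes achieves.\<close>
    have "distinct [a, b, x, y]" "distinct [a, b, x, z]" "distinct [a, b, y, z]"
      "distinct [a, x, y, z]" "distinct [b, x, y, z]" using g z by auto
    then have "(cl a = cl b) \<noteq> (cl x = cl y)" "(cl a = cl b) \<noteq> (cl x = cl z)" "(cl a = cl b) \<noteq> (cl y = cl z)"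
      "(cl a = cl x) \<noteq> (cl y = cl z)" "(cl b = cl x) \<noteq> (cl y = cl z)"
      using g(1,2,5,6) z(1) by (simp_all only: same_class not_False_eq_True)
    then show False by argo
  qed
  show "\<exists>B. (\<forall>b\<in>B. b \<in> V k) \<and> B \<noteq> {} \<and> (\<forall>s. nd B (k + 3) s)"
    by (rule exI[of _ "{a, b} \<union> {x, y}"]) (use *(2) g in \<open>auto dest!: T_D\<close>)
qed

lemma T_le_4: "card (T k t) \<le> 4"
  using four_same(6)[of k t] by linarith

lemma same_stable_card:
  assumes "2 \<le> card (T k t)"
  shows "stable (k + 2)"
  using same_stable card_ge_2D[OF assms] by blast

lemma two_mixed_card:
  assumes "2 \<le> card (T k t)" "2 \<le> card (T k (\<not> t))"
  shows "n (k + 2) = 0" "n (k + 3) = 0" "n (k + 4) = 0" "n (k + 1) \<le> 1"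
proof -
  obtain p p' where p: "p \<in> T k t" "p' \<in> T k t" "p \<noteq> p'" using card_ge_2D[OF assms(1)] by blast
  obtain q q' where q: "q \<in> T k (\<not> t)" "q' \<in> T k (\<not> t)" "q \<noteq> q'" using card_ge_2D[OF assms(2)] by blast
  show "n (k + 2) = 0" "n (k + 3) = 0" "n (k + 4) = 0" using two_mixed[OF p q] by (simp_all add: n_0)
  show "n (k + 1) \<le> 1"
    using two_mixed_same_next[OF p q] card_ge_2D[of "V (k + 1)"] by (force simp: n_def)
qed

lemma same_same_card:
  assumes "2 \<le> card (T k t)" "2 \<le> n (k + 1)"
  shows "n (k + 2) = 0" "n (k + 3) = 0" "n (k + 4) = 0" "\<exists>s. card (T (k + 1) s) = n (k + 1)"
proof -
  obtain p p' where p: "p \<in> T k t" "p' \<in> T k t" "p \<noteq> p'" using card_ge_2D[OF assms(1)] by blast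
  obtain w w' where w: "w \<in> V (k + 1)" "w' \<in> V (k + 1)" "w \<noteq> w'"
    using card_ge_2D[of "V (k + 1)"] assms(2) by (auto simp: n_def)
  have "ty w = ty w'" using same_mixed_next[OF p, of w "ty w" w'] w by (auto simp: T_def)
  then have w2: "w \<in> T (k + 1) (ty w)" "w' \<in> T (k + 1) (ty w)" using w by (auto simp: T_def)
  show "n (k + 2) = 0" "n (k + 3) = 0" "n (k + 4) = 0"
    using same_same_next[OF p w2 w(3)] by (simp_all add: n_0)
  have "T (k + 1) (\<not> ty w) = {}" using same_mixed_next[OF p w2(1)] by blast
  then show "\<exists>s. card (T (k + 1) s) = n (k + 1)"
    using mono_card[of "k + 1" "\<not> ty w"] by auto
qed

lemma mixed_next_card:
  assumes "T k t \<noteq> {}" "T k (\<not> t) \<noteq> {}" "n (k + 1) \<noteq> 0"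
  shows "n (k + 2) = 0" "n (k + 4) = 0" "stable (k + 3)" "card (T k t) \<le> 2" "card (T k (\<not> t)) \<le> 2"
proof -
  obtain p q where p: "p \<in> T k t" "q \<in> T k (\<not> t)" using assms by blast
  obtain w where w: "w \<in> V (k + 1)" using assms by (auto simp: n_0)
  show "n (k + 2) = 0" "n (k + 4) = 0" "stable (k + 3)"
    using mixed_next(2)[OF p w] mixed_next_carry[OF p V_T[OF w]] by (simp_all add: n_0)
  have *: "card (T k t) \<le> 2" if pq: "p \<in> T k t" "q \<in> T k (\<not> t)" for p q t
  proof (rule ccontr)
    assume "\<not> card (T k t) \<le> 2"
    then obtain a b c where "a \<in> T k t" "b \<in> T k t" "c \<in> T k t" "distinct [a, b, c]"
      using card_ge_3D[of "T k t"] by auto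
    then show False using mixed_same_next[OF _ pq(2) w, of c a t b] pq by (auto simp: T_def)
  qed
  show "card (T k t) \<le> 2" "card (T k (\<not> t)) \<le> 2" using *[OF p] *[of q "\<not> t" p] p by auto
qed

lemma mixed_three_card:
  assumes "T k t \<noteq> {}" "T k (\<not> t) \<noteq> {}" "3 \<le> n (k + 1)"
  shows "\<exists>s. card (T (k + 1) s) = n (k + 1)"
proof -
  obtain p q where p: "p \<in> T k t" "q \<in> T k (\<not> t)" using assms by blast
  show ?thesis
  proof (cases "\<exists>s. T (k + 1) s = {}")
    case True
    then obtain s where "T (k + 1) s = {}" by blast
    then show ?thesis using mono_card by blast
  next
    case False
    then obtain w w' where w: "w \<in> T (k + 1) True" "w' \<in> T (k + 1) False" by blast
    have "card {w, w'} < card (V (k + 1))" using assms(3) by (simp add: card_insert_if n_def)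
    then obtain w'' where "w'' \<in> V (k + 1)" "w'' \<noteq> w" "w'' \<noteq> w'" using card_less_obtain[of "{w, w'}"] by auto
    then show ?thesis using mixed_three_next[OF p w(1)] w by auto
  qed
qed

lemma n_le_6: "n k \<le> 6"
proof (cases "\<exists>t. 4 \<le> card (T k t)")
  case True
  then obtain t where "4 \<le> card (T k t)" by blast
  then show ?thesis using four_same(5,6)[of k t] n_T[of k t] by simp
next
  case False
  then have "card (T k True) \<le> 3" "card (T k False) \<le> 3" by (simp_all add: not_le less_Suc_eq_le eval_nat_numeral)
  then show ?thesis using n_T[of k True] by simp
qed

text \<open>Five variables contain four of one type or at least two of each, and both configurations
  empty these levels.\<close>

lemma five_zeros:
  assumes "5 \<le> n k"
  shows "n (k + 2) = 0" "n (k + 3) = 0" "n (k + 4) = 0"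
proof -
  have "n (k + 2) = 0 \<and> n (k + 3) = 0 \<and> n (k + 4) = 0"
  proof (cases "\<exists>t. 4 \<le> card (T k t)")
    case True
    then obtain t where "4 \<le> card (T k t)" by blast
    then show ?thesis using four_same(1-3)[of k t] by (simp add: n_0)
  next
    case False
    then have "card (T k True) \<le> 3" "card (T k False) \<le> 3" by (simp_all add: not_le less_Suc_eq_le eval_nat_numeral)
    then have "2 \<le> card (T k True)" "2 \<le> card (T k (\<not> True))" using assms n_T[of k True] by auto
    from two_mixed_card[OF this] show ?thesis by simp
  qed
  then show "n (k + 2) = 0" "n (k + 3) = 0" "n (k + 4) = 0" by auto
qed

lemma three_same_pair:
  assumes "3 \<le> n k"
  shows "\<exists>t. 2 \<le> card (T k t)"
proof (rule ccontr)
  assume "\<not> ?thesis"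
  then have "card (T k True) \<le> 1" "card (T k False) \<le> 1" by (simp_all add: not_le less_Suc_eq_le eval_nat_numeral)
  then show False using assms n_T[of k True] by simp
qed

section \<open>Splitting the levels into blocks\<close>

lemma stable_zero: "stable k \<Longrightarrow> n k \<noteq> 0 \<Longrightarrow> n (k + 1) = 0"
  by (auto simp: stable_def n_0)

text \<open>Three variables at k + 1 would have the same type and, by
  \<open>mixed_same_pair_next\<close>, pairwise equal classes. In (i) two of them form a bad pair
  arriving at k + 3 with type s, where the third one arrives with the mixed pair, also with type
  s.\<close>

lemma mixed_next_le_2:
  assumes "\<not> \<epsilon>" "T k t \<noteq> {}" "T k (\<not> t) \<noteq> {}"
  shows "n (k + 1) \<le> 2"
proof (rule ccontr)
  assume "\<not> n (k + 1) \<le> 2"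
  then have *: "3 \<le> n (k + 1)" by simp
  then obtain s where "card (T (k + 1) s) \<ge> 3" using mixed_three_card[OF assms(2,3)] by metis
  then obtain a b c where abc: "a \<in> T (k + 1) s" "b \<in> T (k + 1) s" "c \<in> T (k + 1) s" "a \<noteq> b" "a \<noteq> c" "b \<noteq> c"
    using card_ge_3D[of "T (k + 1) s"] by auto
  obtain p q where p: "p \<in> T k t" "q \<in> T k (\<not> t)" using assms by blast
  have "bad b c" using mixed_same_pair_next[OF p abc(2,3)] assms(1) by simp
  then have "nd {b, c} (k + 1 + 2) s" using pair_bad abc by blast
  then have m: "nd {b, c} (k + 3) s" by (simp add: eval_nat_numeral)
  have "s = (\<not> s)"
    by (rule clash[OF mixed_next_carry(1)[OF p abc(1)] m, of k])
      (use abc p in \<open>auto dest!: T_D V_D simp: window_def\<close>)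
  then show False by simp
qed

text \<open>Counts are doubled to keep the average 3/2 integral. A surplus of one variable is
  tolerated only when the block ends at a stable level; \<open>block_split_stable\<close> shows how
  it is lost again.\<close>

lemma block_split:
  assumes "\<not> \<epsilon>"
  shows "\<exists>l>0. 2 * sm k l < 3 * l \<or> 2 * sm k l \<le> 3 * l + 2 \<and> stable (k + l)"
proof -
  consider "n k \<le> 1" | "n k = 2" "n (k + 1) = 0" | "3 \<le> n k" "n k \<le> 4" "n (k + 1) = 0"
    | "5 \<le> n k" "n (k + 1) = 0"
    | "2 \<le> n k" "n (k + 1) \<noteq> 0" by linarith
  then show ?thesis
  proof cases
    case 1
    then show ?thesis by (intro exI[of _ 1]) (simp add: sm_simps)
  next
    case 2
    then show ?thesis by (intro exI[of _ 2]) (simp add: sm_simps)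
  next
    case 3
    have "stable (k + 2)" using three_same_pair[OF 3(1)] same_stable_card by blast
    then show ?thesis using 3 by (intro exI[of _ 2]) (simp add: sm_simps)
  next
    case 4
    \<comment> \<open>A crowded level leaves at most 6 variables on five levels, less than
      7.5.\<close>
    then show ?thesis using five_zeros[OF 4(1)] n_le_6[of k] by (intro exI[of _ 5]) (simp add: sm_simps)
  next
    case 5
    show ?thesis
    proof (cases "\<exists>t. T k t = {}")
      case False
      then have m: "T k True \<noteq> {}" "T k (\<not> True) \<noteq> {}" by auto
      note z = mixed_next_card[OF m 5(2)] mixed_next_le_2[OF assms m]
      show ?thesis
      proof (cases "n k \<le> 3")
        case True
        then show ?thesis using z by (intro exI[of _ 3]) (simp add: sm_simps)
      next
        case False
        then have "2 \<le> card (T k True)" "2 \<le> card (T k (\<not> True))" using z n_T[of k True] by auto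
        from two_mixed_card[OF this] show ?thesis using z n_T[of k True]
          by (intro exI[of _ 5]) (simp add: sm_simps)
      qed
    next
      case True
      then obtain t where t: "card (T k t) = n k" using mono_card by blast
      have st: "stable (k + 2)" using same_stable_card[of k t] t 5 by simp
      consider "n (k + 1) = 1" "n k \<le> 3" | "n (k + 1) = 1" "4 \<le> n k" | "2 \<le> n (k + 1)" "n k \<le> 3"
        | "2 \<le> n (k + 1)" "4 \<le> n k" using 5 by linarith
      then show ?thesis
      proof cases
        case 1
        then show ?thesis using st by (intro exI[of _ 2]) (simp add: sm_simps)
      next
        case 2
        then show ?thesis using four_same(1-3)[of k t] t T_le_4[of k t]
          by (intro exI[of _ 5]) (simp add: sm_simps flip: n_0)
      next
        case 3
        note z = same_same_card[of k t, unfolded t, OF 5(1) 3(1)]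
        then obtain s where "card (T (k + 1) s) = n (k + 1)" by blast
        then have "n (k + 1) \<le> 4" using T_le_4[of "k + 1" s] by simp
        \<comment> \<open>At most 3 + 4 = 7 variables on five levels, still less than 7.5.\<close>
        then show ?thesis using 3 z(1-3)
          by (intro exI[of _ 5]) (simp add: sm_simps)
      next
        case 4
        then show ?thesis using four_same(4)[of k t] t by simp
      qed
    qed
  qed
qed

text \<open>Only the block 3, 0 is free of loss. A block that may end at a level that is not stable
  loses at least 3 in doubled count, more than the 2 that \<open>block_split\<close> may have
  gained.\<close>

lemma block_split_stable:
  assumes "\<not> \<epsilon>" "stable k"
  shows "n k = 3 \<and> n (k + 1) = 0 \<and> stable (k + 2) \<or>
    (\<exists>l>0. 2 * sm k l < 3 * l \<and> stable (k + l)) \<or> (\<exists>l>0. 2 * sm k l + 3 \<le> 3 * l)"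
proof -
  obtain t where t: "card (T k t) = n k" using assms mono_card by (auto simp: stable_def)
  consider "n k = 0" | "n k = 1" | "n k = 2" | "n k = 3" | "4 \<le> n k" by linarith
  then show ?thesis
  proof cases
    case 1
    then have "2 * sm k 1 + 3 \<le> 3 * 1" by (simp add: sm_simps)
    then show ?thesis by (metis less_numeral_extra(1))
  next
    case 2
    then have "2 * sm k 2 + 3 \<le> 3 * 2" using stable_zero[OF assms(2)] by (simp add: sm_simps)
    then show ?thesis by (metis zero_less_numeral)
  next
    case 3
    then have "2 * sm k 2 < 3 * 2" using stable_zero[OF assms(2)] by (simp add: sm_simps)
    moreover have "stable (k + 2)" using same_stable_card[of k t] 3 t by simp
    ultimately show ?thesis by (metis zero_less_numeral)
  next
    case 4
    then show ?thesis using same_stable_card[of k t] stable_zero[OF assms(2)] t by simp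
  next
    case 5
    then have "2 * sm k 5 + 3 \<le> 3 * 5"
      using four_same(1-3)[of k t] stable_zero[OF assms(2)] t T_le_4[of k t]
      by (simp add: sm_simps flip: n_0)
    then show ?thesis by (metis zero_less_numeral)
  qed
qed

text \<open>Two of the three variables share a class, hence form a bad pair in (i), and this pair
  carries its own type to level k + 2.\<close>

lemma triple_alternates:
  assumes "\<not> \<epsilon>" "stable k" "n k = 3" "b \<in> V k" "v \<in> V (k + 2)"
  shows "ty v = (\<not> ty b)"
proof -
  obtain t' where "T k t' = {}" using assms(2) unfolding stable_def by blast
  then have "T k (\<not> (\<not> t')) = {}" by simp
  then obtain t where t: "T k (\<not> t) = {}" by blast
  then have "card (T k t) = 3" using assms(3) n_T[of k t] by simp
  then obtain x y z where x: "x \<in> T k t" "y \<in> T k t" "z \<in> T k t" "x \<noteq> y" "x \<noteq> z" "y \<noteq> z"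
    using card_ge_3D[of "T k t"] by auto
  then have "bad x y \<or> bad x z \<or> bad y z" using assms(1) unfolding bad_def by auto
  then obtain x y where x: "x \<in> T k t" "y \<in> T k t" "x \<noteq> y" "bad x y" using x by blast
  have "ty v = (\<not> t)"
    by (rule carry(1)[OF pair_bad(1)[OF x], of k]) (use x assms(5) in \<open>auto dest!: T_D V_D simp: window_def\<close>)
  moreover have "ty b = t" using t assms(4) by (auto simp: T_def)
  ultimately show ?thesis by simp
qed

text \<open>Two of three variables share a class, and in (ii) equal classes are good.\<close>

lemma triple_good_pair:
  assumes "\<epsilon>" "3 \<le> card (T k t)"
  shows "\<exists>a b. a \<in> T k t \<and> b \<in> T k t \<and> a \<noteq> b \<and> \<not> bad a b"
proof -
  obtain x y z where "x \<in> T k t" "y \<in> T k t" "z \<in> T k t" "x \<noteq> y" "x \<noteq> z" "y \<noteq> z"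
    using card_ge_3D[OF assms(2)] by auto
  moreover have "\<not> bad x y \<or> \<not> bad x z \<or> \<not> bad y z" using assms(1) unfolding bad_def by auto
  ultimately show ?thesis by metis
qed

text \<open>The good pair reaches k + 4, where it tolerates no second arrival. This rules out
  variables at k + 4, a same-type pair at k + 2 (which climbs two levels) and a mixed pair at k + 3
  (which climbs one).\<close>

lemma good_pair_next:
  assumes "a \<in> T k t" "b \<in> T k t" "a \<noteq> b" "\<not> bad a b"
  shows "n (k + 4) = 0" "n (k + 2) = 0 \<and> stable (k + 3) \<or> n (k + 2) = 1 \<and> n (k + 3) = 0"
proof -
  show z: "n (k + 4) = 0" using good_empty[OF assms] by (simp add: n_0)
  have st: "stable (k + 2)" using same_stable[OF assms(1-3)] .
  then obtain s where s: "card (T (k + 2) s) = n (k + 2)" using mono_card by (auto simp: stable_def)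
  have "n (k + 2) \<le> 1"
  proof (rule ccontr)
    assume "\<not> n (k + 2) \<le> 1"
    then obtain x y where "x \<in> T (k + 2) s" "y \<in> T (k + 2) s" "x \<noteq> y"
      using card_ge_2D[of "T (k + 2) s"] s by auto
    then show False using good_same_empty[OF assms] by blast
  qed
  moreover have "n (k + 3) = 0" if "n (k + 2) = 1"
    using stable_zero[OF st] that by (simp add: eval_nat_numeral)
  moreover have "stable (k + 3)"
  proof -
    have "T (k + 3) True = {} \<or> T (k + 3) (\<not> True) = {}" using good_mixed_empty[OF assms, of _ True] by blast
    then show ?thesis using z unfolding stable_def by (auto simp: n_0 eval_nat_numeral)
  qed
  ultimately show "n (k + 2) = 0 \<and> stable (k + 3) \<or> n (k + 2) = 1 \<and> n (k + 3) = 0"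
    by linarith
qed

text \<open>Four variables of one type leave room for one of the other, so six would be three of
  each type, and these contain two disjoint good pairs.\<close>

lemma n_le_5:
  assumes \<epsilon>
  shows "n k \<le> 5"
proof (rule ccontr)
  assume a: "\<not> n k \<le> 5"
  have "card (T k t) \<le> 3" for t
  proof (rule ccontr)
    assume "\<not> card (T k t) \<le> 3"
    then show False using four_same(5,6)[of k t] n_T[of k t] a by simp
  qed
  from this[of True] this[of "\<not> True"] have "3 \<le> card (T k True)" "3 \<le> card (T k (\<not> True))"
    using a n_T[of k True] by auto
  note g = this[THEN triple_good_pair[OF assms]]
  obtain a b where ab: "a \<in> T k True" "b \<in> T k True" "a \<noteq> b" "\<not> bad a b" using g(1) by metis
  obtain x y where xy: "x \<in> T k (\<not> True)" "y \<in> T k (\<not> True)" "x \<noteq> y" "\<not> bad x y" using g(2) by metis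
  have "{a, b} \<inter> {x, y} = {}" using ab xy by (auto simp: T_def)
  then show False by (rule good_good[OF ab xy])
qed

text \<open>Variables of one type at k + 1 have equal classes and so form good pairs in (ii). Four
  of them would give two disjoint good pairs. One good pair reaches k + 5, and it arrives at k + 3
  with the type opposite to that of \<open>mixed_next_carry\<close>, so both levels are
  empty.\<close>

lemma mixed_next_eps:
  assumes \<epsilon> "T k t \<noteq> {}" "T k (\<not> t) \<noteq> {}" "3 \<le> n (k + 1)"
  shows "n (k + 1) = 3" "n (k + 3) = 0" "n (k + 5) = 0"
proof -
  obtain s where s: "card (T (k + 1) s) = n (k + 1)" using mixed_three_card[OF assms(2-4)] by auto
  obtain p q where p: "p \<in> T k t" "q \<in> T k (\<not> t)" using assms by blast
  have g: "\<not> bad b c" if "b \<in> T (k + 1) s" "c \<in> T (k + 1) s" for b c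
    using mixed_same_pair_next[OF p that] assms(1) by simp
  have "\<not> 4 \<le> card (T (k + 1) s)"
  proof
    assume "4 \<le> card (T (k + 1) s)"
    then obtain a b c e where "a \<in> T (k + 1) s" "b \<in> T (k + 1) s" "c \<in> T (k + 1) s" "e \<in> T (k + 1) s" "distinct [a, b, c, e]"
      using card_ge_4D by blast
    then show False using good_good[of a "k + 1" s b c s e] g by auto
  qed
  then show "n (k + 1) = 3" using s assms(4) by simp
  obtain a b where ab: "a \<in> T (k + 1) s" "b \<in> T (k + 1) s" "a \<noteq> b"
    using card_ge_2D[of "T (k + 1) s"] s assms by auto
  then show "n (k + 5) = 0" using good_empty[OF ab g[OF ab(1,2)]] by (simp add: n_0 eval_nat_numeral)
  have m: "nd {a, b} (k + 3) (\<not> s)" using pair_good(1)[OF ab g[OF ab(1,2)]] by (simp add: eval_nat_numeral)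
  have "V (k + 3) = {}"
    by (rule carry_both[OF mixed_next_carry(1)[OF p ab(1)] _ _ m, of k "k + 1"])
      (use ab p in \<open>auto dest!: T_D V_D simp: window_def\<close>)
  then show "n (k + 3) = 0" by (simp add: n_0)
qed

text \<open>Four variables of one type climb three levels, from k + 1 to k + 4, where the good pair
  also arrives.\<close>

lemma good_four_next:
  assumes "a \<in> T k t" "b \<in> T k t" "a \<noteq> b" "\<not> bad a b" "4 \<le> card (T (k + 1) s)"
  shows False
proof -
  obtain B where B: "\<forall>b\<in>B. b \<in> V (k + 1)" "B \<noteq> {}" "\<forall>s. nd B (k + 1 + 3) s"
    using four_same(7)[OF assms(5)] by blast
  obtain t' where m: "nd {a, b} (k + 4) t'" using pair_good(2)[OF assms(1-4)] by blast
  have m': "nd B (k + 4) True" using B(3) by (simp add: eval_nat_numeral)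
  have l: "\<forall>x\<in>B. lv x = k + 1" "lv a = k" "lv b = k" using B(1) assms by (auto dest!: T_D V_D)
  then have "{a, b} \<inter> B = {}" "window k ({a, b} \<union> B)" by (auto simp: window_def)
  then show False by (rule clash_4[OF m m'])
qed

text \<open>The counterpart of \<open>block_split\<close> for the average 1: again a surplus of one
  variable must be accompanied by a stable end. Good pairs, which empty a level four steps later,
  now supply the missing zeros.\<close>

lemma block_split_eps:
  assumes \<epsilon>
  shows "\<exists>l>0. sm k l \<le> l \<or> sm k l \<le> l + 1 \<and> stable (k + l)"
proof -
  have good_case: "\<exists>l>0. sm k l \<le> l \<or> sm k l \<le> l + 1 \<and> stable (k + l)"
    if h: "3 \<le> card (T k t)" "n k + n (k + 1) = 4" for t
  proof -
    obtain a b where "a \<in> T k t" "b \<in> T k t" "a \<noteq> b" "\<not> bad a b"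
      using triple_good_pair[OF assms h(1)] by metis
    note z = good_pair_next[OF this]
    show ?thesis
    proof (cases "n (k + 2) = 0")
      case True
      then show ?thesis using z h by (intro exI[of _ 3]) (simp add: sm_simps)
    next
      case False
      then show ?thesis using z h by (intro exI[of _ 5]) (simp add: sm_simps)
    qed
  qed
  consider "n k \<le> 1" | "n k = 2" "n (k + 1) = 0" | "n k = 3" "n (k + 1) = 0"
    | "n k = 4" "n (k + 1) = 0" | "5 \<le> n k" "n (k + 1) = 0"
    | "2 \<le> n k" "n (k + 1) \<noteq> 0" by linarith
  then show ?thesis
  proof cases
    case 1
    then show ?thesis by (intro exI[of _ 1]) (simp add: sm_simps)
  next
    case 2
    then show ?thesis by (intro exI[of _ 2]) (simp add: sm_simps)
  next
    case 3
    have "stable (k + 2)" using three_same_pair[of k] 3 same_stable_card by auto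
    then show ?thesis using 3 by (intro exI[of _ 2]) (simp add: sm_simps)
  next
    case 4
    show ?thesis
    proof (cases "\<exists>t. 3 \<le> card (T k t)")
      case True
      then show ?thesis using good_case 4 by auto
    next
      case False
      then have "card (T k True) \<le> 2" "card (T k False) \<le> 2" by (simp_all add: not_le less_Suc_eq_le eval_nat_numeral)
      then have "2 \<le> card (T k True)" "2 \<le> card (T k (\<not> True))" using 4 n_T[of k True] by auto
      from two_mixed_card[OF this] show ?thesis using 4
        by (intro exI[of _ 5]) (simp add: sm_simps)
    qed
  next
    case 5
    then show ?thesis using five_zeros[OF 5(1)] n_le_5[OF assms, of k] by (intro exI[of _ 5]) (simp add: sm_simps)
  next
    case 6
    show ?thesis
    proof (cases "\<exists>t. T k t = {}")
      case False
      then have m: "T k True \<noteq> {}" "T k (\<not> True) \<noteq> {}" by auto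
      note z = mixed_next_card[OF m 6(2)]
      note z3 = mixed_next_eps[OF assms m]
      have "n k \<le> 4" using z n_T[of k True] by simp
      then consider "n k = 2" "n (k + 1) \<le> 2" | "n k = 2" "3 \<le> n (k + 1)" | "n k = 3" "n (k + 1) = 1"
        | "n k = 3" "n (k + 1) = 2" | "n k = 3" "3 \<le> n (k + 1)" | "n k = 4" using 6 by linarith
      then show ?thesis
      proof cases
        case 1
        then show ?thesis using z by (intro exI[of _ 3]) (simp add: sm_simps)
      next
        case 2
        then show ?thesis using z z3 by (intro exI[of _ 5]) (simp add: sm_simps)
      next
        case 3
        then show ?thesis using z by (intro exI[of _ 3]) (simp add: sm_simps)
      next
        case 4
        then obtain t where "2 \<le> card (T k t)" using three_same_pair[of k] by auto
        from same_same_card[OF this] show ?thesis using 4 by (intro exI[of _ 5]) (simp add: sm_simps)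
      next
        case 5
        then show ?thesis using z z3 by (intro exI[of _ 6]) (simp add: sm_simps)
      next
        case 6
        then have "2 \<le> card (T k True)" "2 \<le> card (T k (\<not> True))" using z n_T[of k True] by auto
        from two_mixed_card[OF this] show ?thesis using 6
          by (intro exI[of _ 5]) (simp add: sm_simps)
      qed
    next
      case True
      then obtain t where t: "card (T k t) = n k" using mono_card by blast
      have st: "stable (k + 2)" using same_stable_card[of k t] t 6 by simp
      have n4: "n k \<le> 4" using T_le_4[of k t] t by simp
      consider "n (k + 1) = 1" "n k = 2" | "n (k + 1) = 1" "n k = 3" | "n (k + 1) = 1" "n k = 4"
        | "2 \<le> n (k + 1)" using 6 n4 by linarith
      then show ?thesis
      proof cases
        case 1
        then show ?thesis using st by (intro exI[of _ 2]) (simp add: sm_simps)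
      next
        case 2
        then show ?thesis using good_case[of t] t by simp
      next
        case 3
        then show ?thesis using four_same(1-3)[of k t] t
          by (intro exI[of _ 5]) (simp add: sm_simps flip: n_0)
      next
        case 4
        note z = same_same_card[of k t, unfolded t, OF 6(1) 4]
        then obtain s where s: "card (T (k + 1) s) = n (k + 1)" by blast
        have n3: "n k \<le> 3" using four_same(4)[of k t] t 4 by linarith
        have w4: "n (k + 1) \<le> 4" using T_le_4[of "k + 1" s] s by simp
        \<comment> \<open>A good pair among three variables at k + 1 reaches k + 5. This sixth empty
          level is needed when the first two levels hold 6 variables.\<close>
        have z5: "n (k + 5) = 0" if h: "3 \<le> n (k + 1)"
        proof -
          obtain a b where "a \<in> T (k + 1) s" "b \<in> T (k + 1) s" "a \<noteq> b" "\<not> bad a b"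
            using triple_good_pair[OF assms, of "k + 1" s] h s by auto
          from good_empty[OF this] show ?thesis by (simp add: n_0 eval_nat_numeral)
        qed
        \<comment> \<open>Seven variables would exceed a block of six levels; the good pair at k and
          the four variables at k + 1 collide at k + 4.\<close>
        have "\<not> (n k = 3 \<and> n (k + 1) = 4)"
        proof
          assume h: "n k = 3 \<and> n (k + 1) = 4"
          then obtain a b where "a \<in> T k t" "b \<in> T k t" "a \<noteq> b" "\<not> bad a b"
            using triple_good_pair[OF assms, of k t] t by auto
          then show False using good_four_next[of a k t b s] h s by simp
        qed
        then consider "n k + n (k + 1) \<le> 5" | "n k + n (k + 1) = 6" "3 \<le> n (k + 1)" using n3 w4 by linarith
        then show ?thesis
        proof cases
          case 1
          then show ?thesis using z by (intro exI[of _ 5]) (simp add: sm_simps)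
        next
          case 2
          then show ?thesis using z z5 by (intro exI[of _ 6]) (simp add: sm_simps)
        qed
      qed
    qed
  qed
qed

text \<open>A stable level is followed by blocks that gain nothing, and one that does not end at a
  stable level loses a variable, which repays the surplus of \<open>block_split_eps\<close>.\<close>

lemma block_split_stable_eps:
  assumes \<epsilon> "stable k"
  shows "\<exists>l>0. sm k l \<le> l \<and> stable (k + l) \<or> sm k l + 1 \<le> l"
proof -
  obtain t where t: "card (T k t) = n k" using assms mono_card by (auto simp: stable_def)
  consider "n k = 0" | "n k = 1" | "n k = 2" | "n k = 3" | "4 \<le> n k" by linarith
  then show ?thesis
  proof cases
    case 1
    then show ?thesis by (intro exI[of _ 1]) (simp add: sm_simps)
  next
    case 2
    then show ?thesis using stable_zero[OF assms(2)] by (intro exI[of _ 2]) (simp add: sm_simps)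
  next
    case 3
    moreover have "stable (k + 2)" using same_stable_card[of k t] 3 t by simp
    ultimately show ?thesis using stable_zero[OF assms(2)] by (intro exI[of _ 2]) (simp add: sm_simps)
  next
    case 4
    obtain a b where "a \<in> T k t" "b \<in> T k t" "a \<noteq> b" "\<not> bad a b"
      using triple_good_pair[OF assms(1), of k t] 4 t by auto
    note z = good_pair_next[OF this]
    show ?thesis
    proof (cases "n (k + 2) = 0")
      case True
      then show ?thesis using z 4 stable_zero[OF assms(2)] by (intro exI[of _ 3]) (simp add: sm_simps)
    next
      case False
      then show ?thesis using z 4 stable_zero[OF assms(2)] by (intro exI[of _ 5]) (simp add: sm_simps)
    qed
  next
    case 5
    then show ?thesis
      using four_same(1-3)[of k t] stable_zero[OF assms(2)] t T_le_4[of k t]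
      by (intro exI[of _ 5]) (simp add: sm_simps flip: n_0)
  qed
qed

section \<open>The excess over the average along a period\<close>

definition excess :: "int \<Rightarrow> int \<Rightarrow> nat \<Rightarrow> int" where
  "excess p q k = (\<Sum>i<k. p * int (n i) - q)"

lemma excess_add: "excess p q (k + l) = excess p q k + p * int (sm k l) - q * int l"
proof (induction l)
  case (Suc l)
  have "excess p q (k + Suc l) = excess p q (k + l) + (p * int (n (k + l)) - q)" by (simp add: excess_def)
  then show ?case using Suc by (simp add: sm_def algebra_simps)
qed (simp add: sm_def)

lemma sm_period:
  assumes "\<And>k. n (k + d) = n k"
  shows "sm k d = (\<Sum>i<d. n i)"
proof (induction k)
  case 0
  then show ?case by (simp add: sm_def)
next
  case (Suc k)
  have "sm k d + n (k + d) = n k + sm (Suc k) d"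
    using sum.lessThan_Suc_shift[of "\<lambda>i. n (k + i)" d] by (simp add: sm_def)
  then show ?case using Suc assms[of k] by simp
qed

lemma period_mult:
  assumes "\<And>k. f (k + d) = f k + c"
  shows "f (k + q * d) = f k + of_nat q * (c :: int)"
proof (induction q)
  case (Suc q)
  have "f (k + Suc q * d) = f (k + q * d) + c" using assms[of "k + q * d"] by (simp add: algebra_simps)
  then show ?case using Suc by (simp add: algebra_simps)
qed simp

text \<open>Blocks entered from an arbitrary level may exceed the average by one variable, but then they
  end in a stable level, and a stable phase is only left at a larger loss. So a period attaining the average
  consists of stable blocks \<open>3, 0\<close>, along which the type alternates.\<close>

lemma no_period:
  assumes eps: "\<not> \<epsilon>" and per: "\<And>k. n (k + 2 * m) = n k" and m: "odd m"
    and tot: "(\<Sum>k<2 * m. n k) = 3 * m"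
    and ty_per: "\<And>k b. b \<in> V k \<Longrightarrow> \<exists>b'\<in>V (k + 2 * m). ty b' = ty b"
  shows False
proof -
  define g where "g = excess 2 3"
  have g_add: "g (k + l) = g k + 2 * int (sm k l) - 3 * int l" for k l
    unfolding g_def by (rule excess_add)
  \<comment> \<open>The total 3 m is exactly the average, so the excess is periodic and attains a
    minimum \<open>\<mu>\<close>.\<close>
  have g_per: "g (k + 2 * m) = g k + 0" for k
    using g_add[of k "2 * m"] sm_period[OF per, of k] tot by simp
  have g_mod: "g k = g (k mod (2 * m))" for k
    using period_mult[of g "2 * m" 0, OF g_per, of "k mod (2 * m)" "k div (2 * m)"]
    by (simp only: mod_div_mult_eq mult_zero_right add_0_right)
  define \<mu> where "\<mu> = Min (g ` {..<2 * m})"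
  have m0: "m > 0" using m by (rule odd_pos)
  have \<mu>: "\<mu> \<le> g k" for k
    unfolding \<mu>_def by (subst g_mod) (rule Min_le, use m0 in auto)
  have "\<mu> \<in> g ` {..<2 * m}" unfolding \<mu>_def by (rule Min_in) (use m0 in \<open>auto simp: lessThan_empty_iff\<close>)
  then obtain k0 where k0: "g k0 = \<mu>" by blast
  \<comment> \<open>From a minimum the losing alternative of \<open>block_split\<close> is
    impossible, so a stable level with excess at most \<open>\<mu>\<close> + 2 is reached. At the
    least such excess both losing alternatives of \<open>block_split_stable\<close> are impossible
    too.\<close>
  define Q where "Q k \<longleftrightarrow> stable k \<and> g k \<le> \<mu> + 2" for k
  obtain l where "2 * sm k0 l < 3 * l \<or> 2 * sm k0 l \<le> 3 * l + 2 \<and> stable (k0 + l)"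
    using block_split[OF eps] by blast
  then have "Q (k0 + l)" using g_add[of k0 l] k0 \<mu>[of "k0 + l"] by (auto simp: Q_def)
  from ex_has_least_nat[of Q, OF this, of "\<lambda>k. nat (g k - \<mu>)"]
  obtain k1 where k1: "Q k1" "\<And>k. Q k \<Longrightarrow> g k1 \<le> g k" using \<mu> by (auto simp: nat_le_eq_zle)
  have step: "n k = 3 \<and> Q (k + 2) \<and> g (k + 2) = g k" if k: "Q k" "g k = g k1" for k
  proof -
    have "stable k" "g k \<le> \<mu> + 2" using k by (auto simp: Q_def)
    have no1: "\<not> (2 * sm k l < 3 * l \<and> stable (k + l))" for l
      using k1(2)[of "k + l"] g_add[of k l] k \<open>g k \<le> \<mu> + 2\<close> by (auto simp: Q_def)
    have no2: "\<not> 2 * sm k l + 3 \<le> 3 * l" for l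
      using \<mu>[of "k + l"] g_add[of k l] \<open>g k \<le> \<mu> + 2\<close> by linarith
    have "n k = 3 \<and> n (k + 1) = 0 \<and> stable (k + 2)"
      using block_split_stable[OF eps \<open>stable k\<close>] no1 no2 by blast
    moreover from this have "g (k + 2) = g k" using g_add[of k 2] by (simp add: sm_simps)
    ultimately show ?thesis using k by (simp add: Q_def)
  qed
  have run: "Q (k1 + 2 * i) \<and> g (k1 + 2 * i) = g k1" for i
  proof (induction i)
    case (Suc i)
    then show ?case using step[of "k1 + 2 * i"] by (simp add: eval_nat_numeral)
  qed (use k1 in simp)
  have run3: "n (k1 + 2 * i) = 3" "stable (k1 + 2 * i)" for i
    using run[of i] step[of "k1 + 2 * i"] by (auto simp: Q_def)
  have ne: "V (k1 + 2 * i) \<noteq> {}" for i using run3(1)[of i] by (auto simp flip: n_0)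
  obtain b where b: "b \<in> V k1" using ne[of 0] by auto
  have alt: "\<exists>v\<in>V (k1 + 2 * i). ty v = (ty b = even i)" for i
  proof (induction i)
    case (Suc i)
    then obtain v where v: "v \<in> V (k1 + 2 * i)" "ty v = (ty b = even i)" by blast
    obtain w where w: "w \<in> V (k1 + 2 * i + 2)" using ne[of "Suc i"] by auto
    have "ty w = (\<not> ty v)" by (rule triple_alternates[OF eps run3(2,1) v(1) w])
    then show ?case using v w by auto
  qed (use b in auto)
  obtain v where v: "v \<in> V (k1 + 2 * m)" "ty v = (\<not> ty b)" using alt[of m] m by auto
  obtain v' where v': "v' \<in> V (k1 + 2 * m)" "ty v' = ty b" using ty_per[OF b] by blast
  show False using run3(2)[of m] v v' by (cases "ty b") (auto simp: stable_def T_def)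
qed

text \<open>One variable more than the average makes the excess grow by one per period, whereas
  blocks lead to arbitrarily high levels of excess at most 1.\<close>

lemma no_period_eps:
  assumes eps: \<epsilon> and per: "\<And>k. n (k + d) = n k" and tot: "(\<Sum>k<d. n k) = d + 1" and d: "d > 0"
  shows False
proof -
  define g where "g = excess 1 1"
  have g_add: "g (k + l) = g k + int (sm k l) - int l" for k l
    unfolding g_def by (simp add: excess_add)
  have g_per: "g (k + d) = g k + 1" for k
    using g_add[of k d] sm_period[OF per, of k] tot by simp
  have g_ge: "g k \<ge> - int k" for k
    using g_add[of 0 k] by (simp add: g_def excess_def)
  \<comment> \<open>Invariant of the walk along blocks: the excess is at most 0, or at most 1 at a
    stable level.\<close>
  have walk: "\<exists>k\<ge>K. g k \<le> 0 \<or> stable k \<and> g k \<le> 1" for K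
  proof (induction K)
    case 0
    show ?case by (intro exI[of _ 0]) (simp add: g_def excess_def)
  next
    case (Suc K)
    then obtain k where k: "k \<ge> K" "g k \<le> 0 \<or> stable k \<and> g k \<le> 1" by blast
    have "\<exists>l>0. g (k + l) \<le> 0 \<or> stable (k + l) \<and> g (k + l) \<le> 1"
    proof (cases "g k \<le> 0")
      case True
      obtain l where "l > 0" "sm k l \<le> l \<or> sm k l \<le> l + 1 \<and> stable (k + l)"
        using block_split_eps[OF eps] by blast
      then show ?thesis using True g_add[of k l] by (intro exI[of _ l]) auto
    next
      case False
      then have "stable k" "g k \<le> 1" using k by auto
      obtain l where "l > 0" "sm k l \<le> l \<and> stable (k + l) \<or> sm k l + 1 \<le> l"
        using block_split_stable_eps[OF eps \<open>stable k\<close>] by blast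
      then show ?thesis using \<open>g k \<le> 1\<close> g_add[of k l] by (intro exI[of _ l]) auto
    qed
    then obtain l where "l > 0" "g (k + l) \<le> 0 \<or> stable (k + l) \<and> g (k + l) \<le> 1" by blast
    then show ?case using k by (intro exI[of _ "k + l"]) auto
  qed
  \<comment> \<open>After d + 2 periods the growth outweighs the worst starting value, as
    \<open>g\<close> is at least - (d - 1) on the first period.\<close>
  obtain k where k: "k \<ge> (d + 2) * d" "g k \<le> 1" using walk[of "(d + 2) * d"] by auto
  have "g k = g (k mod d) + int (k div d)"
    using period_mult[of g d 1, OF g_per, of "k mod d" "k div d"] by simp
  moreover have "k div d \<ge> d + 2" using k(1) d by (simp add: less_eq_div_iff_mult_less_eq)
  moreover have "k mod d < d" using d by simp
  ultimately show False using k(2) g_ge[of "k mod d"] by linarith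
qed

end

section \<open>Units of a ramified dyadic ring\<close>

lemmas small_powers = power2_eq_square power3_eq_cube power4_eq_xxxx

text \<open>Applied with the period 2 m >= 6 to levels less than five apart, so that one window
  meets each variable at one level only.\<close>

lemma mod_close_eq:
  fixes x y d :: nat
  assumes "x mod d = y mod d" "x < y + d" "y < x + d"
  shows "x = y"
proof -
  have *: "x = y" if h: "x mod d = y mod d" "y < x + d" "x \<le> y" for x y :: nat
  proof -
    have "d dvd y - x" using h by (metis mod_eq_dvd_iff_nat)
    moreover have "y - x < d" using h by linarith
    ultimately have "y - x = 0" by (metis nat_dvd_not_less neq0_conv)
    then show ?thesis using h(3) by simp
  qed
  show ?thesis using *[of x y] *[of y x] assms by (cases "x \<le> y") auto
qed

text \<open>Completeness is not assumed: the model is a dense subring of the integers of K.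
  \<open>inverse_pi\<close> and \<open>residue\<close> say that the residue field has two elements,
  and \<open>two_eq\<close> records 2 modulo \<open>\<pi> ^ 4\<close>, the precision at which d-th
  powers of units are determined.\<close>

locale dyadic_ring =
  fixes R :: "'a :: field set" and \<pi> :: 'a and \<epsilon> :: bool
  assumes one_mem [simp]: "1 \<in> R"
    and add_mem [simp]: "x \<in> R \<Longrightarrow> y \<in> R \<Longrightarrow> x + y \<in> R"
    and uminus_mem [simp]: "x \<in> R \<Longrightarrow> - x \<in> R"
    and mult_mem [simp]: "x \<in> R \<Longrightarrow> y \<in> R \<Longrightarrow> x * y \<in> R"
    and pi_mem [simp]: "\<pi> \<in> R" and pi_nz [simp]: "\<pi> \<noteq> 0" and inverse_pi: "inverse \<pi> \<notin> R"
    and residue: "x \<in> R \<Longrightarrow> x / \<pi> \<in> R \<or> (x - 1) / \<pi> \<in> R"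
    and two_eq: "\<exists>e\<in>R. 2 = \<pi> ^ 2 + of_bool \<epsilon> * \<pi> ^ 3 + \<pi> ^ 4 * e"
begin

declare One_nat_def [simp del]

lemma diff_mem [simp]: "x \<in> R \<Longrightarrow> y \<in> R \<Longrightarrow> x - y \<in> R"
  using add_mem[of x "- y"] by simp

lemma zero_mem [simp]: "0 \<in> R"
  using diff_mem[of 1 1] by simp

lemma power_mem [simp]: "x \<in> R \<Longrightarrow> x ^ k \<in> R"
  by (induction k) auto

lemma of_nat_mem [simp]: "of_nat k \<in> R"
  by (induction k) auto

lemma of_bool_mem [simp]: "of_bool b \<in> R"
  by (cases b) auto

lemma sum_mem [simp]: "(\<And>i. i \<in> A \<Longrightarrow> f i \<in> R) \<Longrightarrow> sum f A \<in> R"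
  by (induction A rule: infinite_finite_induct) auto

section \<open>Ideals and units\<close>

definition P :: "nat \<Rightarrow> 'a set" where "P k = {\<pi> ^ k * y | y. y \<in> R}"

text \<open>Invertibility in \<open>R\<close> is not among the axioms; \<open>U_cancel\<close> takes
  the place of division by a unit.\<close>

definition U :: "'a set" where "U = R - P 1"

lemma P_I: "y \<in> R \<Longrightarrow> \<pi> ^ k * y \<in> P k"
  by (auto simp: P_def)

lemma P_iff: "x \<in> P k \<longleftrightarrow> x / \<pi> ^ k \<in> R"
proof
  assume "x / \<pi> ^ k \<in> R"
  then have "\<pi> ^ k * (x / \<pi> ^ k) \<in> P k" by (rule P_I)
  then show "x \<in> P k" by simp
qed (auto simp: P_def)

lemma P_0 [simp]: "P 0 = R"
  by (auto simp: P_iff)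

lemma P_mem: "x \<in> P k \<Longrightarrow> x \<in> R"
  by (auto simp: P_def)

lemma P_mono: "x \<in> P l \<Longrightarrow> k \<le> l \<Longrightarrow> x \<in> P k"
  by (auto simp: P_def le_iff_add power_add mult.assoc)

lemma P_add: "x \<in> P k \<Longrightarrow> y \<in> P k \<Longrightarrow> x + y \<in> P k"
  by (simp add: P_iff add_divide_distrib)

lemma P_diff: "x \<in> P k \<Longrightarrow> y \<in> P k \<Longrightarrow> x - y \<in> P k"
  by (simp add: P_iff diff_divide_distrib)

lemma P_zero [simp]: "0 \<in> P k"
  by (simp add: P_iff)

lemma P_sum: "(\<And>i. i \<in> A \<Longrightarrow> f i \<in> P k) \<Longrightarrow> sum f A \<in> P k"
  by (induction A rule: infinite_finite_induct) (auto intro: P_add)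

lemma P_mult: "x \<in> P k \<Longrightarrow> y \<in> P l \<Longrightarrow> x * y \<in> P (k + l)"
  by (auto simp: P_def power_add)

lemma P_multR: "x \<in> P k \<Longrightarrow> y \<in> R \<Longrightarrow> x * y \<in> P k" "x \<in> P k \<Longrightarrow> y \<in> R \<Longrightarrow> y * x \<in> P k"
  using P_mult[of x k y 0] by (auto simp: mult.commute)

lemma pi_P: "k \<le> l \<Longrightarrow> \<pi> ^ l \<in> P k"
  using P_mono[of "\<pi> ^ l" l k] P_I[of 1 l] by simp

lemma P_shift [simp]: "\<pi> ^ k * x \<in> P (k + l) \<longleftrightarrow> x \<in> P l"
  by (simp add: P_iff power_add)

lemma U_mem [simp]: "x \<in> U \<Longrightarrow> x \<in> R"
  by (simp add: U_def)

lemma one_not_P: "1 \<notin> P 1"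
  using inverse_pi by (simp add: P_iff inverse_eq_divide)

lemma one_U [simp]: "1 \<in> U"
  by (simp add: U_def one_not_P)

lemma U_iff: "x \<in> R \<Longrightarrow> x \<in> U \<longleftrightarrow> x - 1 \<in> P 1"
proof -
  assume x: "x \<in> R"
  have "x \<in> P 1 \<or> x - 1 \<in> P 1" using residue[OF x] by (simp add: P_iff)
  moreover have "\<not> (x \<in> P 1 \<and> x - 1 \<in> P 1)" using P_diff[of x 1 "x - 1"] one_not_P by auto
  ultimately show ?thesis using x by (auto simp: U_def)
qed

lemma U_D: "x \<in> U \<Longrightarrow> x - 1 \<in> P 1"
  using U_iff[of x] by simp

lemma U_add_P: "x \<in> U \<Longrightarrow> y \<in> P 1 \<Longrightarrow> x + y \<in> U"
  using P_add[OF U_D, of x y] U_iff[of "x + y"] by (simp add: P_mem algebra_simps)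

lemma U_cong: "x \<in> U \<Longrightarrow> y - x \<in> P 1 \<Longrightarrow> y \<in> U"
  using U_add_P[of x "y - x"] by simp

lemma U_add_U: "x \<in> U \<Longrightarrow> y \<in> U \<Longrightarrow> x - y \<in> P 1"
  using P_diff[OF U_D U_D, of x y] by simp

lemma U_mult [simp]: "x \<in> U \<Longrightarrow> y \<in> U \<Longrightarrow> x * y \<in> U"
proof -
  assume *: "x \<in> U" "y \<in> U"
  then have "(x - 1) * y + (y - 1) \<in> P 1" by (intro P_add P_multR) (auto intro: U_D)
  then show ?thesis using * U_iff[of "x * y"] by (simp add: algebra_simps)
qed

lemma U_power [simp]: "x \<in> U \<Longrightarrow> x ^ k \<in> U"
  by (induction k) auto

lemma two_P: "2 \<in> P 2"
proof -
  obtain e where e: "e \<in> R" "2 = \<pi> ^ 2 + of_bool \<epsilon> * \<pi> ^ 3 + \<pi> ^ 4 * e" using two_eq by blast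
  have "\<pi> ^ 2 + of_bool \<epsilon> * \<pi> ^ 3 + \<pi> ^ 4 * e = \<pi> ^ 2 * (1 + of_bool \<epsilon> * \<pi> + \<pi> ^ 2 * e)"
    by (simp add: algebra_simps small_powers)
  also have "\<dots> \<in> P 2" using e(1) by (intro P_I) simp
  finally show ?thesis using e(2) by simp
qed

lemma sum_U: "finite A \<Longrightarrow> (\<And>i. i \<in> A \<Longrightarrow> f i \<in> U) \<Longrightarrow> sum f A - of_bool (odd (card A)) \<in> P 1"
proof (induction A rule: finite_induct)
  case (insert x A)
  have a: "f x - 1 \<in> P 1" using insert.prems U_D by auto
  have 1: "(f x - 1) + (sum f A - of_bool (odd (card A))) \<in> P 1" using insert a by (intro P_add) auto
  have 2: "2 * of_bool (odd (card A)) \<in> P 1" using P_mono[OF two_P, of 1] by (intro P_multR) auto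
  have "(f x - 1) + (sum f A - of_bool (odd (card A))) + 2 * of_bool (odd (card A))
      = sum f (insert x A) - of_bool (odd (card (insert x A)))"
    using insert by simp
  with P_add[OF 1 2] show ?case by simp
qed simp

section \<open>Digits of units and sums of two units\<close>

definition tail :: "'a \<Rightarrow> 'a" where "tail x = (x - of_bool (x \<notin> P 1)) / \<pi>"

lemma tail_mem [simp]: "x \<in> R \<Longrightarrow> tail x \<in> R"
  using residue[of x] P_iff[of x 1] by (cases "x \<in> P 1") (simp_all add: tail_def)

lemma tail_eq: "x = of_bool (x \<notin> P 1) + \<pi> * tail x"
  by (simp add: tail_def)

lemma digit_unique:
  assumes "y \<in> R" "x = of_bool b + \<pi> * y"
  shows "x \<notin> P 1 \<longleftrightarrow> b" and "tail x = y"
proof -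
  have y: "\<pi> * y \<in> P 1" using P_I[OF assms(1), of 1] by simp
  have "1 + \<pi> * y \<notin> P 1" using U_add_P[OF one_U y] unfolding U_def by blast
  with y show b: "x \<notin> P 1 \<longleftrightarrow> b" unfolding assms(2) by (cases b) (simp_all only: of_bool_eq add_0_left not_False_eq_True not_True_eq_False)
  show "tail x = y" unfolding tail_def b using assms(2) by simp
qed

text \<open>For a unit \<open>1 + a \<pi> + b \<pi>\<^sup>2 + c \<pi>\<^sup>3 + \<dots>\<close> the type is the digit \<open>a\<close>; the class is the
  third digit after the second one has been cleared by the square \<open>1 + \<pi>\<^sup>2 + \<pi>\<^sup>3 + \<dots>\<close>.\<close>

definition type :: "'a \<Rightarrow> bool" where "type x \<longleftrightarrow> tail x \<notin> P 1"

definition cls :: "'a \<Rightarrow> bool" where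
  "cls x \<longleftrightarrow> (tail (tail (tail x)) \<notin> P 1) \<noteq> (tail (tail x) \<notin> P 1 \<and> tail x \<in> P 1)"

lemma unit_digits:
  assumes "x \<in> U"
  obtains b c r where "r \<in> R"
    "x = 1 + of_bool (type x) * \<pi> + of_bool b * \<pi> ^ 2 + of_bool c * \<pi> ^ 3 + \<pi> ^ 4 * r"
    "cls x = (c \<noteq> (b \<and> \<not> type x))"
proof -
  define y z w r where "y = tail x" "z = tail y" "w = tail z" "r = tail w"
  have R: "x \<in> R" "r \<in> R" using assms by (auto simp: y_z_w_r_def)
  have "x = 1 + \<pi> * y" using tail_eq[of x] assms by (simp add: y_z_w_r_def U_def)
  also have "y = of_bool (type x) + \<pi> * z" using tail_eq[of y] by (simp add: y_z_w_r_def type_def)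
  also have "z = of_bool (z \<notin> P 1) + \<pi> * w" using tail_eq[of z] by (simp add: y_z_w_r_def)
  also have "w = of_bool (w \<notin> P 1) + \<pi> * r" using tail_eq[of w] by (simp add: y_z_w_r_def)
  finally have "x = 1 + of_bool (type x) * \<pi> + of_bool (z \<notin> P 1) * \<pi> ^ 2 + of_bool (w \<notin> P 1) * \<pi> ^ 3 + \<pi> ^ 4 * r"
    by (simp add: algebra_simps small_powers)
  moreover have "cls x = ((w \<notin> P 1) \<noteq> (z \<notin> P 1 \<and> \<not> type x))" by (simp add: cls_def type_def y_z_w_r_def)
  ultimately show ?thesis using that R(2) by blast
qed

lemma unit_I:
  assumes "r \<in> R" "x = 1 + of_bool a * \<pi> + \<pi> ^ 2 * r"
  shows "x \<in> U" "type x = a"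
proof -
  have 1: "x = of_bool True + \<pi> * (of_bool a + \<pi> * r)" using assms(2) by (simp add: algebra_simps power2_eq_square)
  have R: "of_bool a + \<pi> * r \<in> R" using assms(1) by simp
  then have "x \<in> R" using 1 by simp
  then show "x \<in> U" using digit_unique(1)[OF R 1] by (simp add: U_def)
  show "type x = a" unfolding type_def digit_unique(2)[OF R 1] using digit_unique(1)[OF assms(1) refl] .
qed

lemma parity_red:
  obtains q where "q \<in> R" "of_nat k = of_bool (odd k) + \<pi> ^ 2 * q"
proof -
  obtain h where h: "h \<in> R" "2 = \<pi> ^ 2 * h" using two_P by (auto simp: P_def)
  have "of_nat k = (of_nat (k mod 2) + 2 * of_nat (k div 2) :: 'a)"
    by (metis mod_mult_div_eq of_nat_add of_nat_mult of_nat_numeral)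
  also have "\<dots> = of_bool (odd k) + \<pi> ^ 2 * (h * of_nat (k div 2))"
    by (subst h(2)) (simp add: mod2_eq_if mult.assoc)
  finally have eq: "of_nat k = of_bool (odd k) + \<pi> ^ 2 * (h * of_nat (k div 2))" .
  show ?thesis by (rule that[OF _ eq]) (use h(1) in simp)
qed

text \<open>Because 2 lies in \<open>P 2\<close>, carries from the digits at
  \<open>\<pi> ^ 2\<close> and \<open>\<pi> ^ 3\<close> only affect \<open>P 4\<close>. Modulo
  \<open>\<pi> ^ 4\<close> the parities of the two digit sums therefore suffice.\<close>

definition digit23 :: "nat \<Rightarrow> nat \<Rightarrow> 'a" where
  "digit23 k l = \<pi> ^ 2 * of_bool (odd k) + \<pi> ^ 3 * of_bool (odd l)"

lemma digit23_red:
  assumes "q \<in> R" "x = \<pi> ^ 2 * of_nat k + \<pi> ^ 3 * of_nat l + \<pi> ^ 4 * q"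
  shows "x - digit23 k l \<in> P 4"
proof -
  obtain u where u: "u \<in> R" "of_nat k = of_bool (odd k) + \<pi> ^ 2 * u" using parity_red .
  obtain v where v: "v \<in> R" "of_nat l = of_bool (odd l) + \<pi> ^ 2 * v" using parity_red .
  have "x - digit23 k l = \<pi> ^ 4 * (u + \<pi> * v + q)"
    unfolding assms(2) u(2) v(2) digit23_def by (simp add: algebra_simps small_powers)
  then show ?thesis using u v assms by (simp add: P_I)
qed

text \<open>The sum of the leading ones contributes
  \<open>\<pi> ^ 2 + of_bool \<epsilon> * \<pi> ^ 3\<close>, and twice a \<open>\<pi>\<close>
  contributes a \<open>\<pi> ^ 3\<close>. Multiplying y by \<open>\<sigma>\<close> adds
  \<open>\<pi> ^ 2\<close> + (1 + a) \<open>\<pi> ^ 3\<close>, so exactly one of the two sums has an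
  odd digit at \<open>\<pi> ^ 2\<close>.\<close>

lemma same_type_sum:
  assumes "x = 1 + of_bool a * \<pi> + of_bool b * \<pi> ^ 2 + of_bool c * \<pi> ^ 3 + \<pi> ^ 4 * r" "r \<in> R"
    and "y = 1 + of_bool a * \<pi> + of_bool b' * \<pi> ^ 2 + of_bool c' * \<pi> ^ 3 + \<pi> ^ 4 * r'" "r' \<in> R"
    and "\<sigma> = 1 + \<pi> ^ 2 + \<pi> ^ 3 + \<pi> ^ 4 * s" "s \<in> R"
  shows "x + y - digit23 (1 + of_bool b + of_bool b') (of_bool \<epsilon> + of_bool a + of_bool c + of_bool c') \<in> P 4"
    and "x + \<sigma> * y - digit23 (of_bool b + of_bool b') (1 + of_bool \<epsilon> + of_bool c + of_bool c') \<in> P 4"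
proof -
  obtain e where e: "e \<in> R" "2 = \<pi> ^ 2 + of_bool \<epsilon> * \<pi> ^ 3 + \<pi> ^ 4 * e" using two_eq by blast
  define q where "q = r + r' + e + of_bool \<epsilon> * of_bool a + e * of_bool a * \<pi>"
  have q: "q \<in> R" using e assms by (simp add: q_def)
  have "x + y = 2 * (1 + of_bool a * \<pi>) + \<pi> ^ 2 * (of_bool b + of_bool b') + \<pi> ^ 3 * (of_bool c + of_bool c') + \<pi> ^ 4 * (r + r')"
    unfolding assms(1,3) by (simp add: algebra_simps)
  also have "2 * (1 + of_bool a * \<pi>) = (\<pi> ^ 2 + of_bool \<epsilon> * \<pi> ^ 3 + \<pi> ^ 4 * e) * (1 + of_bool a * \<pi>)"
    using e(2) by simp
  finally have 1: "x + y = \<pi> ^ 2 * of_nat (1 + of_bool b + of_bool b')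
      + \<pi> ^ 3 * of_nat (of_bool \<epsilon> + of_bool a + of_bool c + of_bool c') + \<pi> ^ 4 * q"
    by (simp add: q_def algebra_simps small_powers)
  from digit23_red[OF q this]
  show "x + y - digit23 (1 + of_bool b + of_bool b') (of_bool \<epsilon> + of_bool a + of_bool c + of_bool c') \<in> P 4" .
  define w where "w = of_bool b' + of_bool c' * \<pi> + \<pi> ^ 2 * r'"
  define z where "z = of_bool a + (1 + \<pi>) * w + s * y"
  have z: "z \<in> R" using assms(2,4,6) by (simp add: z_def w_def assms(3))
  have y: "y = 1 + of_bool a * \<pi> + \<pi> ^ 2 * w"
    unfolding assms(3) w_def by (simp add: algebra_simps small_powers)
  have "(\<sigma> - 1) * y = (\<pi> ^ 2 + \<pi> ^ 3) * y + \<pi> ^ 4 * (s * y)" unfolding assms(5) by (simp add: algebra_simps)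
  also have "(\<pi> ^ 2 + \<pi> ^ 3) * y = \<pi> ^ 2 * 1 + \<pi> ^ 3 * (1 + of_bool a) + \<pi> ^ 4 * (of_bool a + (1 + \<pi>) * w)"
    unfolding y by (simp add: algebra_simps small_powers)
  finally have "(\<sigma> - 1) * y = \<pi> ^ 2 * 1 + \<pi> ^ 3 * (1 + of_bool a) + \<pi> ^ 4 * z"
    by (simp add: z_def algebra_simps)
  then have "x + \<sigma> * y = \<pi> ^ 2 * of_nat (2 + of_bool b + of_bool b')
      + \<pi> ^ 3 * of_nat (1 + of_bool \<epsilon> + of_bool c + of_bool c' + 2 * of_bool a) + \<pi> ^ 4 * (q + z)"
    using 1 by (simp add: algebra_simps)
  from digit23_red[OF _ this]
  show "x + \<sigma> * y - digit23 (of_bool b + of_bool b') (1 + of_bool \<epsilon> + of_bool c + of_bool c') \<in> P 4"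
    using q z by (simp add: digit23_def)
qed

lemma digit23_unit:
  assumes "x - digit23 k l \<in> P 4" "odd k"
  shows "\<exists>z\<in>U. type z = odd l \<and> x = \<pi> ^ 2 * z"
proof -
  obtain q where q: "q \<in> R" "x - digit23 k l = \<pi> ^ 4 * q" using assms(1) by (auto simp: P_def)
  have "x = \<pi> ^ 2 * (1 + of_bool (odd l) * \<pi> + \<pi> ^ 2 * q)"
    using q(2) assms(2) by (simp add: digit23_def algebra_simps small_powers)
  then show ?thesis using unit_I[OF q(1) refl, of "odd l"] by blast
qed

lemma digit23_unit3:
  assumes "x - digit23 k l \<in> P 4" "even k" "odd l"
  shows "\<exists>z\<in>U. x = \<pi> ^ 3 * z"
proof -
  obtain q where q: "q \<in> R" "x - digit23 k l = \<pi> ^ 4 * q" using assms(1) by (auto simp: P_def)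
  have "x = \<pi> ^ 3 * (1 + \<pi> ^ 1 * q)"
    using q(2) assms(2,3) by (simp add: digit23_def algebra_simps small_powers)
  then show ?thesis using U_add_P[OF one_U P_I[OF q(1), of 1]] by blast
qed

lemma digit23_P4: "x - digit23 k l \<in> P 4 \<Longrightarrow> even k \<Longrightarrow> even l \<Longrightarrow> x \<in> P 4"
  by (simp add: digit23_def)

text \<open>Whether the second digits b, b' agree decides which factor gives order two; the other
  factor gives the longer climb. The correction in \<open>cls\<close> is the amount 1 + a by which
  clearing b with \<open>\<sigma>\<close> shifts the third digit, so the outcome depends on the
  classes only.\<close>

lemma unit_sum_bad:
  assumes "x \<in> U" "y \<in> U" "type x = type y" "(cls x = cls y) = (\<not> \<epsilon>)"
    and "\<sigma> = 1 + \<pi> ^ 2 + \<pi> ^ 3 + \<pi> ^ 4 * s" "s \<in> R"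
  shows "\<exists>f\<in>{1, \<sigma>}. \<exists>z\<in>U. type z = type x \<and> x + f * y = \<pi> ^ 2 * z"
    and "\<exists>f\<in>{1, \<sigma>}. \<exists>z\<in>U. x + f * y = \<pi> ^ 3 * z"
proof -
  obtain b c r where x: "r \<in> R"
    "x = 1 + of_bool (type x) * \<pi> + of_bool b * \<pi> ^ 2 + of_bool c * \<pi> ^ 3 + \<pi> ^ 4 * r"
    "cls x = (c \<noteq> (b \<and> \<not> type x))" by (rule unit_digits[OF assms(1)])
  obtain b' c' r' where y: "r' \<in> R"
    "y = 1 + of_bool (type x) * \<pi> + of_bool b' * \<pi> ^ 2 + of_bool c' * \<pi> ^ 3 + \<pi> ^ 4 * r'"
    "cls y = (c' \<noteq> (b' \<and> \<not> type x))" by (rule unit_digits[OF assms(2), folded assms(3)])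
  note s = same_type_sum[OF x(2,1) y(2,1) assms(5,6)]
  have c: "((c \<noteq> (b \<and> \<not> type x)) = (c' \<noteq> (b' \<and> \<not> type x))) = (\<not> \<epsilon>)" using assms(4) x(3) y(3) by simp
  show "\<exists>f\<in>{1, \<sigma>}. \<exists>z\<in>U. type z = type x \<and> x + f * y = \<pi> ^ 2 * z"
  proof (cases "b = b'")
    case True
    then show ?thesis using digit23_unit[OF s(1)] c
      by (cases \<epsilon>; cases b; cases c; cases c'; cases "type x") auto
  next
    case False
    then show ?thesis using digit23_unit[OF s(2)] c
      by (cases \<epsilon>; cases b; cases c; cases c'; cases "type x") auto
  qed
  show "\<exists>f\<in>{1, \<sigma>}. \<exists>z\<in>U. x + f * y = \<pi> ^ 3 * z"
  proof (cases "b = b'")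
    case True
    then show ?thesis using digit23_unit3[OF s(2)] c
      by (cases \<epsilon>; cases b; cases c; cases c'; cases "type x") auto
  next
    case False
    then show ?thesis using digit23_unit3[OF s(1)] c
      by (cases \<epsilon>; cases b; cases c; cases c'; cases "type x") auto
  qed
qed

lemma unit_sum_good:
  assumes "x \<in> U" "y \<in> U" "type x = type y" "(cls x = cls y) = \<epsilon>"
    and "\<sigma> = 1 + \<pi> ^ 2 + \<pi> ^ 3 + \<pi> ^ 4 * s" "s \<in> R"
  shows "\<exists>f\<in>{1, \<sigma>}. \<exists>z\<in>U. type z \<noteq> type x \<and> x + f * y = \<pi> ^ 2 * z"
    and "\<exists>f\<in>{1, \<sigma>}. x + f * y \<in> P 4"
proof -
  obtain b c r where x: "r \<in> R"
    "x = 1 + of_bool (type x) * \<pi> + of_bool b * \<pi> ^ 2 + of_bool c * \<pi> ^ 3 + \<pi> ^ 4 * r"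
    "cls x = (c \<noteq> (b \<and> \<not> type x))" by (rule unit_digits[OF assms(1)])
  obtain b' c' r' where y: "r' \<in> R"
    "y = 1 + of_bool (type x) * \<pi> + of_bool b' * \<pi> ^ 2 + of_bool c' * \<pi> ^ 3 + \<pi> ^ 4 * r'"
    "cls y = (c' \<noteq> (b' \<and> \<not> type x))" by (rule unit_digits[OF assms(2), folded assms(3)])
  note s = same_type_sum[OF x(2,1) y(2,1) assms(5,6)]
  have c: "((c \<noteq> (b \<and> \<not> type x)) = (c' \<noteq> (b' \<and> \<not> type x))) = \<epsilon>" using assms(4) x(3) y(3) by simp
  show "\<exists>f\<in>{1, \<sigma>}. \<exists>z\<in>U. type z \<noteq> type x \<and> x + f * y = \<pi> ^ 2 * z"
  proof (cases "b = b'")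
    case True
    then show ?thesis using digit23_unit[OF s(1)] c
      by (cases \<epsilon>; cases b; cases c; cases c'; cases "type x") auto
  next
    case False
    then show ?thesis using digit23_unit[OF s(2)] c
      by (cases \<epsilon>; cases b; cases c; cases c'; cases "type x") auto
  qed
  show "\<exists>f\<in>{1, \<sigma>}. x + f * y \<in> P 4"
  proof (cases "b = b'")
    case True
    then show ?thesis using digit23_P4[OF s(2)] c
      by (cases \<epsilon>; cases b; cases c; cases c'; cases "type x") auto
  next
    case False
    then show ?thesis using digit23_P4[OF s(1)] c
      by (cases \<epsilon>; cases b; cases c; cases c'; cases "type x") auto
  qed
qed

text \<open>Replacing x + y by x + \<open>\<sigma>\<close> y adds \<open>\<pi> ^ 2\<close> times a
  unit. After division by \<open>\<pi>\<close> this flips the digit that is the type, so both types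
  are available.\<close>

lemma unit_sum_mixed:
  assumes "x \<in> U" "y \<in> U" "type x \<noteq> type y"
    and "\<sigma> = 1 + \<pi> ^ 2 + \<pi> ^ 3 + \<pi> ^ 4 * s" "s \<in> R"
  shows "\<exists>f\<in>{1, \<sigma>}. \<exists>z\<in>U. type z = t \<and> x + f * y = \<pi> * z"
proof -
  obtain b c r where x: "r \<in> R"
    "x = 1 + of_bool (type x) * \<pi> + of_bool b * \<pi> ^ 2 + of_bool c * \<pi> ^ 3 + \<pi> ^ 4 * r"
    "cls x = (c \<noteq> (b \<and> \<not> type x))" by (rule unit_digits[OF assms(1)])
  obtain b' c' r' where y: "r' \<in> R"
    "y = 1 + of_bool (type y) * \<pi> + of_bool b' * \<pi> ^ 2 + of_bool c' * \<pi> ^ 3 + \<pi> ^ 4 * r'"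
    "cls y = (c' \<noteq> (b' \<and> \<not> type y))" by (rule unit_digits[OF assms(2)])
  obtain e where e: "e \<in> R" "2 = \<pi> ^ 2 + of_bool \<epsilon> * \<pi> ^ 3 + \<pi> ^ 4 * e" using two_eq by blast
  obtain u where u: "u \<in> R" "of_nat (1 + of_bool b + of_bool b') = of_bool (odd (1 + of_bool b + of_bool b' :: nat)) + \<pi> ^ 2 * u" using parity_red .
  have t: "of_bool (type x) + of_bool (type y) = (1 :: 'a)" using assms(3) by (cases "type x"; cases "type y") auto
  define q where "q = u * \<pi> + of_bool \<epsilon> + \<pi> * e + (of_bool c + of_bool c') + \<pi> * (r + r')"
  have q: "q \<in> R" using u e x y by (simp add: q_def)
  have "x + y = 2 + (of_bool (type x) + of_bool (type y)) * \<pi> + (of_bool b + of_bool b') * \<pi> ^ 2 + (of_bool c + of_bool c') * \<pi> ^ 3 + \<pi> ^ 4 * (r + r')"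
    by (subst x(2), subst y(2)) (simp add: algebra_simps)
  also have "\<dots> = \<pi> + of_nat (1 + of_bool b + of_bool b') * \<pi> ^ 2 + \<pi> ^ 3 * (of_bool \<epsilon> + \<pi> * e + (of_bool c + of_bool c') + \<pi> * (r + r'))"
    unfolding t e(2) by (simp add: algebra_simps small_powers)
  also have "\<dots> = \<pi> * (1 + of_bool (odd (1 + of_bool b + of_bool b' :: nat)) * \<pi> + \<pi> ^ 2 * q)"
    unfolding u(2) q_def by (simp add: algebra_simps small_powers)
  finally have 1: "x + y = \<pi> * (1 + of_bool (odd (1 + of_bool b + of_bool b' :: nat)) * \<pi> + \<pi> ^ 2 * q)" .
  define z where "z = 1 + of_bool (odd (1 + of_bool b + of_bool b' :: nat)) * \<pi> + \<pi> ^ 2 * q"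
  have z: "z \<in> U" using unit_I(1)[OF q z_def] .
  obtain y' where y': "y' \<in> R" "y = 1 + \<pi> * y'" using assms(2) U_iff[of y] by (auto simp: P_def algebra_simps)
  define z' where "z' = z + \<pi> * (1 + \<pi> * (y' + (1 + \<pi> * s) * y))"
  have 2: "x + \<sigma> * y = \<pi> * z'"
    using 1 unfolding assms(4) z'_def z_def[symmetric]
    by (simp add: algebra_simps small_powers) (simp add: y'(2) algebra_simps)
  obtain b2 c2 r2 where zz: "r2 \<in> R"
    "z = 1 + of_bool (type z) * \<pi> + of_bool b2 * \<pi> ^ 2 + of_bool c2 * \<pi> ^ 3 + \<pi> ^ 4 * r2"
    "cls z = (c2 \<noteq> (b2 \<and> \<not> type z))" by (rule unit_digits[OF z])
  obtain v where v: "v \<in> R" "of_nat (1 + of_bool (type z)) = of_bool (odd (1 + of_bool (type z) :: nat)) + \<pi> ^ 2 * v" using parity_red .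
  have yR: "y \<in> R" using assms(2) by simp
  have "z' = 1 + of_nat (1 + of_bool (type z)) * \<pi> + \<pi> ^ 2 * (of_bool b2 + of_bool c2 * \<pi> + \<pi> ^ 2 * r2 + (y' + (1 + \<pi> * s) * y))"
    unfolding z'_def by (subst zz(2)) (simp add: algebra_simps small_powers)
  also have "\<dots> = 1 + of_bool (\<not> type z) * \<pi> + \<pi> ^ 2 * (\<pi> * v + (of_bool b2 + of_bool c2 * \<pi> + \<pi> ^ 2 * r2 + (y' + (1 + \<pi> * s) * y)))"
    unfolding v(2) by (simp add: algebra_simps small_powers)
  finally have z'_eq: "z' = 1 + of_bool (\<not> type z) * \<pi> + \<pi> ^ 2 * (\<pi> * v + (of_bool b2 + of_bool c2 * \<pi> + \<pi> ^ 2 * r2 + (y' + (1 + \<pi> * s) * y)))" .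
  have z': "z' \<in> U" "type z' = (\<not> type z)"
    using unit_I[OF _ z'_eq] v(1) zz(1) y'(1) yR assms(5) by auto
  show ?thesis
  proof (cases "type z = t")
    case True
    then show ?thesis using 1 z by (auto simp: z_def)
  next
    case False
    then show ?thesis using 2 z' by auto
  qed
qed

section \<open>Powers of units modulo the fourth power of the uniformizer\<close>

lemma square_unit:
  assumes "w \<in> U"
  shows "w ^ 2 - 1 \<in> P 4 \<or> w ^ 2 - (1 + \<pi> ^ 2 + \<pi> ^ 3) \<in> P 4"
proof -
  obtain b c r where w: "r \<in> R"
    "w = 1 + of_bool (type w) * \<pi> + of_bool b * \<pi> ^ 2 + of_bool c * \<pi> ^ 3 + \<pi> ^ 4 * r"
    "cls w = (c \<noteq> (b \<and> \<not> type w))" by (rule unit_digits[OF assms])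
  define q where "q = of_bool b + of_bool c * \<pi> + \<pi> ^ 2 * r"
  have q: "q \<in> R" using w(1) by (simp add: q_def)
  have w2: "w = 1 + of_bool (type w) * \<pi> + \<pi> ^ 2 * q"
    by (subst w(2)) (simp add: q_def algebra_simps small_powers)
  obtain e where e: "e \<in> R" "2 = \<pi> ^ 2 + of_bool \<epsilon> * \<pi> ^ 3 + \<pi> ^ 4 * e" using two_eq by blast
  define h where "h = 1 + of_bool \<epsilon> * \<pi> + \<pi> ^ 2 * e"
  have h: "h \<in> R" "2 = \<pi> ^ 2 * h" using e(1)
    by (simp add: h_def) (subst e(2), simp add: h_def algebra_simps small_powers)
  show ?thesis
  proof (cases "type w")
    case False
    have "w ^ 2 - 1 = 2 * (\<pi> ^ 2 * q) + \<pi> ^ 4 * q ^ 2"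
      by (subst w2) (simp add: False algebra_simps power2_eq_square power4_eq_xxxx)
    also have "\<dots> = \<pi> ^ 4 * (h * q + q ^ 2)"
      by (subst h(2)) (simp add: algebra_simps power2_eq_square power4_eq_xxxx)
    finally show ?thesis using q h by (simp add: P_I)
  next
    case True
    have "w ^ 2 = 1 + \<pi> ^ 2 + 2 * (\<pi> + \<pi> ^ 2 * q * (1 + \<pi>)) + \<pi> ^ 4 * q ^ 2"
      by (subst w2) (simp add: True algebra_simps power2_eq_square power4_eq_xxxx)
    also have "\<dots> = 1 + \<pi> ^ 2 + \<pi> ^ 2 * h * (\<pi> + \<pi> ^ 2 * q * (1 + \<pi>)) + \<pi> ^ 4 * q ^ 2"
      by (subst h(2)) simp
    also have "\<dots> = 1 + \<pi> ^ 2 + \<pi> ^ 3 + \<pi> ^ 4 * (of_bool \<epsilon> + \<pi> * e + h * q * (1 + \<pi>) + q ^ 2)"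
      by (simp add: h_def algebra_simps small_powers)
    finally have "w ^ 2 - (1 + \<pi> ^ 2 + \<pi> ^ 3) = \<pi> ^ 4 * (of_bool \<epsilon> + \<pi> * e + h * q * (1 + \<pi>) + q ^ 2)"
      by simp
    then show ?thesis using q h e by (simp add: P_I)
  qed
qed

text \<open>Squares of units are 1 modulo \<open>P 2\<close>, so both \<open>(w ^ 2 - 1) ^ 2\<close>
  and \<open>2 * (w ^ 2 - 1)\<close> lie in \<open>P 4\<close>. Consequently
  \<open>w ^ (2 * m)\<close> depends modulo \<open>P 4\<close> only on the parity of m.\<close>

lemma fourth_power_unit:
  assumes "w \<in> U"
  shows "w ^ 4 - 1 \<in> P 4"
proof -
  have "w ^ 2 - 1 \<in> P 2" using square_unit[OF assms]
  proof
    assume "w ^ 2 - (1 + \<pi> ^ 2 + \<pi> ^ 3) \<in> P 4"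
    then have "w ^ 2 - (1 + \<pi> ^ 2 + \<pi> ^ 3) + (\<pi> ^ 2 + \<pi> ^ 3) \<in> P 2"
      by (intro P_add pi_P) (auto intro: P_mono)
    then show ?thesis by (simp add: algebra_simps)
  qed (auto intro: P_mono)
  then have "(w ^ 2 - 1) * (w ^ 2 - 1) + 2 * (w ^ 2 - 1) \<in> P 4"
    using P_mult[of "w ^ 2 - 1" 2 "w ^ 2 - 1" 2] P_mult[OF two_P, of "w ^ 2 - 1" 2] P_add by simp
  then show ?thesis by (simp add: algebra_simps power2_eq_square power4_eq_xxxx)
qed

lemma power_cong_P:
  assumes "x \<in> R" "y \<in> R" "x - y \<in> P k"
  shows "x ^ n - y ^ n \<in> P k"
proof (induction n)
  case (Suc n)
  have "x * (x ^ n - y ^ n) + (x - y) * y ^ n \<in> P k" using Suc assms by (intro P_add P_multR) auto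
  then show ?case by (simp add: algebra_simps)
qed simp

lemma odd_power_unit:
  assumes "w \<in> U" "odd m"
  shows "w ^ (2 * m) - w ^ 2 \<in> P 4"
proof -
  obtain j where "m = 2 * j + 1" using assms(2) by (elim oddE)
  then have "w ^ (2 * m) - w ^ 2 = w ^ 2 * ((w ^ 4) ^ j - 1)"
    by (simp add: algebra_simps flip: power_mult power_add)
  then show ?thesis using power_cong_P[OF _ one_mem fourth_power_unit[OF assms(1)], of j] assms(1)
    by (simp add: P_multR)
qed

lemma power_unit_cases:
  assumes "w \<in> U" "odd m"
  shows "w ^ (2 * m) - 1 \<in> P 4 \<or> w ^ (2 * m) - (1 + \<pi> ^ 2 + \<pi> ^ 3) \<in> P 4"
  using square_unit[OF assms(1)] P_add[OF odd_power_unit[OF assms], of "w ^ 2 - 1"]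
    P_add[OF odd_power_unit[OF assms], of "w ^ 2 - (1 + \<pi> ^ 2 + \<pi> ^ 3)"]
  by (simp only: diff_add_cancel add_diff_eq) blast

lemma pi_plus_1 [simp]: "1 + \<pi> \<in> U"
  using U_add_P[OF one_U pi_P[of 1 1]] by simp

lemma sigma_eq:
  assumes "odd m"
  obtains s where "s \<in> R" "(1 + \<pi>) ^ (2 * m) = 1 + \<pi> ^ 2 + \<pi> ^ 3 + \<pi> ^ 4 * s"
proof -
  obtain e where e: "e \<in> R" "2 = \<pi> ^ 2 + of_bool \<epsilon> * \<pi> ^ 3 + \<pi> ^ 4 * e" using two_eq by blast
  have "(1 + \<pi>) ^ 2 - (1 + \<pi> ^ 2 + \<pi> ^ 3) = 2 * \<pi> - \<pi> ^ 3" by (simp add: algebra_simps power2_eq_square)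
  also have "\<dots> = \<pi> ^ 4 * (of_bool \<epsilon> + \<pi> * e)"
    by (subst e(2)) (simp add: algebra_simps small_powers)
  finally have "(1 + \<pi>) ^ 2 - (1 + \<pi> ^ 2 + \<pi> ^ 3) \<in> P 4" using e(1) by (simp add: P_I)
  from P_add[OF odd_power_unit[OF pi_plus_1 assms] this]
  have "(1 + \<pi>) ^ (2 * m) - (1 + \<pi> ^ 2 + \<pi> ^ 3) \<in> P 4" by (simp only: diff_add_cancel add_diff_eq)
  then obtain s where "s \<in> R" "(1 + \<pi>) ^ (2 * m) - (1 + \<pi> ^ 2 + \<pi> ^ 3) = \<pi> ^ 4 * s"
    unfolding P_def by blast
  then show ?thesis using that[of s] by (simp add: algebra_simps)
qed

text \<open>\<open>lev\<close> gives the levels modulo d, \<open>l\<close> the representatives used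
  by the contraction. The variable \<open>i0\<close> sits at the lowest level and has a unit value,
  so it is the one that \<open>hensel\<close> can adjust, and t + 5 is the precision needed to
  start.\<close>

theorem approximate_zero:
  fixes lev :: "nat \<Rightarrow> nat" and u :: "nat \<Rightarrow> 'a"
  assumes m: "odd m" "m \<ge> 3" and s: "s = (if \<epsilon> then 2 * m + 1 else 3 * m)"
    and lev: "\<And>i. i < s \<Longrightarrow> lev i < 2 * m" and u: "\<And>i. i < s \<Longrightarrow> u i \<in> U"
  shows "\<exists>t A l w i0. A \<subseteq> {..<s} \<and> i0 \<in> A \<and> l i0 = t \<and>
    (\<forall>i\<in>A. w i \<in> U \<and> t \<le> l i \<and> l i mod (2 * m) = lev i) \<and>
    (\<Sum>i\<in>A. u i * \<pi> ^ l i * w i ^ (2 * m)) \<in> P (t + 5)"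
proof (rule ccontr)
  assume no_zero: "\<not> ?thesis"
  define \<sigma> where "\<sigma> = (1 + \<pi>) ^ (2 * m)"
  obtain c0 where \<sigma>: "\<sigma> = 1 + \<pi> ^ 2 + \<pi> ^ 3 + \<pi> ^ 4 * c0" "c0 \<in> R"
    using sigma_eq[OF m(1)] unfolding \<sigma>_def by metis
  \<comment> \<open>The pair (k, i) is variable i rescaled by a power of \<open>\<pi>\<close> so
    that its term has order k.\<close>
  define I where "I = {(k, i). i < s \<and> lev i = k mod (2 * m)}"
  \<comment> \<open>Only powers of 1 + \<open>\<pi>\<close> are used as values; their d-th powers
    are the powers of \<open>\<sigma>\<close>.\<close>
  define yields where "yields B x \<longleftrightarrow> finite B \<and> B \<subseteq> I \<and>
    (\<exists>j. x = (\<Sum>b\<in>B. \<sigma> ^ j b * u (snd b) * \<pi> ^ fst b))" for B x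
  define node where "node B l t c \<longleftrightarrow> (\<exists>x\<in>U. type x = t \<and> cls x = c \<and> yields B (\<pi> ^ l * x))" for B l t c
  define big where "big B l \<longleftrightarrow> (\<exists>x\<in>R. yields B (\<pi> ^ l * x))" for B l
  have yields_union: "yields (B \<union> B') (x + f * x')"
    if h: "yields B x" "yields B' x'" "B \<inter> B' = {}" "f \<in> {1, \<sigma>}" for B B' x x' f
  proof -
    obtain j j' where j: "x = (\<Sum>b\<in>B. \<sigma> ^ j b * u (snd b) * \<pi> ^ fst b)"
      "x' = (\<Sum>b\<in>B'. \<sigma> ^ j' b * u (snd b) * \<pi> ^ fst b)" using h by (auto simp: yields_def)
    obtain e where e: "f = \<sigma> ^ e" using h(4) by (metis insertE power_0 power_one_right singletonD)
    define g where "g b = (if b \<in> B then j b else e + j' b)" for b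
    have fin: "finite B" "finite B'" using h by (auto simp: yields_def)
    have "(\<Sum>b\<in>B \<union> B'. \<sigma> ^ g b * u (snd b) * \<pi> ^ fst b) =
        (\<Sum>b\<in>B. \<sigma> ^ g b * u (snd b) * \<pi> ^ fst b) + (\<Sum>b\<in>B'. \<sigma> ^ g b * u (snd b) * \<pi> ^ fst b)"
      using fin h(3) by (rule sum.union_disjoint)
    also have "(\<Sum>b\<in>B. \<sigma> ^ g b * u (snd b) * \<pi> ^ fst b) = x"
      unfolding j(1) by (rule sum.cong) (auto simp: g_def)
    also have "(\<Sum>b\<in>B'. \<sigma> ^ g b * u (snd b) * \<pi> ^ fst b) = f * x'"
      unfolding j(2) sum_distrib_left e by (rule sum.cong) (use h(3) in \<open>auto simp: g_def power_add mult.assoc\<close>)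
    finally have eq: "x + f * x' = (\<Sum>b\<in>B \<union> B'. \<sigma> ^ g b * u (snd b) * \<pi> ^ fst b)" ..
    show ?thesis unfolding yields_def
      by (intro conjI exI[of _ g] eq) (use h in \<open>auto simp: yields_def\<close>)
  qed
  have comb: "yields (B \<union> B') (\<pi> ^ l * (x + f * x'))"
    if "yields B (\<pi> ^ l * x)" "yields B' (\<pi> ^ l * x')" "B \<inter> B' = {}" "f \<in> {1, \<sigma>}" for B B' l x x' f
    using yields_union[OF that] by (simp add: algebra_simps)
  interpret contraction I fst "\<lambda>b. type (u (snd b))" "\<lambda>b. cls (u (snd b))" node big \<epsilon>
  proof
    fix k
    have "{b \<in> I. fst b = k} \<subseteq> {k} \<times> {..<s}" by (auto simp: I_def)
    then show "finite {b \<in> I. fst b = k}" by (rule finite_subset) auto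
  next
    fix b assume b: "b \<in> I"
    then have "yields {b} (\<pi> ^ fst b * u (snd b))"
      by (auto simp: yields_def mult.commute intro!: exI[of _ "\<lambda>_. 0"])
    moreover have "u (snd b) \<in> U" using b u by (auto simp: I_def)
    ultimately show "node {b} (fst b) (type (u (snd b))) (cls (u (snd b)))" by (auto simp: node_def)
  next
    fix B l t c i assume "node B l t c" "i \<le> l"
    then obtain x where x: "x \<in> U" "yields B (\<pi> ^ l * x)" by (auto simp: node_def)
    have eq: "\<pi> ^ l * x = \<pi> ^ i * (\<pi> ^ (l - i) * x)" using \<open>i \<le> l\<close> by (simp flip: power_add mult.assoc)
    show "big B i" unfolding big_def
      by (intro bexI[of _ "\<pi> ^ (l - i) * x"]) (use x(2) in \<open>simp only: eq\<close>, use x(1) in simp)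
  next
    fix B l t c B' c' t'' assume "node B l t c" "node B' l (\<not> t) c'" "B \<inter> B' = {}"
    then obtain x x' where x: "x \<in> U" "x' \<in> U" "type x = t" "type x' = (\<not> t)"
      "yields B (\<pi> ^ l * x)" "yields B' (\<pi> ^ l * x')" by (auto simp: node_def)
    obtain f z where f: "f \<in> {1, \<sigma>}" "z \<in> U" "type z = t''" "x + f * x' = \<pi> * z"
      using unit_sum_mixed[OF x(1,2) _ \<sigma>, of t''] x(3,4) by blast
    have "yields (B \<union> B') (\<pi> ^ (l + 1) * z)"
      using comb[OF x(5,6) \<open>B \<inter> B' = {}\<close> f(1)] f(4) by (simp add: power_add mult.assoc)
    then show "\<exists>c''. node (B \<union> B') (l + 1) t'' c''" using f by (auto simp: node_def)
  next
    fix B l t c B' c' assume a: "node B l t c" "node B' l t c'" "B \<inter> B' = {}" "(c = c') = (\<not> \<epsilon>)"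
    then obtain x x' where x: "x \<in> U" "x' \<in> U" "type x = t" "type x' = t" "cls x = c" "cls x' = c'"
      "yields B (\<pi> ^ l * x)" "yields B' (\<pi> ^ l * x')" by (auto simp: node_def)
    have xx: "type x = type x'" "(cls x = cls x') = (\<not> \<epsilon>)" using x a by auto
    obtain f z where f: "f \<in> {1, \<sigma>}" "z \<in> U" "type z = t" "x + f * x' = \<pi> ^ 2 * z"
      using unit_sum_bad(1)[OF x(1,2) xx \<sigma>, unfolded x(3)] by blast
    obtain f' z' where f': "f' \<in> {1, \<sigma>}" "z' \<in> U" "x + f' * x' = \<pi> ^ 3 * z'"
      using unit_sum_bad(2)[OF x(1,2) xx \<sigma>] by blast
    have "yields (B \<union> B') (\<pi> ^ (l + 2) * z)" "yields (B \<union> B') (\<pi> ^ (l + 3) * z')"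
      using comb[OF x(7,8) a(3) f(1)] comb[OF x(7,8) a(3) f'(1)] f(4) f'(3) by (simp_all only: power_add mult.assoc)
    then show "(\<exists>c''. node (B \<union> B') (l + 2) t c'') \<and> (\<exists>t'' c''. node (B \<union> B') (l + 3) t'' c'')"
      using f f' by (auto simp: node_def)
  next
    fix B l t c B' c' assume a: "node B l t c" "node B' l t c'" "B \<inter> B' = {}" "(c = c') = \<epsilon>"
    then obtain x x' where x: "x \<in> U" "x' \<in> U" "type x = t" "type x' = t" "cls x = c" "cls x' = c'"
      "yields B (\<pi> ^ l * x)" "yields B' (\<pi> ^ l * x')" by (auto simp: node_def)
    have xx: "type x = type x'" "(cls x = cls x') = \<epsilon>" using x a by auto
    obtain f z where f: "f \<in> {1, \<sigma>}" "z \<in> U" "type z = (\<not> t)" "x + f * x' = \<pi> ^ 2 * z"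
      using unit_sum_good(1)[OF x(1,2) xx \<sigma>, unfolded x(3)] by blast
    obtain f' where f': "f' \<in> {1, \<sigma>}" "x + f' * x' \<in> P 4"
      using unit_sum_good(2)[OF x(1,2) xx \<sigma>] by blast
    then obtain z' where z': "z' \<in> R" "x + f' * x' = \<pi> ^ 4 * z'" by (auto simp: P_def)
    have y: "yields (B \<union> B') (\<pi> ^ (l + 2) * z)" "yields (B \<union> B') (\<pi> ^ (l + 4) * z')"
      using comb[OF x(7,8) a(3) f(1)] comb[OF x(7,8) a(3) f'(1)] f(4) z'(2) by (simp_all only: power_add mult.assoc)
    have "big (B \<union> B') (l + 5)" if z1: "z' \<in> P 1"
    proof -
      obtain z2 where z2: "z2 \<in> R" "z' = \<pi> ^ 1 * z2" using z1 unfolding P_def by blast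
      have "\<pi> ^ (l + 4) * z' = \<pi> ^ (l + 4 + 1) * z2" unfolding z2(2) by (simp only: power_add mult.assoc)
      then have "yields (B \<union> B') (\<pi> ^ (l + 5) * z2)" using y(2) by (simp add: add.commute)
      then show ?thesis using z2(1) by (auto simp: big_def)
    qed
    moreover have "\<exists>t'' c''. node (B \<union> B') (l + 4) t'' c''" if "z' \<notin> P 1"
      using y(2) z'(1) that by (auto simp: node_def U_def)
    ultimately show "(\<exists>c''. node (B \<union> B') (l + 2) (\<not> t) c'') \<and>
        (big (B \<union> B') (l + 5) \<or> (\<exists>t'' c''. node (B \<union> B') (l + 4) t'' c''))"
      using y(1) f by (auto simp: node_def)
  next
    fix B l i assume "big B l" "i \<le> l"
    then obtain x where x: "x \<in> R" "yields B (\<pi> ^ l * x)" by (auto simp: big_def)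
    have eq: "\<pi> ^ l * x = \<pi> ^ i * (\<pi> ^ (l - i) * x)" using \<open>i \<le> l\<close> by (simp flip: power_add mult.assoc)
    show "big B i" unfolding big_def
      by (intro bexI[of _ "\<pi> ^ (l - i) * x"]) (use x(2) in \<open>simp only: eq\<close>, use x(1) in simp)
  next
    fix B k assume a: "big B (k + 5)" "\<forall>b\<in>B. k \<le> fst b \<and> fst b < k + 5"
    obtain x j where x: "x \<in> R" "\<pi> ^ (k + 5) * x = (\<Sum>b\<in>B. \<sigma> ^ j b * u (snd b) * \<pi> ^ fst b)"
      and B: "finite B" "B \<subseteq> I" using a(1) by (auto simp: big_def yields_def)
    \<comment> \<open>Needed to turn a set of unrolled variables into an assignment of one value to
      each actual variable.\<close>
    have inj: "inj_on snd B"
    proof (rule inj_onI)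
      fix b b' assume b: "b \<in> B" "b' \<in> B" "snd b = snd b'"
      then have "b \<in> I" "b' \<in> I" using B(2) by auto
      then have "fst b mod (2 * m) = fst b' mod (2 * m)" using b(3) by (auto simp: I_def case_prod_unfold)
      moreover have "fst b < fst b' + 2 * m" "fst b' < fst b + 2 * m" using a(2)[rule_format, OF b(1)] a(2)[rule_format, OF b(2)] m(2) by auto
      ultimately have "fst b = fst b'" by (rule mod_close_eq)
      then show "b = b'" using b(3) by (simp add: prod_eq_iff)
    qed
    define h where "h = inv_into B snd"
    have h: "h (snd b) = b" if "b \<in> B" for b using inj that by (simp add: h_def)
    have "(\<Sum>i\<in>snd ` B. u i * \<pi> ^ fst (h i) * ((1 + \<pi>) ^ j (h i)) ^ (2 * m)) = \<pi> ^ (k + 5) * x"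
      unfolding x(2) sum.reindex[OF inj]
      by (rule sum.cong) (simp_all add: h \<sigma>_def mult.commute mult.left_commute flip: power_mult)
    then have z: "(\<Sum>i\<in>snd ` B. u i * \<pi> ^ fst (h i) * ((1 + \<pi>) ^ j (h i)) ^ (2 * m)) \<in> P (k + 5)"
      using x(1) by (simp add: P_I)
    show "\<forall>b\<in>B. fst b \<noteq> k"
    proof (intro ballI notI)
      fix b assume b: "b \<in> B" "fst b = k"
      have sub: "snd b' < s" "fst b' mod (2 * m) = lev (snd b')" if "b' \<in> B" for b'
        using subsetD[OF B(2) that] by (auto simp: I_def case_prod_unfold)
      have 1: "snd ` B \<subseteq> {..<s}" "snd b \<in> snd ` B" "fst (h (snd b)) = k" using sub b h by auto
      have 2: "\<forall>i\<in>snd ` B. (1 + \<pi>) ^ j (h i) \<in> U \<and> k \<le> fst (h i) \<and> fst (h i) mod (2 * m) = lev i"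
        using sub a(2) h by simp
      show False using no_zero
      proof (rule notE, intro exI conjI)
        show "snd ` B \<subseteq> {..<s}" "snd b \<in> snd ` B" by (rule 1)+
        show "fst (h (snd b)) = k" by (rule 1)
        show "\<forall>i\<in>snd ` B. (1 + \<pi>) ^ j (h i) \<in> U \<and> k \<le> fst (h i) \<and> fst (h i) mod (2 * m) = lev i" by (rule 2)
        show "(\<Sum>i\<in>snd ` B. u i * \<pi> ^ fst (h i) * ((1 + \<pi>) ^ j (h i)) ^ (2 * m)) \<in> P (k + 5)" by (rule z)
      qed
    qed
  qed
  have V_eq: "V k = {k} \<times> {i. i < s \<and> lev i = k mod (2 * m)}" for k
    unfolding V_def unfolding I_def by auto
  have n_eq: "n k = card {i. i < s \<and> lev i = k mod (2 * m)}" for k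
    unfolding n_def V_eq by (simp add: card_cartesian_product)
  have per: "n (k + 2 * m) = n k" for k by (simp add: n_eq)
  have "(\<Sum>k<2 * m. n k) = (\<Sum>k<2 * m. card {i. i < s \<and> lev i = k})" by (simp add: n_eq)
  also have "\<dots> = card (\<Union>k<2 * m. {i. i < s \<and> lev i = k})"
    by (rule card_UN_disjoint[symmetric]) auto
  also have "(\<Union>k<2 * m. {i. i < s \<and> lev i = k}) = {..<s}" using lev by auto
  finally have tot: "(\<Sum>k<2 * m. n k) = s" by simp
  show False
  proof (cases \<epsilon>)
    case True
    show ?thesis by (rule no_period_eps[OF True per]) (use tot s True m in auto)
  next
    case False
    show ?thesis
    proof (rule no_period[OF False per m(1)])
      show "(\<Sum>k<2 * m. n k) = 3 * m" using tot s False by simp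
      fix k b assume "b \<in> V k"
      then show "\<exists>b'\<in>V (k + 2 * m). type (u (snd b')) = type (u (snd b))"
        by (intro bexI[of _ "(k + 2 * m, snd b)"]) (auto simp: V_eq)
    qed
  qed
qed

section \<open>Anisotropic forms for the lower bounds\<close>

lemma U_cancel:
  assumes "u \<in> U" "q \<in> R" "u * q \<in> P k"
  shows "q \<in> P k"
  using assms(3)
proof (induction k)
  case (Suc k)
  then have "q \<in> P k" using P_mono[of "u * q" "Suc k" k] by simp
  then obtain y where y: "y \<in> R" "q = \<pi> ^ k * y" unfolding P_def by blast
  have "\<pi> ^ k * (u * y) \<in> P (k + 1)" using Suc.prems y(2) by (simp add: ac_simps Suc_eq_plus1)
  then have "u * y \<in> P 1" by simp
  then have "y \<in> P 1" using y(1) U_mult[OF assms(1), of y] by (auto simp: U_def)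
  then show ?case using y P_shift[of k y 1] by (simp add: Suc_eq_plus1)
qed (use assms in simp)

lemma U_not_P: "x \<in> U \<Longrightarrow> \<pi> ^ k * x \<notin> P (k + 1)"
  using P_shift[of k x 1] by (simp add: U_def)

text \<open>Each summand is 1 or 1 + \<open>\<pi> ^ 2\<close> + \<open>\<pi> ^ 3\<close> modulo
  \<open>P 4\<close>, and \<open>D\<close> counts those of the second kind.\<close>

lemma sum_power_unit:
  assumes "finite A" "\<And>i. i \<in> A \<Longrightarrow> y i \<in> U" "odd m"
  shows "\<exists>D :: nat. (\<Sum>i\<in>A. y i ^ (2 * m)) - (of_nat (card A) + of_nat D * (\<pi> ^ 2 + \<pi> ^ 3)) \<in> P 4"
  using assms(1,2)
proof (induction A rule: finite_induct)
  case empty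
  show ?case by (intro exI[of _ 0]) simp
next
  case (insert x A)
  obtain D where D: "(\<Sum>i\<in>A. y i ^ (2 * m)) - (of_nat (card A) + of_nat D * (\<pi> ^ 2 + \<pi> ^ 3)) \<in> P 4"
    using insert by auto
  have "\<exists>E :: nat. y x ^ (2 * m) - (1 + of_nat E * (\<pi> ^ 2 + \<pi> ^ 3)) \<in> P 4"
    using power_unit_cases[OF _ assms(3), of "y x"] insert.prems[of x]
    by (auto intro: exI[of _ 0] exI[of _ 1] simp: add.assoc)
  then obtain E :: nat where E: "y x ^ (2 * m) - (1 + of_nat E * (\<pi> ^ 2 + \<pi> ^ 3)) \<in> P 4" ..
  from P_add[OF D E] show ?case
    using insert by (intro exI[of _ "D + E"]) (simp add: algebra_simps)
qed

text \<open>An odd number of units sums to a unit. For two units, 2 contributes to the digit at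
  \<open>\<pi> ^ 2\<close> only, since \<open>\<epsilon>\<close> is false. Everything else
  contributes equally to the digits at \<open>\<pi> ^ 2\<close> and \<open>\<pi> ^ 3\<close>: the
  nontrivial powers counted by D, and the upper level because of its factor 1 +
  \<open>\<pi>\<close>. So the two digits differ and cannot both vanish.\<close>

lemma two_level_nonzero:
  assumes "finite A" "\<And>i. i \<in> A \<Longrightarrow> y i \<in> U" "finite B" "\<And>i. i \<in> B \<Longrightarrow> y i \<in> U" "odd m"
    and "card A \<in> {1, 2, 3}" "\<not> \<epsilon>"
  shows "(\<Sum>i\<in>A. y i ^ (2 * m)) + \<pi> ^ 2 * (1 + \<pi>) * (\<Sum>i\<in>B. y i ^ (2 * m)) \<notin> P 4"
proof
  assume q: "(\<Sum>i\<in>A. y i ^ (2 * m)) + \<pi> ^ 2 * (1 + \<pi>) * (\<Sum>i\<in>B. y i ^ (2 * m)) \<in> P 4" (is "?q \<in> _")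
  obtain D where D: "(\<Sum>i\<in>A. y i ^ (2 * m)) - (of_nat (card A) + of_nat D * (\<pi> ^ 2 + \<pi> ^ 3)) \<in> P 4"
    using sum_power_unit[of A y m] assms by blast
  obtain E where E: "(\<Sum>i\<in>B. y i ^ (2 * m)) - (of_nat (card B) + of_nat E * (\<pi> ^ 2 + \<pi> ^ 3)) \<in> P 4"
    using sum_power_unit[of B y m] assms by blast
  obtain e where e: "e \<in> R" "2 = \<pi> ^ 2 + of_bool \<epsilon> * \<pi> ^ 3 + \<pi> ^ 4 * e" using two_eq by blast
  obtain f g where f: "f \<in> R" "(\<Sum>i\<in>A. y i ^ (2 * m)) = of_nat (card A) + of_nat D * (\<pi> ^ 2 + \<pi> ^ 3) + \<pi> ^ 4 * f"
    "g \<in> R" "(\<Sum>i\<in>B. y i ^ (2 * m)) = of_nat (card B) + of_nat E * (\<pi> ^ 2 + \<pi> ^ 3) + \<pi> ^ 4 * g"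
    using D E by (auto simp: P_def algebra_simps)
  define h where "h = f + of_nat E * (1 + \<pi>) ^ 2 + \<pi> ^ 2 * (1 + \<pi>) * g"
  have h: "h \<in> R" using f by (simp add: h_def)
  have q_eq: "?q = of_nat (card A) + \<pi> ^ 2 * of_nat (D + card B) + \<pi> ^ 3 * of_nat (D + card B) + \<pi> ^ 4 * h"
    unfolding f(2,4) h_def by (simp add: algebra_simps small_powers)
  consider "odd (card A)" | "card A = 2" using assms(6) by auto
  then show False
  proof cases
    case 1
    have "(\<Sum>i\<in>A. y i ^ (2 * m)) - of_bool (odd (card A)) \<in> P 1" by (rule sum_U) (use assms in auto)
    moreover have "\<pi> ^ 2 * (1 + \<pi>) * (\<Sum>i\<in>B. y i ^ (2 * m)) \<in> P 1"
      by (intro P_multR pi_P sum_mem) (use assms in auto)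
    ultimately have "?q - 1 \<in> P 1" using P_add 1 by (force simp: algebra_simps)
    moreover have "?q \<in> P 1" using q by (rule P_mono) simp
    ultimately show False using P_diff[of ?q 1 "?q - 1"] one_not_P by simp
  next
    case 2
    have "?q = \<pi> ^ 2 * of_nat (1 + D + card B) + \<pi> ^ 3 * of_nat (D + card B) + \<pi> ^ 4 * (h + e)"
      unfolding q_eq 2 using assms(7) by (simp, subst e(2)) (simp add: algebra_simps)
    then have d: "?q - digit23 (1 + D + card B) (D + card B) \<in> P 4"
      by (rule digit23_red[rotated]) (use h e in simp)
    show False
    proof (cases "odd (1 + D + card B)")
      case True
      then obtain z where "z \<in> U" "?q = \<pi> ^ 2 * z" using digit23_unit[OF d] by blast
      then show False using U_not_P[of z 2] P_mono[OF q, of 3] by simp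
    next
      case False
      then obtain z where "z \<in> U" "?q = \<pi> ^ 3 * z" using digit23_unit3[OF d] by auto
      then show False using U_not_P[of z 3] q by simp
    qed
  qed
qed

text \<open>The first unit coordinate j gives a term of order exactly j; earlier coordinates are
  divisible by \<open>\<pi>\<close> and contribute to \<open>P d\<close>, later ones have order
  above j.\<close>

lemma monomial_form_nonzero:
  assumes "\<And>i. i < d \<Longrightarrow> y i \<in> R" "i0 < d" "y i0 \<in> U"
  shows "(\<Sum>i<d. \<pi> ^ i * y i ^ d) \<notin> P d"
proof -
  obtain j where j: "j < d" "y j \<in> U" "\<forall>i<j. \<not> (i < d \<and> y i \<in> U)"
    using exists_least_iff[of "\<lambda>i. i < d \<and> y i \<in> U"] assms(2,3) by blast
  have rest: "(\<Sum>i\<in>{..<d} - {j}. \<pi> ^ i * y i ^ d) \<in> P (j + 1)"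
  proof (rule P_sum)
    fix i assume i: "i \<in> {..<d} - {j}"
    show "\<pi> ^ i * y i ^ d \<in> P (j + 1)"
    proof (cases "i < j")
      case True
      then have "y i \<in> R" "y i \<notin> U" using j(3) i assms(1) by auto
      then have "y i \<in> P 1" unfolding U_def by blast
      then obtain z where z: "z \<in> R" "y i = \<pi> ^ 1 * z" unfolding P_def by blast
      have "\<pi> ^ i * y i ^ d = \<pi> ^ d * (\<pi> ^ i * z ^ d)" unfolding z(2) by (simp add: power_mult_distrib)
      also have "\<dots> \<in> P (j + 1)" by (intro P_multR pi_P) (use j z in auto)
      finally show ?thesis .
    next
      case False
      then show ?thesis using i assms(1)[of i] by (intro P_multR pi_P) auto
    qed
  qed
  have eq: "(\<Sum>i<d. \<pi> ^ i * y i ^ d) = \<pi> ^ j * y j ^ d + (\<Sum>i\<in>{..<d} - {j}. \<pi> ^ i * y i ^ d)"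
    by (rule sum.remove) (use j in auto)
  show ?thesis
  proof
    assume "(\<Sum>i<d. \<pi> ^ i * y i ^ d) \<in> P d"
    then have "(\<Sum>i<d. \<pi> ^ i * y i ^ d) \<in> P (j + 1)" by (rule P_mono) (use j in simp)
    from P_diff[OF this rest] have "\<pi> ^ j * y j ^ d \<in> P (j + 1)" unfolding eq by simp
    moreover have "\<pi> ^ j * y j ^ d \<notin> P (j + 1)" by (rule U_not_P) (use j in simp)
    ultimately show False by blast
  qed
qed

lemma nonunit_power:
  assumes "y \<in> R" "y \<notin> U"
  shows "y ^ d \<in> P d"
proof -
  have "y \<in> P 1" using assms unfolding U_def by blast
  then obtain z where z: "z \<in> R" "y = \<pi> ^ 1 * z" unfolding P_def by blast
  have "y ^ d = \<pi> ^ d * z ^ d" unfolding z(2) by (simp add: power_mult_distrib)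
  then show ?thesis using z(1) by (simp add: P_I)
qed

lemma unit_power_P2:
  assumes "y \<in> U" "odd m"
  shows "y ^ (2 * m) - 1 \<in> P 2"
  using power_unit_cases[OF assms]
proof
  assume "y ^ (2 * m) - (1 + \<pi> ^ 2 + \<pi> ^ 3) \<in> P 4"
  then have "y ^ (2 * m) - (1 + \<pi> ^ 2 + \<pi> ^ 3) + (\<pi> ^ 2 + \<pi> ^ 3) \<in> P 2"
    by (intro P_add pi_P) (auto intro: P_mono)
  then show ?thesis by (simp add: algebra_simps)
qed (auto intro: P_mono)

text \<open>The numbers of variables at the levels \<open>0, 2, \<dots>, 2 m - 2\<close> are \<open>4, 3, \<dots>, 3, 1\<close>, and all odd levels are empty.
  The type alternates, except for the extra variable with index \<open>3 m - 2\<close> at level \<open>0\<close>.\<close>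

definition triple_coeff :: "nat \<Rightarrow> nat \<Rightarrow> 'a" where
  "triple_coeff m i = (if i = 3 * m - 2 then 1 + \<pi> else (\<pi> ^ 2 * (1 + \<pi>)) ^ (i div 3))"

lemma triple_coeff_mem [simp]: "triple_coeff m i \<in> R"
  by (simp add: triple_coeff_def)

lemma triple_form_nonzero:
  assumes m: "odd m" "m \<ge> 3" and eps: "\<not> \<epsilon>"
    and y: "\<And>i. i < 3 * m - 1 \<Longrightarrow> y i \<in> R" and i0: "i0 < 3 * m - 1" "y i0 \<in> U"
  shows "(\<Sum>i<3 * m - 1. triple_coeff m i * y i ^ (2 * m)) \<notin> P (2 * m + 2)"
proof
  define \<beta> where "\<beta> = \<pi> ^ 2 * (1 + \<pi>)"
  define f where "f i = triple_coeff m i * y i ^ (2 * m)" for i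
  define N where "N = {..<3 * m - 1}"
  define lvl where "lvl i = (if i = 3 * m - 2 then 0 else i div 3)" for i
  have \<beta>_pow: "\<beta> ^ j = \<pi> ^ (2 * j) * (1 + \<pi>) ^ j" for j
    by (simp add: \<beta>_def power_mult_distrib power_mult)
  have \<beta>P: "\<beta> ^ j \<in> P (2 * j)" for j unfolding \<beta>_pow by (rule P_I) simp
  have fR: "f i \<in> R" if "i \<in> N" for i using y that by (simp add: f_def N_def)
  assume "(\<Sum>i<3 * m - 1. triple_coeff m i * y i ^ (2 * m)) \<in> P (2 * m + 2)"
  then have zero: "sum f N \<in> P (2 * m + 2)" by (simp add: f_def N_def)
  have nonunit: "f i \<in> P (2 * m)" if "i \<in> N" "y i \<notin> U" for i
    unfolding f_def using nonunit_power[of "y i" "2 * m"] that y by (intro P_multR) (auto simp: N_def)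
  have split: "(\<Sum>i\<in>A. f i) \<in> P k" if "A \<subseteq> N" "\<And>i. i \<in> N - A \<Longrightarrow> f i \<in> P k" "k \<le> 2 * m + 2" for A k
  proof -
    have "sum f N = sum f (N - A) + sum f A" by (rule sum.subset_diff) (use that in \<open>auto simp: N_def\<close>)
    moreover have "sum f (N - A) \<in> P k" using that by (intro P_sum) auto
    moreover have "sum f N \<in> P k" using P_mono[OF zero that(3)] .
    ultimately show ?thesis using P_diff[of "sum f N" k "sum f (N - A)"] by simp
  qed
  define j where "j = (LEAST j. \<exists>i\<in>N. y i \<in> U \<and> lvl i = j)"
  have "\<exists>i\<in>N. y i \<in> U \<and> lvl i = j"
    unfolding j_def by (rule LeastI_ex) (use i0 in \<open>auto simp: N_def\<close>)
  then obtain i1 where i1: "i1 \<in> N" "y i1 \<in> U" "lvl i1 = j" by blast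
  have least: "y i \<notin> U" if "i \<in> N" "lvl i < j" for i
    using that not_less_Least[of "lvl i" "\<lambda>j. \<exists>i\<in>N. y i \<in> U \<and> lvl i = j"] unfolding j_def by blast
  have j_le: "j \<le> m - 1" using i1 by (auto simp: lvl_def N_def split: if_splits)
  have f_lvl: "f i \<in> P (2 * lvl i)" if "i \<in> N" for i
  proof -
    have "triple_coeff m i \<in> P (2 * lvl i)"
      using \<beta>P[of "i div 3"] by (simp add: triple_coeff_def lvl_def \<beta>_def)
    then show ?thesis unfolding f_def using y that by (intro P_multR) (auto simp: N_def)
  qed
  have x_N: "3 * m - 2 \<in> N" using m by (simp add: N_def)
  have j_less: "j < m - 1" if "j \<noteq> m - 1" using that j_le by simp
  consider "j = m - 1" | "j = 0" "3 * m - 2 \<in> N" "y (3 * m - 2) \<in> U" | "j < m - 1" "j = 0 \<longrightarrow> y (3 * m - 2) \<notin> U"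
    using j_less x_N by blast
  then show False
  proof cases
    \<comment> \<open>Only the top level carries a unit, and it consists of the single variable 3 m
      - 3.\<close>
    case 1
    then have "i1 = 3 * m - 3" using i1 m by (auto simp: lvl_def N_def split: if_splits)
    then have "i1 \<noteq> 3 * m - 2" "i1 div 3 = m - 1" using m by presburger+
    then have "f i1 = \<beta> ^ (m - 1) * y i1 ^ (2 * m)" by (simp add: f_def triple_coeff_def \<beta>_def)
    then have f1: "f i1 = \<pi> ^ (2 * (m - 1)) * ((1 + \<pi>) ^ (m - 1) * y i1 ^ (2 * m))"
      unfolding \<beta>_pow by (simp only: mult.assoc)
    have "sum f {i1} \<in> P (2 * (m - 1) + 1)"
    proof (rule split)
      show "{i1} \<subseteq> N" using i1 by simp
      fix i assume i: "i \<in> N - {i1}"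
      then have "lvl i < j" using \<open>i1 = _\<close> 1 m by (auto simp: lvl_def N_def)
      then show "f i \<in> P (2 * (m - 1) + 1)" using nonunit[of i] least[of i] i m by (auto intro: P_mono)
    qed (use m in simp)
    then show False using U_not_P[of "(1 + \<pi>) ^ (m - 1) * y i1 ^ (2 * m)" "2 * (m - 1)"] i1 f1 by simp
  next
    \<comment> \<open>The extra variable has a type different from the others at level 0. Modulo
      \<open>P 2\<close> the sum is an integer plus \<open>\<pi>\<close>, hence of order 0 or
      1.\<close>
    case 2
    define A where "A = {i \<in> N. i < 3 \<and> y i \<in> U}"
    define x where "x = 3 * m - 2"
    have A: "finite A" "x \<notin> A" using m by (auto simp: A_def N_def x_def)
    have "sum f (insert x A) \<in> P 2"
    proof (rule split)
      show "insert x A \<subseteq> N" using 2 by (auto simp: A_def x_def)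
      fix i assume i: "i \<in> N - insert x A"
      show "f i \<in> P 2"
      proof (cases "y i \<in> U")
        case False
        then show ?thesis using nonunit[of i] i m by (auto intro: P_mono)
      next
        case True
        then have "\<not> i < 3" "i \<noteq> x" using i by (auto simp: A_def)
        moreover from this have "1 \<le> i div 3" by presburger
        ultimately have "lvl i \<ge> 1" by (simp add: lvl_def x_def)
        then show ?thesis using f_lvl[of i] i by (auto intro: P_mono)
      qed
    qed (use m in simp)
    then have 3: "f x + sum f A \<in> P 2" using A by simp
    have fA: "sum f A - of_nat (card A) \<in> P 2"
    proof -
      have "sum f A - of_nat (card A) = (\<Sum>i\<in>A. f i - 1)" by (simp add: sum_subtractf)
      also have "\<dots> \<in> P 2"
      proof (rule P_sum)
        fix i assume i: "i \<in> A"
        then have "f i = y i ^ (2 * m)" using m by (auto simp: f_def triple_coeff_def A_def)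
        then show "f i - 1 \<in> P 2" using unit_power_P2 i m by (auto simp: A_def)
      qed
      finally show ?thesis .
    qed
    have fx: "f x - (1 + \<pi>) \<in> P 2"
    proof -
      have "f x - (1 + \<pi>) = (1 + \<pi>) * (y x ^ (2 * m) - 1)" by (simp add: f_def triple_coeff_def x_def algebra_simps)
      then show ?thesis using unit_power_P2[of "y x" m] 2 m by (simp add: P_multR x_def)
    qed
    obtain q where q: "q \<in> R" "of_nat (card A + 1) = of_bool (odd (card A + 1)) + \<pi> ^ 2 * q" using parity_red .
    have "of_nat (card A + 1) - of_bool (odd (card A + 1)) \<in> P 2" using P_I[OF q(1), of 2] q(2) by simp
    with P_add[OF fA fx] have "(sum f A - of_nat (card A)) + (f x - (1 + \<pi>)) + (of_nat (card A + 1) - of_bool (odd (card A + 1))) \<in> P 2"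
      by (rule P_add)
    from P_diff[OF 3 this] have 4: "of_bool (odd (card A + 1)) + \<pi> \<in> P 2" by (simp add: algebra_simps)
    show False
    proof (cases "odd (card A + 1)")
      case True
      then show False using P_mono[OF 4, of 1] pi_plus_1 by (simp add: U_def)
    next
      case False
      then show False using 4 U_not_P[OF one_U, of 1] by simp
    qed
  next
    \<comment> \<open>Here at most three variables of the lowest level j are units, and the next
      nonempty level has the opposite type, so \<open>two_level_nonzero\<close> applies after
      removing the factor \<open>\<beta> ^ j\<close>.\<close>
    case 3
    define A where "A = {i \<in> N. i \<noteq> 3 * m - 2 \<and> i div 3 = j \<and> y i \<in> U}"
    define B where "B = {i \<in> N. i \<noteq> 3 * m - 2 \<and> i div 3 = j + 1 \<and> y i \<in> U}"
    have fin: "finite A" "finite B" "A \<inter> B = {}" by (auto simp: A_def B_def N_def)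
    have "sum f (A \<union> B) \<in> P (2 * j + 4)"
    proof (rule split)
      show "A \<union> B \<subseteq> N" by (auto simp: A_def B_def)
      fix i assume i: "i \<in> N - (A \<union> B)"
      show "f i \<in> P (2 * j + 4)"
      proof (cases "y i \<in> U")
        case False
        then show ?thesis using nonunit[of i] i 3 by (auto intro: P_mono)
      next
        case True
        then have "lvl i \<noteq> j" "lvl i \<noteq> j + 1" "\<not> lvl i < j"
          using i 3 least[of i] by (auto simp: A_def B_def lvl_def)
        then have "2 * j + 4 \<le> 2 * lvl i" by linarith
        then show ?thesis using f_lvl[of i] i by (auto intro: P_mono)
      qed
    qed (use 3 in linarith)
    moreover have "sum f A = \<beta> ^ j * (\<Sum>i\<in>A. y i ^ (2 * m))"
      unfolding sum_distrib_left by (rule sum.cong) (auto simp: A_def f_def triple_coeff_def \<beta>_def)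
    moreover have "sum f B = \<beta> ^ j * (\<beta> * (\<Sum>i\<in>B. y i ^ (2 * m)))"
      unfolding sum_distrib_left by (rule sum.cong) (auto simp: B_def f_def triple_coeff_def power_add \<beta>_def)
    ultimately have "\<beta> ^ j * ((\<Sum>i\<in>A. y i ^ (2 * m)) + \<beta> * (\<Sum>i\<in>B. y i ^ (2 * m))) \<in> P (2 * j + 4)" (is "_ * ?q \<in> _")
      using fin by (simp add: sum.union_disjoint algebra_simps)
    then have "\<pi> ^ (2 * j) * ((1 + \<pi>) ^ j * ?q) \<in> P (2 * j + 4)" unfolding \<beta>_pow by (simp only: mult.assoc)
    then have 4: "(1 + \<pi>) ^ j * ?q \<in> P 4" by (simp only: P_shift)
    have "?q \<in> R" using y by (auto simp: A_def B_def N_def \<beta>_def intro!: add_mem mult_mem sum_mem)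
    from U_cancel[OF _ this 4] have q4: "?q \<in> P 4" by simp
    have "i1 \<in> A" using i1 3 by (auto simp: A_def lvl_def split: if_splits)
    have "A \<subseteq> {3 * j ..< 3 * j + 3}" by (auto simp: A_def)
    from card_mono[OF _ this] have "card A \<le> 3" by simp
    moreover have "card A \<noteq> 0" using \<open>i1 \<in> A\<close> fin by auto
    ultimately have "card A = 1 \<or> card A = 2 \<or> card A = 3" by linarith
    then have c: "card A \<in> {1, 2, 3}" by simp
    have yA: "y i \<in> U" if "i \<in> A" for i using that by (simp add: A_def)
    have yB: "y i \<in> U" if "i \<in> B" for i using that by (simp add: B_def)
    show False
      using two_level_nonzero[of A y B m, OF fin(1) yA fin(2) yB m(1) c eps] q4 unfolding \<beta>_def by blast
  qed
qed

section \<open>Hensel lifting\<close>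

lemma hensel_step:
  assumes "y \<in> U" "odd m" "j \<ge> 3"
  shows "\<exists>z\<in>U. (y + \<pi> ^ j) ^ (2 * m) - y ^ (2 * m) = \<pi> ^ (j + 2) * z"
proof -
  obtain e where e: "e \<in> R" "2 = \<pi> ^ 2 + of_bool \<epsilon> * \<pi> ^ 3 + \<pi> ^ 4 * e" using two_eq by blast
  define h where "h = 1 + \<pi> * (of_bool \<epsilon> + \<pi> * e)"
  have h: "h \<in> U" unfolding h_def by (rule U_add_P[OF one_U]) (use P_I[of "of_bool \<epsilon> + \<pi> * e" 1] e in simp)
  have h2: "2 = \<pi> ^ 2 * h"
    by (subst e(2)) (simp add: h_def algebra_simps small_powers)
  define Y Z where "Y = y ^ 2" and "Z = (y + \<pi> ^ j) ^ 2"
  have yj: "y + \<pi> ^ j \<in> U" by (rule U_add_P) (use assms pi_P[of 1 j] in auto)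
  obtain k where k: "j = k + 2" "k \<ge> 1" using assms(3) by (intro that[of "j - 2"]) auto
  \<comment> \<open>The term with the factor 2 has order j + 2 and dominates, because 2 j > j + 2
    for j >= 3.\<close>
  have "Z - Y = 2 * (y * \<pi> ^ j) + \<pi> ^ j * \<pi> ^ j" by (simp add: Y_def Z_def power2_eq_square algebra_simps)
  also have "\<dots> = \<pi> ^ (j + 2) * (h * y + \<pi> ^ k)"
    by (subst h2) (simp add: k power_add power2_eq_square algebra_simps)
  finally have ZY: "Z - Y = \<pi> ^ (j + 2) * (h * y + \<pi> ^ k)" .
  obtain l where l: "m = Suc l" using assms(2) by (metis even_zero not0_implies_Suc)
  \<comment> \<open>The quotient of Z^m - Y^m by Z - Y is a sum of m units, a unit as m is
    odd.\<close>
  have "(\<Sum>p<m. Z ^ p * Y ^ (l - p)) - of_bool (odd (card {..<m})) \<in> P 1"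
    by (rule sum_U) (use assms yj in \<open>auto simp: Y_def Z_def\<close>)
  then have s: "(\<Sum>p<m. Z ^ p * Y ^ (l - p)) \<in> U"
    using U_cong[OF one_U] assms(2) by simp
  have "(y + \<pi> ^ j) ^ (2 * m) - y ^ (2 * m) = Z ^ Suc l - Y ^ Suc l"
    unfolding Y_def Z_def l[symmetric] by (simp only: power_mult)
  also have "\<dots> = (Z - Y) * (\<Sum>p<m. Z ^ p * Y ^ (l - p))" unfolding diff_power_eq_sum l ..
  also have "\<dots> = \<pi> ^ (j + 2) * ((h * y + \<pi> ^ k) * (\<Sum>p<m. Z ^ p * Y ^ (l - p)))" unfolding ZY by (simp only: mult.assoc)
  finally have eq: "(y + \<pi> ^ j) ^ (2 * m) - y ^ (2 * m) =
    \<pi> ^ (j + 2) * ((h * y + \<pi> ^ k) * (\<Sum>p<m. Z ^ p * Y ^ (l - p)))" .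
  have "h * y + \<pi> ^ k \<in> U" by (rule U_add_P[OF U_mult[OF h assms(1)] pi_P[OF k(2)]])
  then have "(h * y + \<pi> ^ k) * (\<Sum>p<m. Z ^ p * Y ^ (l - p)) \<in> U" using s by (rule U_mult)
  then show ?thesis using eq by blast
qed

text \<open>The coefficients are Cauchy sequences, so each approximation is a zero only for large i.
  The root is not an element of the field but the sequence y, which converges by its second
  property.\<close>

lemma hensel:
  fixes G W :: "nat \<Rightarrow> 'a"
  assumes m: "odd m" and G: "\<And>k. \<exists>N. \<forall>i\<ge>N. \<forall>j\<ge>N. G i - G j \<in> P k"
    and W: "\<And>k. \<exists>N. \<forall>i\<ge>N. \<forall>j\<ge>N. W i - W j \<in> P k" "\<And>i. i \<ge> N0 \<Longrightarrow> W i \<in> U"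
    and w: "w \<in> U" and zero: "\<And>i. i \<ge> N0 \<Longrightarrow> G i + W i * \<pi> ^ t * w ^ (2 * m) \<in> P (t + 5)"
  obtains y where "\<And>k. y k \<in> U" "\<And>k. y (Suc k) - y k \<in> P (k + 3)"
    "\<And>k. \<exists>N. \<forall>i\<ge>N. G i + W i * \<pi> ^ t * y k ^ (2 * m) \<in> P (t + 5 + k)"
proof -
  define Q where "Q k y \<longleftrightarrow> y \<in> U \<and> (\<exists>N. \<forall>i\<ge>N. G i + W i * \<pi> ^ t * y ^ (2 * m) \<in> P (t + 5 + k))" for k y
  have step: "\<exists>y'. Q (Suc k) y' \<and> y' - y \<in> P (k + 3)" if Qy: "Q k y" for k y
  proof -
    define F where "F x i = G i + W i * \<pi> ^ t * x ^ (2 * m)" for x i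
    have y: "y \<in> U" and "\<exists>N. \<forall>i\<ge>N. F y i \<in> P (t + 5 + k)" using Qy by (simp_all only: Q_def F_def)
    from this(2) obtain N1 where N1: "\<forall>i\<ge>N1. F y i \<in> P (t + 5 + k)" ..
    obtain N2 where N2: "\<forall>i\<ge>N2. \<forall>j\<ge>N2. G i - G j \<in> P (t + 5 + k + 1)" using G[of "t + 5 + k + 1"] ..
    obtain N3 where N3: "\<forall>i\<ge>N3. \<forall>j\<ge>N3. W i - W j \<in> P (t + 5 + k + 1)" using W(1)[of "t + 5 + k + 1"] ..
    define N where "N = Max {N0, N1, N2, N3}"
    have N: "N \<ge> N0" "N \<ge> N1" "N \<ge> N2" "N \<ge> N3" by (simp_all add: N_def)
    have close: "F x i - F x N \<in> P (t + 5 + k + 1)" if "x \<in> U" "i \<ge> N" for x i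
    proof -
      have "(G i - G N) + (W i - W N) * (\<pi> ^ t * x ^ (2 * m)) \<in> P (t + 5 + k + 1)"
        using N N2 N3 that by (intro P_add P_multR) auto
      then show ?thesis by (simp add: F_def algebra_simps)
    qed
    \<comment> \<open>One index N beyond which G and W are constant to the required precision
      decides. If the value there has order exactly t + 5 + k, adding \<open>\<pi> ^ (k + 3)\<close>
      to y adds a term of the same order, and two units cancel modulo \<open>\<pi>\<close>.\<close>
    have "\<exists>y'. y' \<in> U \<and> F y' N \<in> P (t + 5 + k + 1) \<and> y' - y \<in> P (k + 3)"
    proof (cases "F y N \<in> P (t + 5 + k + 1)")
      case True
      then show ?thesis using y by (intro exI[of _ y]) simp
    next
      case False
      have "F y N \<in> P (t + 5 + k)" using N1 N by blast
      then obtain q where q: "q \<in> R" "F y N = \<pi> ^ (t + 5 + k) * q" unfolding P_def by blast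
      then have qU: "q \<in> U" using False P_shift[of "t + 5 + k" q 1] by (simp add: U_def)
      obtain z where z: "z \<in> U" "(y + \<pi> ^ (k + 3)) ^ (2 * m) - y ^ (2 * m) = \<pi> ^ (k + 3 + 2) * z"
        using hensel_step[OF y m, of "k + 3"] by auto
      have "F (y + \<pi> ^ (k + 3)) N = F y N + W N * \<pi> ^ t * ((y + \<pi> ^ (k + 3)) ^ (2 * m) - y ^ (2 * m))"
        by (simp add: F_def algebra_simps)
      also have "\<dots> = \<pi> ^ (t + 5 + k) * (q + W N * z)"
        unfolding z(2) q(2) by (simp add: algebra_simps power_add)
      also have "\<dots> \<in> P (t + 5 + k + 1)"
      proof -
        have u: "W N * z \<in> U" using W(2) N z by simp
        have "q - W N * z + 2 * (W N * z) \<in> P 1"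
          using U_add_U[OF qU u] P_mono[OF two_P, of 1] u by (intro P_add P_multR) auto
        then have "q + W N * z \<in> P 1" by (simp add: algebra_simps)
        then show ?thesis by (simp only: P_shift)
      qed
      finally show ?thesis using U_add_P[OF y, of "\<pi> ^ (k + 3)"] pi_P[of 1 "k + 3"] pi_P[of "k + 3" "k + 3"]
        by (intro exI[of _ "y + \<pi> ^ (k + 3)"]) simp
    qed
    then obtain y' where y': "y' \<in> U" "F y' N \<in> P (t + 5 + k + 1)" "y' - y \<in> P (k + 3)" by blast
    have "F y' i \<in> P (t + 5 + Suc k)" if "i \<ge> N" for i
      using P_add[OF close[OF y'(1) that] y'(2)] by (simp add: Suc_eq_plus1 add.assoc)
    then show ?thesis using y' unfolding Q_def F_def by blast
  qed
  have "Q 0 w" unfolding Q_def using w zero by auto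
  then obtain y where "\<And>k. Q k (y k)" "\<And>k. y (Suc k) - y k \<in> P (k + 3)"
    using dependent_nat_choice[of Q "\<lambda>k y y'. y' - y \<in> P (k + 3)"] step by metis
  then show ?thesis using that[of y] unfolding Q_def by blast
qed

lemma P_powi:
  assumes "z \<in> R" "e \<ge> int k"
  shows "\<pi> powi e * z \<in> P k"
proof -
  obtain l where l: "e = int k + int l" using assms(2) by (metis zle_iff_zadd)
  have eq: "\<pi> powi e * z = \<pi> ^ k * (\<pi> ^ l * z)" unfolding l by (simp add: power_int_add)
  show ?thesis unfolding eq by (rule P_I) (use assms(1) in simp)
qed

lemma powi_power: "(\<pi> powi e) ^ k = \<pi> powi (e * int k)"
  by (simp add: power_int_mult)

lemma powi_mult_power: "\<pi> powi e * (\<pi> ^ k * z) = \<pi> powi (e + int k) * z"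
  by (simp add: power_int_add mult.assoc)

lemma telescope_P:
  assumes "\<And>k. y (Suc k) - y k \<in> P (k + c)" "i \<le> j"
  shows "y j - y i \<in> P (i + c)"
  using assms(2)
proof (induction j rule: dec_induct)
  case (step n)
  have "y (Suc n) - y n \<in> P (i + c)" using assms(1)[of n] by (rule P_mono) (use step in simp)
  from P_add[OF this step.IH] show ?case by simp
qed simp

end

section \<open>2-adic integers in the rational numbers\<close>

text \<open>The rationals divisible by 2^k in the localization of the integers at 2; membership
  replaces estimates for \<open>abs2\<close>.\<close>

definition Z2 :: "nat \<Rightarrow> rat set" where
  "Z2 k = {q. \<exists>a b :: int. odd b \<and> q = 2 ^ k * of_int a / of_int b}"

lemma Z2_I: "odd (b :: int) \<Longrightarrow> 2 ^ k * of_int a / of_int b \<in> Z2 k"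
  by (auto simp: Z2_def)

lemma Z2_E:
  assumes "q \<in> Z2 k"
  obtains a b :: int where "odd b" "b \<noteq> 0" "q = 2 ^ k * of_int a / of_int b"
  using assms by (auto simp: Z2_def)

lemma Z2_add: "x \<in> Z2 k \<Longrightarrow> y \<in> Z2 k \<Longrightarrow> x + y \<in> Z2 k"
proof -
  assume "x \<in> Z2 k" "y \<in> Z2 k"
  then obtain a b a' b' :: int where h: "odd b" "b \<noteq> 0" "x = 2 ^ k * of_int a / of_int b"
    "odd b'" "b' \<noteq> 0" "y = 2 ^ k * of_int a' / of_int b'" by (auto elim!: Z2_E)
  have "x + y = 2 ^ k * of_int (a * b' + a' * b) / of_int (b * b')" using h by (simp add: field_simps)
  then show ?thesis using Z2_I[of "b * b'" k "a * b' + a' * b"] h by simp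
qed

lemma Z2_mult: "x \<in> Z2 k \<Longrightarrow> y \<in> Z2 l \<Longrightarrow> x * y \<in> Z2 (k + l)"
proof -
  assume "x \<in> Z2 k" "y \<in> Z2 l"
  then obtain a b a' b' :: int where h: "odd b" "b \<noteq> 0" "x = 2 ^ k * of_int a / of_int b"
    "odd b'" "b' \<noteq> 0" "y = 2 ^ l * of_int a' / of_int b'" by (auto elim!: Z2_E)
  have eq: "x * y = 2 ^ (k + l) * of_int (a * a') / of_int (b * b')" unfolding h(3,6) by (simp add: power_add)
  show ?thesis unfolding eq by (rule Z2_I) (use h in simp)
qed

lemma Z2_of_int: "2 ^ k dvd a \<Longrightarrow> of_int a \<in> Z2 k"
  using Z2_I[of 1 k] by (auto elim!: dvdE)

lemma Z2_uminus: "x \<in> Z2 k \<Longrightarrow> - x \<in> Z2 k"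
  using Z2_mult[OF Z2_of_int[of 0 "-1"], of x k] by simp

lemma Z2_diff: "x \<in> Z2 k \<Longrightarrow> y \<in> Z2 k \<Longrightarrow> x - y \<in> Z2 k"
  using Z2_add[OF _ Z2_uminus, of x k y] by simp

lemma Z2_mult0: "x \<in> Z2 k \<Longrightarrow> y \<in> Z2 0 \<Longrightarrow> x * y \<in> Z2 k"
  using Z2_mult[of x k y 0] by simp

lemma Z2_shift: "2 ^ k * x \<in> Z2 (k + l) \<longleftrightarrow> x \<in> Z2 l"
proof
  assume "2 ^ k * x \<in> Z2 (k + l)"
  then obtain a b :: int where h: "odd b" "2 ^ k * x = 2 ^ (k + l) * of_int a / of_int b" by (elim Z2_E)
  then have "2 ^ k * x = 2 ^ k * (2 ^ l * of_int a / of_int b)" by (simp add: power_add)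
  then have "x = 2 ^ l * of_int a / of_int b" by (subst (asm) mult_left_cancel) auto
  then show "x \<in> Z2 l" using Z2_I[OF h(1)] by simp
next
  assume "x \<in> Z2 l"
  from Z2_mult[OF Z2_of_int[of k "2 ^ k"] this] show "2 ^ k * x \<in> Z2 (k + l)" by simp
qed

lemma Z2_zero: "0 \<in> Z2 k"
  using Z2_of_int[of k 0] by simp

lemma Z2_residue: "x \<in> Z2 0 \<Longrightarrow> x \<in> Z2 1 \<or> x - 1 \<in> Z2 1"
proof -
  assume "x \<in> Z2 0"
  then obtain a b :: int where h: "odd b" "b \<noteq> 0" "x = of_int a / of_int b" by (auto elim!: Z2_E)
  show ?thesis
  proof (cases "even a")
    case True
    then show ?thesis using Z2_I[OF h(1), of 1 "a div 2"] h by auto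
  next
    case False
    then have "even (a - b)" using h by simp
    then obtain c where c: "a - b = 2 * c" by (elim evenE)
    then have "a = b + 2 * c" by simp
    then have eq: "x - 1 = 2 ^ 1 * of_int c / of_int b" using h by (simp add: field_simps)
    show ?thesis unfolding eq by (rule disjI2, rule Z2_I[OF h(1)])
  qed
qed

lemma Z2_half:
  assumes "odd b" "u \<in> Z2 1"
  shows "u / (2 * of_int b) \<in> Z2 0"
proof -
  obtain k l :: int where kl: "odd l" "u = 2 ^ 1 * of_int k / of_int l" using assms(2) by (elim Z2_E)
  have "u / (2 * of_int b) = 2 ^ 0 * of_int k / of_int (l * b)" using kl by (simp add: field_simps)
  then show ?thesis using Z2_I[of "l * b" 0 k] kl(1) assms(1) by (metis even_mult_iff)
qed

lemma half_notin_Z2: "odd b \<Longrightarrow> 1 / (2 * of_int b) \<notin> Z2 0"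
proof
  assume "odd b" "1 / (2 * of_int b) \<in> Z2 0"
  then obtain a c :: int where h: "odd c" "c \<noteq> 0" "1 / (2 * rat_of_int b) = of_int a / of_int c" by (auto elim!: Z2_E)
  moreover have "b \<noteq> 0" using \<open>odd b\<close> by auto
  ultimately have "rat_of_int c = of_int (2 * b * a)" by (simp add: field_simps)
  then have "c = 2 * b * a" by (simp only: of_int_eq_iff)
  then show False using h by simp
qed

section \<open>Translation of the 2-adic absolute value into divisibility\<close>

lemma abs2_le: "q \<in> Z2 k \<Longrightarrow> abs2 q \<le> 2 powr (- real k)"
proof (cases "q = 0")
  case False
  assume "q \<in> Z2 k"
  then obtain a b :: int where h: "odd b" "b \<noteq> 0" "q = 2 ^ k * of_int a / of_int b" by (elim Z2_E)
  obtain n d where nd: "quotient_of q = (n, d)" by fastforce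
  have q: "q = of_int n / of_int d" "d > 0" using quotient_of_div[OF nd] quotient_of_denom_pos[OF nd] by auto
  have nz: "n \<noteq> 0" "a \<noteq> 0" using False q h by auto
  have "rat_of_int (2 ^ k * a * d) = of_int (n * b)" using q h by (simp add: field_simps)
  then have "2 ^ k * a * d = n * b" by (simp only: of_int_eq_iff)
  then have "multiplicity 2 (2 ^ k * a * d) = multiplicity 2 (n * b)" by simp
  moreover have "multiplicity 2 (2 ^ k * a * d) = k + multiplicity 2 a + multiplicity 2 d"
    using nz q by (subst prime_elem_multiplicity_mult_distrib prime_elem_multiplicity_mult_distrib, auto)+
  moreover have "multiplicity 2 (n * b) = multiplicity 2 n"
    using nz h by (subst prime_elem_multiplicity_mult_distrib) (auto simp: not_dvd_imp_multiplicity_0)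
  ultimately have "k + multiplicity 2 a + multiplicity 2 d = multiplicity 2 n" by simp
  then have "real (multiplicity 2 d) - real (multiplicity 2 n) \<le> - real k" by linarith
  then show ?thesis using False by (simp add: abs2_def nd)
qed (simp add: abs2_def)

text \<open>Nonzero values are powers of 2, so a value strictly below 2^(1 - k) is at most 2^(-
  k).\<close>

lemma Z2_if_abs2_less: "abs2 q < 2 powr (1 - real k) \<Longrightarrow> q \<in> Z2 k"
proof (cases "q = 0")
  case False
  assume a: "abs2 q < 2 powr (1 - real k)"
  obtain n d where nd: "quotient_of q = (n, d)" by fastforce
  have q: "q = of_int n / of_int d" "d > 0" using quotient_of_div[OF nd] quotient_of_denom_pos[OF nd] by auto
  have nz: "n \<noteq> 0" using False q by auto
  have "2 powr (real (multiplicity 2 d) - real (multiplicity 2 n)) < 2 powr (1 - real k)"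
    using a False by (simp add: abs2_def nd)
  then have le: "k + multiplicity 2 d \<le> multiplicity 2 n" by simp
  obtain n' where n': "n = 2 ^ multiplicity 2 n * n'" using multiplicity_dvd[of 2 n] by (auto elim: dvdE)
  obtain d' where d': "d = 2 ^ multiplicity 2 d * d'" "\<not> 2 dvd d'"
    using multiplicity_decompose'[of d 2] q(2) by auto
  define e where "e = multiplicity 2 n - multiplicity 2 d - k"
  have e: "multiplicity 2 n = k + multiplicity 2 d + e" using le by (simp add: e_def)
  have "q = 2 ^ k * of_int (2 ^ e * n') / of_int d'"
    unfolding q(1) by (subst n', subst d'(1)) (simp add: e power_add)
  then show ?thesis using Z2_I[of d' k "2 ^ e * n'"] d'(2) by simp
qed (simp add: Z2_zero)

lemma ex_powr_less: "(e :: real) > 0 \<Longrightarrow> \<exists>k. 2 powr (- real k) < e"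
proof -
  assume "e > 0"
  then obtain k where "(1 / 2) ^ k < e" using real_arch_pow_inv[of e "1 / 2"] by auto
  then show ?thesis by (intro exI[of _ k]) (simp add: powr_minus powr_realpow power_one_over inverse_eq_divide)
qed

lemma cauchy2_iff: "cauchy2 X \<longleftrightarrow> (\<forall>k. \<exists>N. \<forall>m\<ge>N. \<forall>n\<ge>N. X m - X n \<in> Z2 k)"
proof
  assume X: "cauchy2 X"
  show "\<forall>k. \<exists>N. \<forall>m\<ge>N. \<forall>n\<ge>N. X m - X n \<in> Z2 k"
  proof
    fix k
    have "(0 :: real) < 2 powr (1 - real k)" by simp
    then show "\<exists>N. \<forall>m\<ge>N. \<forall>n\<ge>N. X m - X n \<in> Z2 k"
      using X Z2_if_abs2_less unfolding cauchy2_def by meson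
  qed
next
  assume X: "\<forall>k. \<exists>N. \<forall>m\<ge>N. \<forall>n\<ge>N. X m - X n \<in> Z2 k"
  show "cauchy2 X" unfolding cauchy2_def
  proof (intro allI impI)
    fix e :: real assume "e > 0"
    then obtain k where k: "2 powr (- real k) < e" using ex_powr_less by blast
    obtain N where "\<forall>m\<ge>N. \<forall>n\<ge>N. X m - X n \<in> Z2 k" using X by blast
    then show "\<exists>N. \<forall>m\<ge>N. \<forall>n\<ge>N. abs2 (X m - X n) < e"
      using abs2_le k by (meson order_le_less_trans)
  qed
qed

lemma null2_iff: "null2 X \<longleftrightarrow> (\<forall>k. \<exists>N. \<forall>n\<ge>N. X n \<in> Z2 k)"
proof
  assume X: "null2 X"
  show "\<forall>k. \<exists>N. \<forall>n\<ge>N. X n \<in> Z2 k"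
  proof
    fix k
    have "(0 :: real) < 2 powr (1 - real k)" by simp
    then show "\<exists>N. \<forall>n\<ge>N. X n \<in> Z2 k"
      using X Z2_if_abs2_less unfolding null2_def by meson
  qed
next
  assume X: "\<forall>k. \<exists>N. \<forall>n\<ge>N. X n \<in> Z2 k"
  show "null2 X" unfolding null2_def
  proof (intro allI impI)
    fix e :: real assume "e > 0"
    then obtain k where k: "2 powr (- real k) < e" using ex_powr_less by blast
    obtain N where "\<forall>n\<ge>N. X n \<in> Z2 k" using X by blast
    then show "\<exists>N. \<forall>n\<ge>N. abs2 (X n) < e"
      using abs2_le k by (meson order_le_less_trans)
  qed
qed

lemma Z2_all_zero:
  assumes "\<And>k. q \<in> Z2 k"
  shows "q = 0"
proof (rule ccontr)
  assume "q \<noteq> 0"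
  then have "abs2 q > 0" by (simp add: abs2_def split_beta)
  then obtain k where "2 powr (- real k) < abs2 q" using ex_powr_less by blast
  then show False using abs2_le[OF assms, of k] by simp
qed

lemma Z2_clear_denominator: "\<exists>k. 2 ^ k * q \<in> Z2 0"
proof -
  obtain n d where nd: "quotient_of q = (n, d)" by fastforce
  have q: "q = of_int n / of_int d" "d > 0" using quotient_of_div[OF nd] quotient_of_denom_pos[OF nd] by auto
  obtain d' where d': "d = 2 ^ multiplicity 2 d * d'" "\<not> 2 dvd d'"
    using multiplicity_decompose'[of d 2] q(2) by auto
  have "2 ^ multiplicity 2 d * q = 2 ^ 0 * of_int n / of_int d'"
    unfolding q(1) by (subst (2) d'(1)) (use d'(2) in auto)
  then show ?thesis using Z2_I[of d' 0 n] d'(2) by metis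
qed

section \<open>Ramified quadratic extensions\<close>

lemma uniform_bound:
  assumes "\<And>i. i < (s :: nat) \<Longrightarrow> \<exists>N :: nat. \<forall>k\<ge>N. Q i k"
  shows "\<exists>N. \<forall>i<s. \<forall>k\<ge>N. Q i k"
proof -
  obtain f where f: "\<And>i. i < s \<Longrightarrow> \<forall>k\<ge>f i. Q i k" using assms by metis
  have "f i \<le> sum f {..<s}" if "i < s" for i using that by (intro member_le_sum) auto
  then show ?thesis using f by (intro exI[of _ "sum f {..<s}"]) (meson order_trans)
qed

text \<open>The complex number r serves as a square root of a, so Q(r) is an honest field in which
  to compute; only its 2-adic structure matters. \<open>pi2\<close>, together with 2 lying in
  \<open>P 2\<close>, makes 2 and \<open>\<pi> ^ 2\<close> associates in the ring.\<close>

locale quadratic =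
  fixes a :: int and r \<pi> :: complex and \<epsilon> :: bool
  assumes r2: "r ^ 2 = of_int a"
    and indep: "of_rat u + of_rat v * r = 0 \<Longrightarrow> u = 0 \<and> v = 0"
    and pi_range: "\<exists>u v. \<pi> = of_rat u + of_rat v * r"
    and ring: "dyadic_ring {of_rat u + of_rat v * r | u v. u \<in> Z2 0 \<and> v \<in> Z2 0} \<pi> \<epsilon>"
    and pi2: "\<exists>u v. u \<in> Z2 0 \<and> v \<in> Z2 0 \<and> \<pi> ^ 2 = 2 * (of_rat u + of_rat v * r)"
begin

definition emb :: "rat \<Rightarrow> rat \<Rightarrow> complex" where "emb u v = of_rat u + of_rat v * r"

definition R :: "complex set" where "R = {emb u v | u v. u \<in> Z2 0 \<and> v \<in> Z2 0}"

sublocale dyadic_ring R \<pi> \<epsilon>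
  using ring by (simp add: R_def emb_def)

lemma emb_eq_iff: "emb u v = emb u' v' \<longleftrightarrow> u = u' \<and> v = v'"
  using indep[of "u - u'" "v - v'"] by (auto simp: emb_def of_rat_diff algebra_simps)

lemma emb_add: "emb u v + emb u' v' = emb (u + u') (v + v')"
  by (simp add: emb_def of_rat_add algebra_simps)

lemma emb_diff: "emb u v - emb u' v' = emb (u - u') (v - v')"
  by (simp add: emb_def of_rat_diff algebra_simps)

lemma emb_mult: "emb u v * emb u' v' = emb (u * u' + of_int a * v * v') (u * v' + v * u')"
proof -
  have "emb u v * emb u' v' = of_rat u * of_rat u' + (of_rat v * of_rat v') * r ^ 2
      + (of_rat u * of_rat v' + of_rat v * of_rat u') * r"
    by (simp add: emb_def algebra_simps power2_eq_square)
  then show ?thesis by (simp add: r2 emb_def of_rat_add of_rat_mult algebra_simps)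
qed

lemma emb_scale: "emb (q * u) (q * v) = of_rat q * emb u v"
  by (simp add: emb_def of_rat_mult algebra_simps)

lemma emb_0: "emb 0 0 = 0" and emb_1: "emb 1 0 = 1"
  by (simp_all add: emb_def)

lemma emb_mem: "emb u v \<in> R \<longleftrightarrow> u \<in> Z2 0 \<and> v \<in> Z2 0"
  by (auto simp: R_def emb_eq_iff)

lemma pi2_eq: "\<exists>h\<in>R. \<pi> ^ 2 = 2 * h"
  unfolding R_def emb_def using pi2 by blast

text \<open>2 and \<open>\<pi> ^ 2\<close> divide each other, so \<open>P (2 * k)\<close> consists
  of the multiples of 2^k. This links the ideals to the componentwise conditions in
  \<open>qvalid\<close> and \<open>qzero_el\<close>.\<close>

lemma emb_P: "emb u v \<in> P (2 * k) \<longleftrightarrow> u \<in> Z2 k \<and> v \<in> Z2 k"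
proof
  obtain h where h: "h \<in> R" "\<pi> ^ 2 = 2 * h" using pi2_eq by blast
  assume "emb u v \<in> P (2 * k)"
  then obtain y where y: "y \<in> R" "emb u v = \<pi> ^ (2 * k) * y" by (auto simp: P_def)
  have "h ^ k * y \<in> R" using h y by simp
  then obtain u' v' where u': "h ^ k * y = emb u' v'" "u' \<in> Z2 0" "v' \<in> Z2 0" by (auto simp: R_def)
  have "emb u v = 2 ^ k * (h ^ k * y)" unfolding y(2) power_mult h(2) by (simp add: power_mult_distrib)
  also have "\<dots> = emb (2 ^ k * u') (2 ^ k * v')" unfolding u'(1) by (simp add: emb_scale of_rat_power)
  finally show "u \<in> Z2 k \<and> v \<in> Z2 k"
    using Z2_shift[of k u' 0] Z2_shift[of k v' 0] u' by (simp add: emb_eq_iff)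
next
  obtain h where h: "h \<in> R" "2 = \<pi> ^ 2 * h" using two_P by (auto simp: P_def)
  assume uv: "u \<in> Z2 k \<and> v \<in> Z2 k"
  define u' v' where "u' = u / 2 ^ k" "v' = v / 2 ^ k"
  have e: "u = 2 ^ k * u'" "v = 2 ^ k * v'" by (auto simp: u'_v'_def)
  have "u' \<in> Z2 0" "v' \<in> Z2 0" using uv Z2_shift[of k u' 0] Z2_shift[of k v' 0] unfolding e by auto
  then have m: "emb u' v' \<in> R" by (simp add: emb_mem)
  have "emb u v = 2 ^ k * emb u' v'" unfolding e by (simp add: emb_scale of_rat_power)
  also have "\<dots> = \<pi> ^ (2 * k) * (h ^ k * emb u' v')"
    by (subst h(2)) (simp add: power_mult_distrib power_mult)
  finally show "emb u v \<in> P (2 * k)" using h(1) m by (simp add: P_I)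
qed

section \<open>Elements of K as sequences in the dense subfield\<close>

definition val :: "qelem \<Rightarrow> nat \<Rightarrow> complex" where "val x i = emb (fst x i) (snd x i)"

lemma qvalid_iff: "qvalid x \<longleftrightarrow> (\<forall>k. \<exists>N. \<forall>i\<ge>N. \<forall>j\<ge>N. val x i - val x j \<in> P k)"
proof
  assume "qvalid x"
  then have c: "cauchy2 (fst x)" "cauchy2 (snd x)" by (auto simp: qvalid_def)
  show "\<forall>k. \<exists>N. \<forall>i\<ge>N. \<forall>j\<ge>N. val x i - val x j \<in> P k"
  proof
    fix k
    obtain N M where N: "\<forall>i\<ge>N. \<forall>j\<ge>N. fst x i - fst x j \<in> Z2 k" "\<forall>i\<ge>M. \<forall>j\<ge>M. snd x i - snd x j \<in> Z2 k"
      using c unfolding cauchy2_iff by metis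
    have "val x i - val x j \<in> P k" if ij: "i \<ge> max N M" "j \<ge> max N M" for i j
    proof -
      have "val x i - val x j \<in> P (2 * k)" using N ij by (simp add: val_def emb_diff emb_P)
      then show ?thesis by (rule P_mono) simp
    qed
    then show "\<exists>N. \<forall>i\<ge>N. \<forall>j\<ge>N. val x i - val x j \<in> P k" by blast
  qed
next
  assume *: "\<forall>k. \<exists>N. \<forall>i\<ge>N. \<forall>j\<ge>N. val x i - val x j \<in> P k"
  have "\<exists>N. \<forall>i\<ge>N. \<forall>j\<ge>N. fst x i - fst x j \<in> Z2 k \<and> snd x i - snd x j \<in> Z2 k" for k
    using *[rule_format, of "2 * k"] by (simp add: val_def emb_diff emb_P)
  then show "qvalid x" unfolding qvalid_def cauchy2_iff by meson
qed

lemma qzero_iff: "qzero_el x \<longleftrightarrow> (\<forall>k. \<exists>N. \<forall>i\<ge>N. val x i \<in> P k)"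
proof
  assume "qzero_el x"
  then have c: "null2 (fst x)" "null2 (snd x)" by (auto simp: qzero_el_def)
  show "\<forall>k. \<exists>N. \<forall>i\<ge>N. val x i \<in> P k"
  proof
    fix k
    obtain N M where N: "\<forall>i\<ge>N. fst x i \<in> Z2 k" "\<forall>i\<ge>M. snd x i \<in> Z2 k"
      using c unfolding null2_iff by metis
    have "val x i \<in> P k" if i: "i \<ge> max N M" for i
    proof -
      have "val x i \<in> P (2 * k)" using N i by (simp add: val_def emb_P)
      then show ?thesis by (rule P_mono) simp
    qed
    then show "\<exists>N. \<forall>i\<ge>N. val x i \<in> P k" by blast
  qed
next
  assume *: "\<forall>k. \<exists>N. \<forall>i\<ge>N. val x i \<in> P k"
  have "\<exists>N. \<forall>i\<ge>N. fst x i \<in> Z2 k \<and> snd x i \<in> Z2 k" for k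
    using *[rule_format, of "2 * k"] by (simp add: val_def emb_P)
  then show "qzero_el x" unfolding qzero_el_def null2_iff by meson
qed

lemma val_simps:
  "val (qadd x y) i = val x i + val y i" "val (qmul a x y) i = val x i * val y i"
  "val qone i = 1" "val qnull i = 0"
  by (simp_all add: val_def qadd_def qmul_def qone_def qnull_def emb_add emb_mult emb_0 emb_1 ac_simps)

lemma val_qpow: "val (qpow a x k) i = val x i ^ k"
  by (induction k) (simp_all add: qpow_def val_simps)

lemma val_addform: "val (addform a d s c x) i = (\<Sum>j<s. val (c j) i * val (x j) i ^ d)"
proof -
  have "val (foldr (\<lambda>j acc. qadd (qmul a (c j) (qpow a (x j) d)) acc) js qnull) i
      = (\<Sum>j\<leftarrow>js. val (c j) i * val (x j) i ^ d)" for js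
    by (induction js) (simp_all add: val_simps val_qpow)
  then show ?thesis
    by (simp add: addform_def interv_sum_list_conv_sum_set_nat atLeast0LessThan)
qed

definition K :: "complex set" where "K = {emb u v | u v. True}"

lemma val_K: "val x i \<in> K"
  by (auto simp: K_def val_def)

lemma K_mult: "x \<in> K \<Longrightarrow> y \<in> K \<Longrightarrow> x * y \<in> K"
  unfolding K_def using emb_mult by blast

lemma R_K: "x \<in> R \<Longrightarrow> x \<in> K"
  by (auto simp: K_def R_def)

lemma inverse_pi_K: "inverse \<pi> \<in> K"
proof -
  obtain u v where uv: "\<pi> = emb u v" using pi_range by (auto simp: emb_def)
  define q where "q = u ^ 2 - of_int a * v ^ 2"
  have *: "\<pi> * emb u (- v) = of_rat q"
    unfolding uv emb_mult by (simp add: emb_def q_def power2_eq_square)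
  have "u \<noteq> 0 \<or> v \<noteq> 0" using uv pi_nz emb_0 by metis
  then have "emb u (- v) \<noteq> 0" using emb_eq_iff[of u "- v" 0 0] by (simp add: emb_0)
  then have "of_rat q \<noteq> (0 :: complex)" using * pi_nz by (metis mult_eq_0_iff)
  then have "inverse \<pi> = inverse (of_rat q) * emb u (- v)" using * by (simp add: field_simps)
  then have "inverse \<pi> = emb (inverse q * u) (inverse q * - v)" by (simp only: emb_scale of_rat_inverse)
  then show ?thesis unfolding K_def by blast
qed

lemma powi_K: "\<pi> powi e \<in> K"
proof -
  have "x ^ k \<in> K" if "x \<in> K" for x k
    by (induction k) (use that R_K[OF one_mem] K_mult in auto)
  then show ?thesis using inverse_pi_K R_K[OF pi_mem] by (auto simp: power_int_def)
qed

lemma ex_seq: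
  assumes "\<And>i. X i \<in> K"
  obtains x where "\<And>i. val x i = X i"
proof -
  have "\<forall>i. \<exists>p. X i = emb (fst p) (snd p)" using assms by (fastforce simp: K_def)
  then obtain p where "\<And>i. X i = emb (fst (p i)) (snd (p i))" by metis
  then have "val (\<lambda>i. fst (p i), \<lambda>i. snd (p i)) i = X i" for i by (simp add: val_def)
  then show ?thesis using that by blast
qed

section \<open>Orders of elements, anisotropy and isotropy over K\<close>

lemma unit_decomposition_R:
  assumes "x \<in> R" "x \<noteq> 0"
  shows "\<exists>k. \<exists>w\<in>U. x = \<pi> ^ k * w"
proof -
  obtain u v where uv: "x = emb u v" using assms by (auto simp: R_def)
  have "\<exists>k. x \<notin> P k"
  proof (rule ccontr)
    assume "\<not> (\<exists>k. x \<notin> P k)"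
    then have "u \<in> Z2 k \<and> v \<in> Z2 k" for k using emb_P[of u v k] uv by blast
    then have "u = 0" "v = 0" using Z2_all_zero by blast+
    then show False using assms uv emb_0 by simp
  qed
  then obtain k where k: "x \<notin> P k" "\<forall>j<k. x \<in> P j" using exists_least_iff[of "\<lambda>k. x \<notin> P k"] by blast
  then obtain l where l: "k = l + 1" using assms by (metis P_0 Suc_eq_plus1 not0_implies_Suc)
  then have "x \<in> P l" using k(2) by simp
  then obtain w where w: "w \<in> R" "x = \<pi> ^ l * w" unfolding P_def by blast
  then have "w \<notin> P 1" using k(1) l P_shift[of l w 1] by simp
  then show ?thesis using w by (auto simp: U_def)
qed

lemma unit_decomposition:
  assumes "x \<in> K" "x \<noteq> 0"
  obtains e w where "w \<in> U" "x = \<pi> powi e * w"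
proof -
  obtain u v where uv: "x = emb u v" using assms by (auto simp: K_def)
  obtain k l where kl: "2 ^ k * u \<in> Z2 0" "2 ^ l * v \<in> Z2 0" using Z2_clear_denominator by metis
  have "2 ^ l * (2 ^ k * u) \<in> Z2 0" "2 ^ k * (2 ^ l * v) \<in> Z2 0"
    using Z2_mult0[OF kl(1) Z2_of_int[of 0 "2 ^ l"]] Z2_mult0[OF kl(2) Z2_of_int[of 0 "2 ^ k"]] by (simp_all add: mult.commute)
  then have "emb (2 ^ (k + l) * u) (2 ^ (k + l) * v) \<in> R" by (simp add: emb_mem power_add ac_simps)
  then have "2 ^ (k + l) * x \<in> R" unfolding emb_scale uv by (simp add: of_rat_power)
  moreover obtain h where h: "h \<in> R" "\<pi> ^ 2 = 2 * h" using pi2_eq by blast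
  ultimately have "h ^ (k + l) * (2 ^ (k + l) * x) \<in> R" by simp
  then have "\<pi> ^ (2 * (k + l)) * x \<in> R" unfolding power_mult h(2) by (simp add: power_mult_distrib ac_simps)
  then obtain N where "\<pi> ^ N * x \<in> R" by blast
  moreover have "\<pi> ^ N * x \<noteq> 0" using assms(2) by simp
  ultimately obtain j w where w: "w \<in> U" "\<pi> ^ N * x = \<pi> ^ j * w" using unit_decomposition_R by blast
  have "x = \<pi> powi (int j - int N) * w"
    using w(2) by (simp add: power_int_diff field_simps)
  then show ?thesis using that w(1) by blast
qed

text \<open>A zero over K is evaluated at one late index, where it is an approximate zero over the
  dense subfield. Scaling by the smallest order among its coordinates makes it primitive, and
  padding with zeros covers all numbers of variables up to s.\<close>

lemma not_isotropicI:
  assumes d: "d > 0" and C: "\<And>i. C i \<in> K"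
    and nz: "\<And>y i0. (\<And>i. i < s \<Longrightarrow> y i \<in> R) \<Longrightarrow> i0 < s \<Longrightarrow> y i0 \<in> U \<Longrightarrow> (\<Sum>i<s. C i * y i ^ d) \<notin> P M"
    and s': "s' \<le> s"
  shows "\<not> all_forms_isotropic a d s'"
proof
  assume iso: "all_forms_isotropic a d s'"
  have "\<forall>i. \<exists>c. \<forall>j. val c j = C i" using ex_seq[of "\<lambda>_. C _"] C by metis
  then obtain c where c: "\<And>i j. val (c i) j = C i" by metis
  have "\<forall>i<s'. qvalid (c i)" by (simp add: qvalid_iff c)
  then obtain x i1 where x: "i1 < s'" "\<not> qzero_el (x i1)" "qzero_el (addform a d s' c x)"
    using iso unfolding all_forms_isotropic_def by blast
  obtain k where k: "\<forall>N. \<exists>i\<ge>N. val (x i1) i \<notin> P k" using x(2) unfolding qzero_iff by blast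
  \<comment> \<open>The smallest order will turn out to be below k, so scaling costs less than d * k
    and precision M survives.\<close>
  obtain N where N: "\<forall>j\<ge>N. (\<Sum>i<s'. C i * val (x i) j ^ d) \<in> P (M + d * k)"
    using x(3) unfolding qzero_iff val_addform c by blast
  obtain j where j: "j \<ge> N" "val (x i1) j \<notin> P k" using k by blast
  define X where "X i = val (x i) j" for i
  have XK: "X i \<in> K" for i by (simp add: X_def val_K)
  have sumX: "(\<Sum>i<s'. C i * X i ^ d) \<in> P (M + d * k)" using N j by (simp add: X_def)
  define S where "S = {i. i < s' \<and> X i \<noteq> 0}"
  have "\<forall>i\<in>S. \<exists>e. \<exists>w\<in>U. X i = \<pi> powi e * w" using unit_decomposition[OF XK] by (metis (mono_tags, lifting) S_def mem_Collect_eq)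
  then obtain e where "\<forall>i\<in>S. \<exists>w\<in>U. X i = \<pi> powi e i * w" by metis
  then obtain w where ew: "\<And>i. i \<in> S \<Longrightarrow> w i \<in> U \<and> X i = \<pi> powi e i * w i" by metis
  have i1: "i1 \<in> S" using x(1) j by (auto simp: S_def X_def)
  have fin: "finite S" by (simp add: S_def)
  have "Min (e ` S) \<in> e ` S" using fin i1 by (intro Min_in) auto
  then obtain i0 where i0: "i0 \<in> S" "e i0 = Min (e ` S)" by force
  have le: "e i0 \<le> e i" if "i \<in> S" for i unfolding i0(2) using fin that by simp
  have "e i1 < int k"
  proof (rule ccontr)
    assume "\<not> e i1 < int k"
    then have "X i1 \<in> P k" using P_powi[of "w i1" k "e i1"] ew[OF i1] by simp
    then show False using j by (simp add: X_def)
  qed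
  then have e0: "e i0 < int k" using le[OF i1] by simp
  define y where "y i = (if i < s' then X i * \<pi> powi (- e i0) else 0)" for i
  have y_S: "y i = \<pi> powi (e i - e i0) * w i" if "i \<in> S" for i
    using ew[OF that] that by (simp add: y_def S_def power_int_diff power_int_minus field_simps)
  have yR: "y i \<in> R" for i
  proof (cases "i \<in> S")
    case True
    have "\<pi> powi (e i - e i0) * w i \<in> P 0" by (rule P_powi) (use ew[OF True] le[OF True] in auto)
    then show ?thesis using y_S[OF True] by simp
  next
    case False
    then show ?thesis by (auto simp: y_def S_def)
  qed
  have "y i0 \<in> U" using y_S[OF i0(1)] ew[OF i0(1)] by simp
  moreover have "i0 < s" using i0 s' by (simp add: S_def)
  ultimately have "(\<Sum>i<s. C i * y i ^ d) \<notin> P M" using nz yR by blast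
  moreover have "(\<Sum>i<s. C i * y i ^ d) = \<pi> powi (- e i0 * int d) * (\<Sum>i<s'. C i * X i ^ d)"
  proof -
    have "(\<Sum>i<s. C i * y i ^ d) = (\<Sum>i<s'. C i * y i ^ d)"
      by (rule sum.mono_neutral_right) (use s' d in \<open>auto simp: y_def\<close>)
    also have "\<dots> = (\<Sum>i<s'. \<pi> powi (- e i0 * int d) * (C i * X i ^ d))"
      by (rule sum.cong) (auto simp: y_def power_mult_distrib powi_power)
    finally show ?thesis by (simp add: sum_distrib_left)
  qed
  moreover have "\<pi> powi (- e i0 * int d) * (\<Sum>i<s'. C i * X i ^ d) \<in> P M"
  proof -
    obtain z where z: "z \<in> R" "(\<Sum>i<s'. C i * X i ^ d) = \<pi> ^ (M + d * k) * z" using sumX unfolding P_def by blast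
    have "e i0 * int d \<le> int k * int d" using e0 by (intro mult_right_mono) auto
    then have "int M \<le> - e i0 * int d + int (M + d * k)" by (simp add: algebra_simps)
    then show ?thesis unfolding z(2) powi_mult_power by (rule P_powi[OF z(1)])
  qed
  ultimately show False by simp
qed

text \<open>Some late term lies outside \<open>P k\<close> while all later terms agree with it
  modulo \<open>P k\<close>, so the order v and the leading digit no longer change.\<close>

lemma nonzero_unit_part:
  assumes "qvalid x" "\<not> qzero_el x"
  shows "\<exists>v. (\<exists>N. \<forall>i\<ge>N. val x i * \<pi> powi (- v) \<in> U) \<and>
    (\<forall>k. \<exists>N. \<forall>i\<ge>N. \<forall>j\<ge>N. val x i * \<pi> powi (- v) - val x j * \<pi> powi (- v) \<in> P k)"
proof -
  obtain k where k: "\<forall>N. \<exists>i\<ge>N. val x i \<notin> P k" using assms(2) unfolding qzero_iff by blast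
  obtain N where N: "\<forall>i\<ge>N. \<forall>j\<ge>N. val x i - val x j \<in> P k" using assms(1) unfolding qvalid_iff by blast
  obtain n where n: "n \<ge> N" "val x n \<notin> P k" using k by blast
  then have "val x n \<noteq> 0" by auto
  then obtain v w where w: "w \<in> U" "val x n = \<pi> powi v * w" using unit_decomposition[OF val_K] by metis
  have v: "v < int k"
  proof (rule ccontr)
    assume "\<not> v < int k"
    then have "val x n \<in> P k" using P_powi[of w k v] w by simp
    then show False using n by simp
  qed
  have scale: "z * \<pi> powi (- v) \<in> P l" if h: "z \<in> P i" "int i - v \<ge> int l" for z i l
  proof -
    obtain q where q: "q \<in> R" "z = \<pi> ^ i * q" using h(1) unfolding P_def by blast
    have "z * \<pi> powi (- v) = \<pi> powi (int i - v) * q" unfolding q(2) by (simp add: power_int_diff power_int_minus field_simps)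
    then show ?thesis using P_powi[OF q(1) h(2)] by simp
  qed
  have "val x i * \<pi> powi (- v) \<in> U" if "i \<ge> N" for i
  proof (rule U_cong[OF w(1)])
    have "(val x i - val x n) * \<pi> powi (- v) \<in> P 1" using N that n v by (intro scale[of _ k]) auto
    moreover have "val x n * \<pi> powi (- v) = w" using w(2) by (simp add: power_int_minus)
    ultimately show "val x i * \<pi> powi (- v) - w \<in> P 1" by (simp add: algebra_simps)
  qed
  moreover have "\<exists>N. \<forall>i\<ge>N. \<forall>j\<ge>N. val x i * \<pi> powi (- v) - val x j * \<pi> powi (- v) \<in> P l" for l
  proof -
    obtain M where "\<forall>i\<ge>M. \<forall>j\<ge>M. val x i - val x j \<in> P (l + nat v)" using assms(1) unfolding qvalid_iff by blast
    then have "\<forall>i\<ge>M. \<forall>j\<ge>M. (val x i - val x j) * \<pi> powi (- v) \<in> P l" using scale[of _ "l + nat v" l] by auto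
    then show ?thesis by (intro exI[of _ M]) (simp add: algebra_simps)
  qed
  ultimately show ?thesis by blast
qed

lemma isotropic_zero_coeff:
  assumes "i < s" "qzero_el (c i)" "d > 0"
  shows "\<exists>x. (\<forall>i<s. qvalid (x i)) \<and> (\<exists>i<s. \<not> qzero_el (x i)) \<and> qzero_el (addform a d s c x)"
proof -
  let ?x = "\<lambda>j. if j = i then qone else qnull"
  have 1: "\<forall>j<s. qvalid (?x j)" by (simp add: qvalid_iff val_simps)
  have 2: "\<exists>j<s. \<not> qzero_el (?x j)"
    using assms(1) one_not_P by (intro exI[of _ i]) (auto simp: qzero_iff val_simps)
  have "val (addform a d s c ?x) n = val (c i) n" for n
  proof -
    have "val (addform a d s c ?x) n = (\<Sum>j<s. if j = i then val (c j) n else 0)"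
      unfolding val_addform by (rule sum.cong) (use assms(3) in \<open>auto simp: val_simps\<close>)
    then show ?thesis using assms(1) by simp
  qed
  then have "qzero_el (addform a d s c ?x)" using assms(2) by (simp add: qzero_iff)
  with 1 2 show ?thesis by (intro exI[of _ ?x] conjI)
qed

text \<open>The coefficients are split into a power of \<open>\<pi>\<close> and an eventually unit
  sequence. Freezing the units at a late index leaves a problem for \<open>approximate_zero\<close>,
  whose solution is then lifted in the single coordinate \<open>i0\<close>.\<close>

theorem isotropic:
  assumes m: "odd m" "m \<ge> 3" and s: "s = (if \<epsilon> then 2 * m + 1 else 3 * m)"
  shows "all_forms_isotropic a (2 * m) s"
  unfolding all_forms_isotropic_def
proof (intro allI impI)
  fix c assume c: "\<forall>i<s. qvalid (c i)"
  show "\<exists>x. (\<forall>i<s. qvalid (x i)) \<and> (\<exists>i<s. \<not> qzero_el (x i)) \<and> qzero_el (addform a (2 * m) s c x)"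
  proof (cases "\<exists>i<s. qzero_el (c i)")
    case True
    then show ?thesis using isotropic_zero_coeff[of _ s c "2 * m"] m by auto
  next
    case False
    then have "\<forall>i. \<exists>v. i < s \<longrightarrow> (\<exists>N. \<forall>j\<ge>N. val (c i) j * \<pi> powi (- v) \<in> U) \<and>
      (\<forall>k. \<exists>N. \<forall>j\<ge>N. \<forall>j'\<ge>N. val (c i) j * \<pi> powi (- v) - val (c i) j' * \<pi> powi (- v) \<in> P k)"
      using nonzero_unit_part c by metis
    then obtain v where v: "\<And>i. i < s \<Longrightarrow> (\<exists>N. \<forall>j\<ge>N. val (c i) j * \<pi> powi (- v i) \<in> U) \<and>
      (\<forall>k. \<exists>N. \<forall>j\<ge>N. \<forall>j'\<ge>N. val (c i) j * \<pi> powi (- v i) - val (c i) j' * \<pi> powi (- v i) \<in> P k)" by metis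
    define W where "W i j = val (c i) j * \<pi> powi (- v i)" for i j
    have val_c: "val (c i) j = \<pi> powi v i * W i j" for i j by (simp add: W_def power_int_minus)
    have W1: "\<exists>N. \<forall>j\<ge>N. W i j \<in> U" if "i < s" for i using v[OF that] by (simp add: W_def)
    have W2: "\<exists>N. \<forall>j\<ge>N. \<forall>j'\<ge>N. W i j - W i j' \<in> P k" if "i < s" for i k using v[OF that] by (simp add: W_def)
    obtain N1 where N1: "\<forall>i<s. \<forall>j\<ge>N1. W i j \<in> U" using uniform_bound[of s "\<lambda>i j. W i j \<in> U"] W1 by blast
    have W3: "\<exists>N. \<forall>i<s. \<forall>j\<ge>N. \<forall>j'\<ge>N. W i j - W i j' \<in> P k" for k
    proof -
      have "\<exists>N. \<forall>n\<ge>N. \<forall>j\<ge>n. \<forall>j'\<ge>n. W i j - W i j' \<in> P k" if "i < s" for i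
        using W2[OF that, of k] by (meson order_trans)
      then show ?thesis using uniform_bound[of s "\<lambda>i n. \<forall>j\<ge>n. \<forall>j'\<ge>n. W i j - W i j' \<in> P k"] by blast
    qed
    \<comment> \<open>Five digits of the unit parts are enough: every term used carries a factor of
      order at least t, and the sum is needed modulo \<open>P (t + 5)\<close>.\<close>
    obtain N2 where N2: "\<forall>i<s. \<forall>j\<ge>N2. \<forall>j'\<ge>N2. W i j - W i j' \<in> P 5" using W3 by blast
    define N0 where "N0 = max N1 N2"
    define u where "u i = W i N0" for i
    define lev where "lev i = nat (v i mod int (2 * m))" for i
    have lev: "lev i < 2 * m" "int (lev i) = v i mod int (2 * m)" for i
    proof -
      have D: "int (2 * m) > 0" using m by simp
      show "int (lev i) = v i mod int (2 * m)" using pos_mod_sign[OF D, of "v i"] by (simp add: lev_def)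
      then show "lev i < 2 * m" using pos_mod_bound[OF D, of "v i"] by linarith
    qed
    have u: "u i \<in> U" if "i < s" for i using N1 that by (simp add: u_def N0_def)
    have az: "\<exists>t A l w i0. A \<subseteq> {..<s} \<and> i0 \<in> A \<and> l i0 = t \<and>
      (\<forall>i\<in>A. w i \<in> U \<and> t \<le> l i \<and> l i mod (2 * m) = lev i) \<and>
      (\<Sum>i\<in>A. u i * \<pi> ^ l i * w i ^ (2 * m)) \<in> P (t + 5)"
      by (rule approximate_zero[OF m s lev(1) u])
    obtain t A l w i0 where A: "A \<subseteq> {..<s}" "i0 \<in> A" "l i0 = t"
      "\<forall>i\<in>A. w i \<in> U \<and> t \<le> l i \<and> l i mod (2 * m) = lev i"
      "(\<Sum>i\<in>A. u i * \<pi> ^ l i * w i ^ (2 * m)) \<in> P (t + 5)"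
      using az by (elim exE conjE) (rule that, assumption+)
    have finA: "finite A" using A(1) finite_subset by blast
    \<comment> \<open>The exponent of \<open>\<pi>\<close> in coordinate i that moves its term from
      order v i to the representative l i.\<close>
    define g where "g i = (int (l i) - v i) div int (2 * m)" for i
    have g: "v i + g i * int (2 * m) = int (l i)" if "i \<in> A" for i
    proof -
      have "int (l i) mod int (2 * m) = v i mod int (2 * m)" using A(4) that lev(2)[of i] by (metis of_nat_mod)
      then have "int (2 * m) dvd int (l i) - v i" by (simp add: mod_eq_dvd_iff)
      then show ?thesis by (simp add: g_def)
    qed
    have term_eq: "val (c i) j * (\<pi> powi g i * z) ^ (2 * m) = W i j * \<pi> ^ l i * z ^ (2 * m)" if "i \<in> A" for i j z
    proof -
      have "val (c i) j * (\<pi> powi g i * z) ^ (2 * m) = \<pi> powi (v i + g i * int (2 * m)) * (W i j * z ^ (2 * m))"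
        unfolding val_c power_mult_distrib powi_power by (subst power_int_add) (simp_all only: pi_nz ac_simps simp_thms)
      also have "\<dots> = \<pi> ^ l i * (W i j * z ^ (2 * m))" unfolding g[OF that] by simp
      finally show ?thesis by (simp add: ac_simps)
    qed
    define G where "G j = (\<Sum>i\<in>A - {i0}. W i j * \<pi> ^ l i * w i ^ (2 * m))" for j
    have G_full: "G j + W i0 j * \<pi> ^ t * w i0 ^ (2 * m) = (\<Sum>i\<in>A. W i j * \<pi> ^ l i * w i ^ (2 * m))" for j
      using sum.remove[OF finA A(2), of "\<lambda>i. W i j * \<pi> ^ l i * w i ^ (2 * m)"] A(3) by (simp add: G_def add.commute)
    have zero: "G j + W i0 j * \<pi> ^ t * w i0 ^ (2 * m) \<in> P (t + 5)" if "j \<ge> N0" for j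
    proof -
      have "(\<Sum>i\<in>A. (W i j - u i) * (\<pi> ^ l i * w i ^ (2 * m))) \<in> P (t + 5)"
      proof (rule P_sum)
        fix i assume i: "i \<in> A"
        have "W i j - u i \<in> P 5" using N2 that i A(1) by (auto simp: u_def N0_def)
        moreover have "\<pi> ^ l i * w i ^ (2 * m) \<in> P t" using A(4) i by (intro P_multR pi_P) auto
        ultimately show "(W i j - u i) * (\<pi> ^ l i * w i ^ (2 * m)) \<in> P (t + 5)"
          using P_mult[of "W i j - u i" 5 "\<pi> ^ l i * w i ^ (2 * m)" t] by (simp add: add.commute)
      qed
      from P_add[OF this A(5)] show ?thesis unfolding G_full sum.distrib[symmetric] by (simp add: algebra_simps)
    qed
    have G_cauchy: "\<exists>N. \<forall>i\<ge>N. \<forall>j\<ge>N. G i - G j \<in> P k" for k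
    proof -
      obtain N where N: "\<forall>i<s. \<forall>j\<ge>N. \<forall>j'\<ge>N. W i j - W i j' \<in> P k" using W3 by blast
      have "G j - G j' \<in> P k" if "j \<ge> N" "j' \<ge> N" for j j'
      proof -
        have "(\<Sum>i\<in>A - {i0}. (W i j - W i j') * (\<pi> ^ l i * w i ^ (2 * m))) \<in> P k"
          by (intro P_sum P_multR) (use N that A in auto)
        then show ?thesis unfolding G_def sum_subtractf[symmetric] by (simp add: algebra_simps)
      qed
      then show ?thesis by blast
    qed
    have i0: "i0 < s" "w i0 \<in> U" using A by auto
    obtain y where y: "\<And>k. y k \<in> U" "\<And>k. y (Suc k) - y k \<in> P (k + 3)"
      "\<And>k. \<exists>N. \<forall>i\<ge>N. G i + W i0 i * \<pi> ^ t * y k ^ (2 * m) \<in> P (t + 5 + k)"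
      using hensel[OF m(1) G_cauchy W2[OF i0(1)] _ i0(2) zero] N1 i0(1) by (metis N0_def max.bounded_iff)
    \<comment> \<open>Only the coordinate \<open>i0\<close> varies with the index j; the others are
      constant, and zero outside A.\<close>
    define X where "X i j = (if i = i0 then \<pi> powi g i0 * y j else if i \<in> A then \<pi> powi g i * w i else 0)" for i j
    have "X i j \<in> K" for i j
      using powi_K K_mult R_K y(1) A(4) by (auto simp: X_def)
    then have "\<forall>i. \<exists>x. \<forall>j. val x j = X i j" by (metis ex_seq)
    then obtain x where x: "\<And>i j. val (x i) j = X i j" by metis
    show ?thesis
    proof (intro exI[of _ x] conjI)
      show "\<forall>i<s. qvalid (x i)"
      proof (intro allI impI)
        fix i assume "i < s"
        show "qvalid (x i)"
        proof (cases "i = i0")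
          case False
          then show ?thesis by (simp add: qvalid_iff x X_def)
        next
          case True
          have "\<exists>N. \<forall>i\<ge>N. \<forall>j\<ge>N. \<pi> powi g i0 * y i - \<pi> powi g i0 * y j \<in> P k" for k
          proof -
            define N where "N = k + nat \<bar>g i0\<bar>"
            have "\<pi> powi g i0 * (y i - y N) \<in> P k" if iN: "i \<ge> N" for i
            proof -
              obtain z where z: "z \<in> R" "y i - y N = \<pi> ^ (N + 3) * z"
                using telescope_P[of y 3, OF y(2) iN] unfolding P_def by blast
              have "\<pi> powi g i0 * (y i - y N) = \<pi> powi (g i0 + int (N + 3)) * z"
                unfolding z(2) by (rule powi_mult_power)
              then show ?thesis using P_powi[OF z(1), of k "g i0 + int (N + 3)"] by (simp add: N_def)
            qed
            then have "\<pi> powi g i0 * (y i - y N) - \<pi> powi g i0 * (y j - y N) \<in> P k" if "i \<ge> N" "j \<ge> N" for i j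
              using that P_diff by blast
            then show ?thesis by (intro exI[of _ N]) (simp add: algebra_simps)
          qed
          then show ?thesis by (simp add: qvalid_iff x X_def True)
        qed
      qed
      have "\<not> qzero_el (x i0)"
      proof
        assume "qzero_el (x i0)"
        then obtain N where "\<forall>i\<ge>N. \<pi> powi g i0 * y i \<in> P (nat \<bar>g i0\<bar> + 1)" by (auto simp: qzero_iff x X_def)
        then have "\<pi> powi g i0 * y N \<in> P (nat \<bar>g i0\<bar> + 1)" by blast
        then obtain z where z: "z \<in> R" "\<pi> powi g i0 * y N = \<pi> ^ (nat \<bar>g i0\<bar> + 1) * z" unfolding P_def by blast
        have "y N = \<pi> powi (- g i0) * (\<pi> powi g i0 * y N)" by (simp add: power_int_minus)
        also have "\<dots> = \<pi> powi (- g i0 + int (nat \<bar>g i0\<bar> + 1)) * z"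
          unfolding z(2) by (rule powi_mult_power)
        also have "\<dots> \<in> P 1" by (rule P_powi[OF z(1)]) simp
        finally show False using y(1)[of N] by (simp add: U_def)
      qed
      then show "\<exists>i<s. \<not> qzero_el (x i)" using i0 by blast
      have form: "val (addform a (2 * m) s c x) j = G j + W i0 j * \<pi> ^ t * y j ^ (2 * m)" for j
      proof -
        have "val (addform a (2 * m) s c x) j = (\<Sum>i<s. val (c i) j * X i j ^ (2 * m))"
          unfolding val_addform x ..
        also have "\<dots> = (\<Sum>i\<in>A. val (c i) j * X i j ^ (2 * m))"
          by (rule sum.mono_neutral_right) (use A m in \<open>auto simp: X_def\<close>)
        also have "\<dots> = val (c i0) j * X i0 j ^ (2 * m) + (\<Sum>i\<in>A - {i0}. val (c i) j * X i j ^ (2 * m))"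
          by (rule sum.remove[OF finA A(2)])
        also have "val (c i0) j * X i0 j ^ (2 * m) = W i0 j * \<pi> ^ t * y j ^ (2 * m)"
          using term_eq[OF A(2)] A(3) by (simp add: X_def)
        also have "(\<Sum>i\<in>A - {i0}. val (c i) j * X i j ^ (2 * m)) = G j"
          unfolding G_def by (rule sum.cong) (use term_eq in \<open>auto simp: X_def\<close>)
        finally show ?thesis by (simp add: add.commute)
      qed
      show "qzero_el (addform a (2 * m) s c x)"
        unfolding qzero_iff form
      proof
        fix k
        obtain N where N: "\<forall>i\<ge>N. G i + W i0 i * \<pi> ^ t * y k ^ (2 * m) \<in> P (t + 5 + k)" using y(3) by blast
        \<comment> \<open>Diagonal step: y k is a good enough zero for all large i, and y i agrees
          with y k modulo \<open>P (k + 3)\<close>.\<close>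
        have "G i + W i0 i * \<pi> ^ t * y i ^ (2 * m) \<in> P k" if i: "i \<ge> max N (max k N0)" for i
        proof -
          have "y i - y k \<in> P (k + 3)" using telescope_P[of y 3, OF y(2), of k i] i by simp
          then have "y i ^ (2 * m) - y k ^ (2 * m) \<in> P (k + 3)" by (intro power_cong_P) (use y(1) in auto)
          then have "y i ^ (2 * m) - y k ^ (2 * m) \<in> P k" by (rule P_mono) simp
          moreover have "W i0 i \<in> R" using N1 i0 i by (simp add: N0_def)
          ultimately have "W i0 i * \<pi> ^ t * (y i ^ (2 * m) - y k ^ (2 * m)) \<in> P k" by (intro P_multR) auto
          moreover have "G i + W i0 i * \<pi> ^ t * y k ^ (2 * m) \<in> P k" using N i by (auto intro: P_mono)
          ultimately have "W i0 i * \<pi> ^ t * (y i ^ (2 * m) - y k ^ (2 * m)) + (G i + W i0 i * \<pi> ^ t * y k ^ (2 * m)) \<in> P k"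
            by (rule P_add)
          then show ?thesis by (simp add: algebra_simps)
        qed
        then show "\<exists>N. \<forall>i\<ge>N. G i + W i0 i * \<pi> ^ t * y i ^ (2 * m) \<in> P k" by blast
      qed
    qed
  qed
qed

theorem Gamma_star_eq:
  assumes m: "odd m" "m \<ge> 3"
  shows "Gamma_star a (2 * m) = (if \<epsilon> then 2 * m + 1 else 3 * m)" (is "_ = ?s")
  unfolding Gamma_star_def
proof (rule Least_equality)
  show "all_forms_isotropic a (2 * m) ?s" by (rule isotropic[OF m refl])
next
  fix s' assume iso: "all_forms_isotropic a (2 * m) s'"
  show "?s \<le> s'"
  proof (rule ccontr)
    assume "\<not> ?s \<le> s'"
    then have le: "s' \<le> ?s - 1" by simp
    show False
    proof (cases \<epsilon>)
      case True
      have "\<not> all_forms_isotropic a (2 * m) s'"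
      proof (rule not_isotropicI)
        show "(\<Sum>i<2 * m. \<pi> ^ i * y i ^ (2 * m)) \<notin> P (2 * m)"
          if "\<And>i. i < 2 * m \<Longrightarrow> y i \<in> R" "i0 < 2 * m" "y i0 \<in> U" for y i0
          using monomial_form_nonzero[of "2 * m" y i0] that by blast
      qed (use m le True R_K in auto)
      then show False using iso by blast
    next
      case False
      have "\<not> all_forms_isotropic a (2 * m) s'"
      proof (rule not_isotropicI)
        show "(\<Sum>i<3 * m - 1. triple_coeff m i * y i ^ (2 * m)) \<notin> P (2 * m + 2)"
          if "\<And>i. i < 3 * m - 1 \<Longrightarrow> y i \<in> R" "i0 < 3 * m - 1" "y i0 \<in> U" for y i0
          using triple_form_nonzero[OF m False, of y i0] that by blast
      qed (use m le False R_K in auto)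
      then show False using iso by blast
    qed
  qed
qed

end

section \<open>The six ramified quadratic extensions of the 2-adic numbers\<close>

lemma no_rational_sqrt:
  assumes "a < 0 \<or> (\<exists>b. odd b \<and> a = 2 * b)"
  shows "(q :: rat) ^ 2 \<noteq> of_int a"
proof
  assume q: "q ^ 2 = of_int a"
  then have "a \<ge> 0" by (metis of_int_0_le_iff zero_le_power2)
  then obtain b where b: "odd b" "a = 2 * b" using assms by auto
  obtain n d where nd: "quotient_of q = (n, d)" by fastforce
  have qd: "q = of_int n / of_int d" "d > 0" "coprime n d"
    using quotient_of_div[OF nd] quotient_of_denom_pos[OF nd] quotient_of_coprime[OF nd] by auto
  have "rat_of_int (n ^ 2) = of_int (2 * b * d ^ 2)"
    using q qd(1,2) b(2) by (simp add: field_simps)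
  then have eq: "n ^ 2 = 2 * b * d ^ 2" by (simp only: of_int_eq_iff)
  then have "even n" by (metis dvd_triv_left even_mult_iff even_power)
  then obtain k where "n = 2 * k" by blast
  then have "2 * k ^ 2 = b * d ^ 2" using eq by (simp add: power2_eq_square)
  then have "even (b * d ^ 2)" by (metis dvd_triv_left)
  then have "even d" using b(1) by simp
  then show False using \<open>even n\<close> qd(3) by (meson coprime_common_divisor odd_one)
qed

lemma sqrt_independent:
  assumes "a < 0 \<or> (\<exists>b. odd b \<and> a = 2 * b)" "r ^ 2 = of_int a" "of_rat u + of_rat v * r = (0 :: complex)"
  shows "u = 0 \<and> v = 0"
proof -
  have "v = 0"
  proof (rule ccontr)
    assume v: "v \<noteq> 0"
    have "of_rat v * r = - of_rat u" using assms(3) by (simp add: eq_neg_iff_add_eq_0 add.commute)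
    then have "r = of_rat (- u / v)" using v by (simp add: of_rat_divide of_rat_minus field_simps)
    then obtain q where "r = of_rat q" by blast
    then have "of_rat (q ^ 2) = (of_rat (of_int a) :: complex)" using assms(2) by (simp add: of_rat_power)
    then have "q ^ 2 = of_int a" by (simp only: of_rat_eq_iff)
    then show False using no_rational_sqrt[OF assms(1)] by blast
  qed
  then show ?thesis using assms(3) by simp
qed

definition quad_ring :: "complex \<Rightarrow> complex set" where
  "quad_ring r = {of_rat u + of_rat v * r | u v. u \<in> Z2 0 \<and> v \<in> Z2 0}"

lemma quad_ring_I: "u \<in> Z2 0 \<Longrightarrow> v \<in> Z2 0 \<Longrightarrow> of_rat u + of_rat v * r \<in> quad_ring r"
  by (auto simp: quad_ring_def)

lemma Z2_0_of_int: "of_int k \<in> Z2 0"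
  by (rule Z2_of_int) simp

lemma quad_ring_closed:
  assumes "r ^ 2 = of_int a"
  shows "1 \<in> quad_ring r" "x \<in> quad_ring r \<Longrightarrow> y \<in> quad_ring r \<Longrightarrow> x + y \<in> quad_ring r"
    "x \<in> quad_ring r \<Longrightarrow> - x \<in> quad_ring r"
    "x \<in> quad_ring r \<Longrightarrow> y \<in> quad_ring r \<Longrightarrow> x * y \<in> quad_ring r"
proof -
  show "1 \<in> quad_ring r" using quad_ring_I[OF Z2_0_of_int[of 1] Z2_zero] by simp
  {
    assume "x \<in> quad_ring r"
    then obtain u v where x: "x = of_rat u + of_rat v * r" "u \<in> Z2 0" "v \<in> Z2 0" by (auto simp: quad_ring_def)
    have "- x = of_rat (- u) + of_rat (- v) * r" using x by (simp add: of_rat_minus)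
    then show "- x \<in> quad_ring r" using x quad_ring_I Z2_uminus by metis
    assume "y \<in> quad_ring r"
    then obtain u' v' where y: "y = of_rat u' + of_rat v' * r" "u' \<in> Z2 0" "v' \<in> Z2 0" by (auto simp: quad_ring_def)
    have "x + y = of_rat (u + u') + of_rat (v + v') * r" using x y by (simp add: of_rat_add algebra_simps)
    then show "x + y \<in> quad_ring r" using x y quad_ring_I Z2_add by metis
    have "x * y = of_rat u * of_rat u' + (of_rat v * of_rat v') * r ^ 2 + (of_rat u * of_rat v' + of_rat v * of_rat u') * r"
      using x y by (simp add: algebra_simps power2_eq_square)
    then have "x * y = of_rat (u * u' + v * v' * of_int a) + of_rat (u * v' + v * u') * r"
      using assms by (simp add: of_rat_add of_rat_mult)
    moreover have "u * u' + v * v' * of_int a \<in> Z2 0" "u * v' + v * u' \<in> Z2 0"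
      using x y by (auto intro!: Z2_add Z2_mult0 Z2_0_of_int)
    ultimately show "x * y \<in> quad_ring r" using quad_ring_I by metis
  }
qed

lemma quad_ring_eq:
  assumes "a < 0 \<or> (\<exists>b. odd b \<and> a = 2 * b)" "r ^ 2 = of_int a" "of_rat u + of_rat v * r \<in> quad_ring r"
  shows "u \<in> Z2 0" "v \<in> Z2 0"
proof -
  obtain u' v' where h: "of_rat u + of_rat v * r = of_rat u' + of_rat v' * r" "u' \<in> Z2 0" "v' \<in> Z2 0"
    using assms(3) by (auto simp: quad_ring_def)
  have "of_rat (u - u') + of_rat (v - v') * r = 0" using h(1) by (simp add: of_rat_diff algebra_simps)
  from sqrt_independent[OF assms(1,2) this] show "u \<in> Z2 0" "v \<in> Z2 0" using h by auto
qed

lemma quadratic_even: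
  assumes "odd b" "r ^ 2 = of_int (2 * b)"
  shows "quadratic (2 * b) r r False"
proof -
  have a: "2 * b < 0 \<or> (\<exists>b'. odd b' \<and> 2 * b = 2 * b')" using assms(1) by auto
  have b0: "b \<noteq> 0" using assms(1) by auto
  have r0: "r \<noteq> 0" using assms(2) b0 by auto
  have inv: "1 / r = of_rat (1 / (2 * of_int b)) * r"
    using assms(2) r0 b0 by (simp add: of_rat_divide of_rat_mult field_simps power2_eq_square)
  note closed = quad_ring_closed[OF assms(2)]
  note half = Z2_half[OF assms(1)]
  have "dyadic_ring (quad_ring r) r False"
  proof
    show "r \<in> quad_ring r" using quad_ring_I[OF Z2_zero Z2_0_of_int[of 1]] by simp
    show "inverse r \<notin> quad_ring r"
    proof
      assume "inverse r \<in> quad_ring r"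
      then have "of_rat 0 + of_rat (1 / (2 * of_int b)) * r \<in> quad_ring r" using inv by (simp add: inverse_eq_divide)
      from quad_ring_eq(2)[OF a assms(2) this] show False using half_notin_Z2[OF assms(1)] by simp
    qed
    \<comment> \<open>Modulo r only u survives, so divisibility by r is evenness of u.\<close>
    have key: "x / r \<in> quad_ring r" if x: "x = of_rat u + of_rat v * r" "u \<in> Z2 1" "v \<in> Z2 0" for x u v
    proof -
      have "x / r = of_rat u * (1 / r) + of_rat v" unfolding x(1) using r0 by (simp add: field_simps)
      also have "\<dots> = of_rat v + of_rat (u / (2 * of_int b)) * r"
        unfolding inv by (simp add: of_rat_divide of_rat_mult)
      finally show ?thesis using quad_ring_I[OF x(3) half[OF x(2)]] by simp
    qed
    fix x assume "x \<in> quad_ring r"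
    then obtain u v where x: "x = of_rat u + of_rat v * r" "u \<in> Z2 0" "v \<in> Z2 0" by (auto simp: quad_ring_def)
    have "x - 1 = of_rat (u - 1) + of_rat v * r" unfolding x(1) by (simp add: of_rat_diff)
    then show "x / r \<in> quad_ring r \<or> (x - 1) / r \<in> quad_ring r" using Z2_residue[OF x(2)] key x by blast
  next
    obtain k where k: "1 - b = 2 * k" using assms(1) by (metis evenE odd_even_add odd_one add_diff_cancel_left' even_diff)
    \<comment> \<open>The solution of 2 = a + a^2 e for a = 2 b, namely (1 - b) / (2 b^2); the
      numerator is even because b is odd.\<close>
    define e where "e = rat_of_int k / of_int (b ^ 2)"
    have "e \<in> Z2 0" using Z2_I[of "b ^ 2" 0 k] assms(1) by (simp add: e_def)
    then have "of_rat e + of_rat 0 * r \<in> quad_ring r" by (intro quad_ring_I Z2_zero)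
    moreover have "2 = r ^ 2 + of_bool False * r ^ 3 + r ^ 4 * (of_rat e + of_rat 0 * r)"
    proof -
      have r4: "r ^ 4 = (of_int (2 * b)) ^ 2" unfolding assms(2)[symmetric] by (simp flip: power_mult)
      have "rat_of_int (2 * b) + (of_int (2 * b)) ^ 2 * e = of_int (2 * b + 4 * k)"
        using b0 by (simp add: e_def power2_eq_square field_simps)
      also have "2 * b + 4 * k = 2" using k by simp
      finally have "of_rat (rat_of_int (2 * b) + (of_int (2 * b)) ^ 2 * e) = (2 :: complex)" by simp
      then show ?thesis unfolding r4 assms(2) by (simp add: of_rat_add of_rat_mult of_rat_power)
    qed
    ultimately show "\<exists>e\<in>quad_ring r. 2 = r ^ 2 + of_bool False * r ^ 3 + r ^ 4 * e" by blast
  qed (use closed r0 in auto)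
  then show ?thesis
  proof (intro quadratic.intro)
    show "\<exists>u v. r = of_rat u + of_rat v * r" by (rule exI[of _ 0], rule exI[of _ 1]) simp
    show "\<exists>u v. u \<in> Z2 0 \<and> v \<in> Z2 0 \<and> r ^ 2 = 2 * (of_rat u + of_rat v * r)"
      using assms(2) by (intro exI[of _ "of_int b"] exI[of _ 0]) (simp add: Z2_0_of_int Z2_zero)
  qed (use assms(2) sqrt_independent[OF a assms(2)] in \<open>auto simp: quad_ring_def\<close>)
qed

text \<open>1 + r is a uniformizer because its norm 1 - a = 2 c is twice an odd number.\<close>

lemma quadratic_odd:
  assumes "odd c" "a = 1 - 2 * c" "a < 0" "r ^ 2 = of_int a"
    and e: "e \<in> quad_ring r" "2 = (1 + r) ^ 2 + (1 + r) ^ 3 + (1 + r) ^ 4 * e"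
  shows "quadratic a r (1 + r) True"
proof -
  have a: "a < 0 \<or> (\<exists>b'. odd b' \<and> a = 2 * b')" using assms(3) by auto
  have c0: "c \<noteq> 0" using assms(1) by auto
  have "(1 + r) * (1 - r) = 1 - r ^ 2" by (simp add: algebra_simps power2_eq_square)
  also have "\<dots> = of_int (1 - a)" unfolding assms(4) by simp
  also have "1 - a = 2 * c" using assms(2) by simp
  finally have norm: "(1 + r) * (1 - r) = of_int (2 * c)" .
  then have p0: "1 + r \<noteq> 0" using c0 by auto
  have inv: "1 / (1 + r) = of_rat (1 / (2 * of_int c)) * (1 - r)"
    using norm p0 c0 by (simp add: of_rat_divide of_rat_mult field_simps)
  note closed = quad_ring_closed[OF assms(4)]
  note half = Z2_half[OF assms(1)]
  have "dyadic_ring (quad_ring r) (1 + r) True"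
  proof
    show "1 + r \<in> quad_ring r" using quad_ring_I[OF Z2_0_of_int[of 1] Z2_0_of_int[of 1], of r] by simp
    show "inverse (1 + r) \<notin> quad_ring r"
    proof
      assume "inverse (1 + r) \<in> quad_ring r"
      then have "of_rat (1 / (2 * of_int c)) + of_rat (- (1 / (2 * of_int c))) * r \<in> quad_ring r"
        using inv by (simp only: inverse_eq_divide of_rat_minus) (simp add: algebra_simps)
      from quad_ring_eq(1)[OF a assms(4) this] show False using half_notin_Z2[OF assms(1)] by simp
    qed
    \<comment> \<open>r is congruent to -1 modulo 1 + r, so u + v r is congruent to u - v. The
      division itself multiplies by the conjugate 1 - r.\<close>
    have key: "x / (1 + r) \<in> quad_ring r" if x: "x = of_rat u + of_rat v * r" "u - v \<in> Z2 1" "v \<in> Z2 0" for x u v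
    proof -
      have "x * (1 - r) = of_rat u - of_rat v * r ^ 2 + (of_rat v - of_rat u) * r"
        unfolding x(1) by (simp add: algebra_simps power2_eq_square)
      also have "\<dots> = of_rat (u - v * of_int a) + of_rat (v - u) * r" unfolding assms(4)
        by (simp add: of_rat_diff of_rat_mult)
      finally have xr: "x * (1 - r) = of_rat (u - v * of_int a) + of_rat (v - u) * r" .
      have "x / (1 + r) = x * (1 / (1 + r))" by simp
      also have "\<dots> = of_rat (1 / (2 * of_int c)) * (x * (1 - r))" unfolding inv by (simp only: ac_simps)
      also have "\<dots> = of_rat ((u - v * of_int a) / (2 * of_int c)) + of_rat ((v - u) / (2 * of_int c)) * r"
        unfolding xr by (simp add: of_rat_divide of_rat_mult add_divide_distrib)
      finally have "x / (1 + r) = of_rat ((u - v * of_int a) / (2 * of_int c)) + of_rat ((v - u) / (2 * of_int c)) * r" .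
      moreover have "v - u \<in> Z2 1" using Z2_uminus[OF x(2)] by simp
      moreover have "u - v * of_int a \<in> Z2 1"
      proof -
        have "(u - v) + of_int (2 * c) * v \<in> Z2 1"
          by (intro Z2_add Z2_mult0 Z2_of_int x) simp
        then show ?thesis unfolding assms(2) by (simp add: algebra_simps)
      qed
      ultimately show ?thesis using half quad_ring_I by metis
    qed
    fix x assume "x \<in> quad_ring r"
    then obtain u v where x: "x = of_rat u + of_rat v * r" "u \<in> Z2 0" "v \<in> Z2 0" by (auto simp: quad_ring_def)
    have "x - 1 = of_rat (u - 1) + of_rat v * r" unfolding x(1) by (simp add: of_rat_diff)
    moreover have "u - v \<in> Z2 1 \<or> u - 1 - v \<in> Z2 1" using Z2_residue[OF Z2_diff[OF x(2,3)]] by (simp add: algebra_simps)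
    ultimately show "x / (1 + r) \<in> quad_ring r \<or> (x - 1) / (1 + r) \<in> quad_ring r" using key x by blast
  next
    show "\<exists>e\<in>quad_ring r. 2 = (1 + r) ^ 2 + of_bool True * (1 + r) ^ 3 + (1 + r) ^ 4 * e" using e by auto
  qed (use closed p0 in auto)
  then show ?thesis
  proof (intro quadratic.intro)
    show "\<exists>u v. 1 + r = of_rat u + of_rat v * r" by (rule exI[of _ 1], rule exI[of _ 1]) simp
    have "(1 + r) ^ 2 = 1 + r ^ 2 + 2 * r" by (simp add: power2_eq_square algebra_simps)
    also have "\<dots> = of_int (1 + a) + 2 * r" unfolding assms(4) by simp
    also have "1 + a = 2 * (1 - c)" using assms(2) by simp
    finally have "(1 + r) ^ 2 = 2 * (of_rat (of_int (1 - c)) + of_rat 1 * r)" by (simp add: of_rat_diff)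
    then show "\<exists>u v. u \<in> Z2 0 \<and> v \<in> Z2 0 \<and> (1 + r) ^ 2 = 2 * (of_rat u + of_rat v * r)"
      using Z2_0_of_int[of "1 - c"] Z2_0_of_int[of 1] by fastforce
  qed (use assms(4) sqrt_independent[OF a assms(4)] in \<open>auto simp: quad_ring_def\<close>)
qed

theorem theorem1:
  fixes m :: nat
  assumes "odd m" and "m \<ge> 3"
  shows "(\<forall>a \<in> {2, 10, -2, -10}. Gamma_star a (2*m) = 3 * (2*m) div 2)
       \<and> (\<forall>a \<in> {-1, -5}. Gamma_star a (2*m) = 2*m + 1)"
proof (intro conjI ballI)
  fix a :: int assume "a \<in> {2, 10, -2, -10}"
  then have "a = 2 * (a div 2)" "odd (a div 2)" by auto
  then obtain b where b: "odd b" "a = 2 * b" by blast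
  interpret quadratic a "csqrt (of_int a)" "csqrt (of_int a)" False
    unfolding b(2) by (rule quadratic_even[OF b(1)]) simp
  show "Gamma_star a (2*m) = 3 * (2*m) div 2" using Gamma_star_eq[OF assms] by simp
next
  fix a :: int assume a: "a \<in> {-1, -5}"
  define r where "r = csqrt (of_int a)"
  have r2: "r ^ 2 = of_int a" by (simp add: r_def)
  have p2: "(1 + r) ^ 2 = of_int (1 + a) + 2 * r" using r2 by (simp add: power2_eq_square algebra_simps)
  have p3: "(1 + r) ^ 3 = of_int (1 + 3 * a) + of_int (3 + a) * r"
    using r2 by (simp add: power3_eq_cube power2_eq_square algebra_simps)
  have p4: "(1 + r) ^ 4 = of_int (1 + 6 * a + a ^ 2) + of_int (4 * (1 + a)) * r"
    using r2 by (simp add: power4_eq_xxxx power2_eq_square algebra_simps) (simp flip: power2_eq_square mult.assoc)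
  have "quadratic a r (1 + r) True"
  proof (cases "a = -1")
    case True
    \<comment> \<open>With r^2 = -1 the second, third and fourth powers of 1 + r are 2 r, -2 + 2 r
      and -4, which forces e = -1 + r.\<close>
    have e: "of_rat (- 1) + of_rat 1 * r \<in> quad_ring r"
      using quad_ring_I[OF Z2_0_of_int[of "-1"] Z2_0_of_int[of 1], of r] by simp
    show ?thesis
      by (rule quadratic_odd[of 1, OF _ _ _ r2 e]) (unfold p2 p3 p4, use True in \<open>auto simp: algebra_simps\<close>)
  next
    case False
    then have a5: "a = -5" using a by simp
    \<comment> \<open>The equation becomes 20 = (-4 - 16 r) e, so e = -5 / (1 + 4 r), and 81 is the
      norm of 1 + 4 r.\<close>
    have e: "of_rat (- 5 / 81) + of_rat (20 / 81) * r \<in> quad_ring r"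
      using quad_ring_I[OF Z2_I[of 81 0 "-5"] Z2_I[of 81 0 20], of r] by simp
    have rr: "r * r = - 5" using r2 a5 by (simp add: power2_eq_square)
    have "(- 4 - 16 * r) * (- 5 / 81 + 20 / 81 * r) = (20 - 320 * (r * r)) / 81" by (simp add: field_simps)
    then have "2 = (- 4 + 2 * r) + (- 14 - 2 * r) + (- 4 - 16 * r) * (- 5 / 81 + 20 / 81 * r)"
      unfolding rr by simp
    then have "2 = (1 + r) ^ 2 + (1 + r) ^ 3 + (1 + r) ^ 4 * (of_rat (- 5 / 81) + of_rat (20 / 81) * r)"
      unfolding p2 p3 p4 a5 by (simp add: of_rat_divide of_rat_minus)
    then show ?thesis by (intro quadratic_odd[of 3, OF _ _ _ r2 e]) (use a5 in auto)
  qed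
  then interpret quadratic a r "1 + r" True .
  show "Gamma_star a (2*m) = 2*m + 1" using Gamma_star_eq[OF assms] by simp
qed

end
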